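(* Let $p>3$ be a prime, $N\ge5$ an integer not divisible by $p$, and $\Gamma=\Gamma_1(N)$. For every integer $k\ge0$ there is a Hecke-equivariant homomorphism $$\alpha_k:H^1(\Gamma,V_k)\to H^1(\Gamma,V_{k+(p-1)}),$$ given by the composite described in the context, such that $\alpha_0=\alpha$ is the map defined by Edixhoven and Khare.
   Context: $V_k=\mathrm{Sym}^k\overline{\mathbb{F}}_p^2$ is the space of homogeneous polynomials of degree $k$ in $\overline{\mathbb{F}}_p[X,Y]$; integral matrices act on $V_k$ through reduction mod $p$ and the substitution $\begin{pmatrix} a&b\\c&d\end{pmatrix}\cdot X=aX+cY$, $\begin{pmatrix} a&b\\c&d\end{pmatrix}\cdot Y=bX+dY$. Hecke-equivariant means commuting with the Hecke operators $T_r$, $p\nmid r$, acting on $H^1(\Gamma,-)$ in the usual way by double coset operators, integral matrices of determinant prime to $p$ acting on coefficients through reduction mod $p$. Construction of $\alpha_k$. Put $\Gamma_0=\Gamma\cap\Gamma_0(p)$, $g=\begin{pmatrix}p&0\\0&1\end{pmatrix}$, $g^*=\begin{pmatrix}1&0\\0&p\end{pmatrix}$. (i) $\beta':H^1(\Gamma,V_k)\to H^1(\Gamma_0,V_k)$ is induced by sending a cocycle $\zeta$ to the cocycle $x\mapsto g^*\cdot\zeta(gxg^{-1})$, $x\in\Gamma_0$. (ii) $\beta'':H^1(\Gamma_0,V_k)\simeq H^1(\Gamma,\mathrm{Ind}_{\Gamma_0}^{\Gamma}V_k)$ is Shapiro's isomorphism. (iii) $\mathrm{Ind}_{\Gamma_0}^\Gamma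 V_k\simeq\mathbb{F}_p[\Gamma/\Gamma_0]\otimes_{\mathbb{F}_p} V_k$ (diagonal action) is given by $f\mapsto\sum_i x_i\Gamma_0\otimes x_if(x_i\Gamma_0)$, with $x_1,\dots,x_{p+1}$ the left transversal $x_i=\begin{pmatrix}1&0\\ N(i-1)&1\end{pmatrix}$ ($1\le i\le p$), $x_{p+1}=\begin{pmatrix}Bp&-1\\ A N&1\end{pmatrix}$, where $A,B\in\mathbb{Z}$ and $AN+Bp=1$. (iv) $\mathbb{F}_p[\Gamma/\Gamma_0]\simeq\mathbb{F}_p[\mathbb{P}^1(\mathbb{F}_p)]$ via $x_i\mapsto(1:N(i-1))$ for $1\le i\le p$ and $x_{p+1}\mapsto(0:1)$. The module $\mathbb{F}_p[\mathbb{P}^1(\mathbb{F}_p)]$ is the direct sum of the constant functions and the functions with sum of values zero, the latter isomorphic to the degree $p-1$ homogeneous polynomials via $f\mapsto\sum_{[a:b]}f([a:b])(aX+bY)^{p-1}$. Hence $\mathbb{F}_p[\Gamma/\Gamma_0]\otimes V_k\simeq V_k\oplus(V_{p-1}\otimes V_k)$. (v) The resulting map $\beta:H^1(\Gamma,V_k)\to H^1(\Gamma,V_k)\oplus H^1(\Gamma,V_{p-1}\otimes V_k)$ is composed with projection to the second factor and with the map induced by polynomial multiplication $V_{p-1}\otimes V_k\to V_{k+(p-1)}$. The map $\alpha:H^1(\Gamma,V_0)\to H^1(\Gamma,V_{p-1})$ of Edixhoven and Khare is obtained from the restriction twisted by $g$, $H^1(\Gamma,V_0)\to H^1(\Gamma_0,V_0)$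 (class of $\zeta$ to class of $x\mapsto\zeta(gxg^{-1})$), followed by $H^1(\Gamma_0,V_0)\simeq H^1(\Gamma,V_0)\oplus H^1(\Gamma,V_{p-1})$ (from Shapiro's lemma and the decomposition $\mathbb{F}_p[\mathbb{P}^1(\mathbb{F}_p)]\otimes_{\mathbb{F}_p}V_0\simeq V_0\oplus V_{p-1}$ of functions on $\mathbb{P}^1(\mathbb{F}_p)$ into constant functions and functions with sum of values zero, the latter identified with $V_{p-1}$ via $f\mapsto\sum_{[a:b]}f([a:b])(aX+bY)^{p-1}$) and projection to the second summand. *)

theory Defs
  imports
    "HOL-Analysis.Determinants"
    "HOL-Computational_Algebra.Polynomial"
    "HOL-Algebra.Left_Coset"
    "HOL-Algebra.Free_Abelian_Groups"
    "HOL-Number_Theory.Cong"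
begin

section \<open>Modules with a group action and their first cohomology\<close>

text \<open>
  As for \<open>free_Abelian_group\<close>, the monoid part of a module is its additive group, so that
  \<open>\<otimes>\<close> below is the addition of the module.  The fields \<open>scal\<close> and \<open>gact\<close> are the
  multiplication by scalars and the left action of the group (or of a larger semigroup).
\<close>

record ('k, 'g, 'a) gmodule = "'a monoid" +
  scal :: "'k \<Rightarrow> 'a \<Rightarrow> 'a"
  gact :: "'g \<Rightarrow> 'a \<Rightarrow> 'a"

definition cocycles ::
  "('g, 'x) monoid_scheme \<Rightarrow> ('k, 'g, 'a, 'y) gmodule_scheme \<Rightarrow> ('g \<Rightarrow> 'a) set" where
  "cocycles G M = {z \<in> carrier G \<rightarrow>\<^sub>E carrier M.
     \<forall>x\<in>carrier G. \<forall>y\<in>carrier G. z (x \<otimes>\<^bsub>G\<^esub> y) = z x \<otimes>\<^bsub>M\<^esub> gact M x (z y)}"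

definition coboundaries ::
  "('g, 'x) monoid_scheme \<Rightarrow> ('k, 'g, 'a, 'y) gmodule_scheme \<Rightarrow> ('g \<Rightarrow> 'a) set" where
  "coboundaries G M =
     (\<lambda>m. \<lambda>x\<in>carrier G. gact M x m \<otimes>\<^bsub>M\<^esub> inv\<^bsub>M\<^esub> m) ` carrier M"

definition Z1 ::
  "('g, 'x) monoid_scheme \<Rightarrow> ('k, 'g, 'a, 'y) gmodule_scheme \<Rightarrow> ('g \<Rightarrow> 'a) monoid" where
  "Z1 G M = \<lparr>carrier = cocycles G M,
     monoid.mult = (\<lambda>z w. \<lambda>x\<in>carrier G. z x \<otimes>\<^bsub>M\<^esub> w x),
     one = (\<lambda>x\<in>carrier G. \<one>\<^bsub>M\<^esub>)\<rparr>"

definition H1 ::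
  "('g, 'x) monoid_scheme \<Rightarrow> ('k, 'g, 'a, 'y) gmodule_scheme \<Rightarrow> ('g \<Rightarrow> 'a) set monoid" where
  "H1 G M = Z1 G M Mod coboundaries G M"

text \<open>
  The map into \<open>H1 G M\<close> induced by a map \<open>\<Phi>\<close> on cocycles.  The union is over a family
  of equal cosets whenever \<open>\<Phi>\<close> is compatible with coboundaries.
\<close>

definition H1_map ::
  "('g, 'x) monoid_scheme \<Rightarrow> ('k, 'g, 'a, 'y) gmodule_scheme \<Rightarrow> ('z \<Rightarrow> 'g \<Rightarrow> 'a) \<Rightarrow>
     'z set \<Rightarrow> ('g \<Rightarrow> 'a) set" where
  "H1_map G M \<Phi> c = (\<Union>z\<in>c. coboundaries G M #>\<^bsub>Z1 G M\<^esub> \<Phi> z)"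

definition H1_coeff ::
  "('g, 'x) monoid_scheme \<Rightarrow> ('k, 'g, 'b, 'y) gmodule_scheme \<Rightarrow> ('a \<Rightarrow> 'b) \<Rightarrow>
     ('g \<Rightarrow> 'a) set \<Rightarrow> ('g \<Rightarrow> 'b) set" where
  "H1_coeff G M \<phi> = H1_map G M (\<lambda>z. \<lambda>x\<in>carrier G. \<phi> (z x))"

definition H1_scal ::
  "('g, 'x) monoid_scheme \<Rightarrow> ('k, 'g, 'a, 'y) gmodule_scheme \<Rightarrow> 'k \<Rightarrow>
     ('g \<Rightarrow> 'a) set \<Rightarrow> ('g \<Rightarrow> 'a) set" where
  "H1_scal G M c = H1_coeff G M (scal M c)"

text \<open>\<open>subgrp G H\<close> is the subgroup \<open>H\<close> of \<open>G\<close>, as a group.\<close>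

abbreviation subgrp :: "('g, 'x) monoid_scheme \<Rightarrow> 'g set \<Rightarrow> ('g, 'x) monoid_scheme" where
  "subgrp G H \<equiv> G\<lparr>carrier := H\<rparr>"

text \<open>
  Functions \<open>f\<close> on \<open>G\<close> with \<open>f (x h) = h\<^sup>-\<^sup>1 f x\<close> and \<open>(y f) x = f (y\<^sup>-\<^sup>1 x)\<close>; thus
  \<open>x f x\<close> only depends on the coset \<open>x H\<close>.
\<close>

definition Ind ::
  "('g, 'x) monoid_scheme \<Rightarrow> 'g set \<Rightarrow> ('k, 'g, 'a, 'y) gmodule_scheme \<Rightarrow>
     ('k, 'g, 'g \<Rightarrow> 'a) gmodule" where
  "Ind G H M = \<lparr>
     carrier = {f \<in> carrier G \<rightarrow>\<^sub>E carrier M.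
       \<forall>x\<in>carrier G. \<forall>h\<in>H. f (x \<otimes>\<^bsub>G\<^esub> h) = gact M (inv\<^bsub>G\<^esub> h) (f x)},
     monoid.mult = (\<lambda>f f'. \<lambda>x\<in>carrier G. f x \<otimes>\<^bsub>M\<^esub> f' x),
     one = (\<lambda>x\<in>carrier G. \<one>\<^bsub>M\<^esub>),
     scal = (\<lambda>c f. \<lambda>x\<in>carrier G. scal M c (f x)),
     gact = (\<lambda>y f. \<lambda>x\<in>carrier G. f (inv\<^bsub>G\<^esub> y \<otimes>\<^bsub>G\<^esub> x))\<rparr>"

text \<open>Shapiro's isomorphism is restriction to \<open>H\<close> followed by evaluation at the identity.\<close>

definition shapiro_eval ::
  "('g, 'x) monoid_scheme \<Rightarrow> 'g set \<Rightarrow> ('k, 'g, 'a, 'y) gmodule_scheme \<Rightarrow>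
     ('g \<Rightarrow> 'g \<Rightarrow> 'a) set \<Rightarrow> ('g \<Rightarrow> 'a) set" where
  "shapiro_eval G H M = H1_map (subgrp G H) M (\<lambda>z. \<lambda>x\<in>H. z x \<one>\<^bsub>G\<^esub>)"

definition shapiro ::
  "('g, 'x) monoid_scheme \<Rightarrow> 'g set \<Rightarrow> ('k, 'g, 'a, 'y) gmodule_scheme \<Rightarrow>
     ('g \<Rightarrow> 'a) set \<Rightarrow> ('g \<Rightarrow> 'g \<Rightarrow> 'a) set" where
  "shapiro G H M = inv_into (carrier (H1 G (Ind G H M))) (shapiro_eval G H M)"

text \<open>
  The module of \<open>M\<close>-valued functions on a \<open>G\<close>-set \<open>S\<close>.  For finite \<open>S\<close> and \<open>M\<close> a field
  with trivial action this is the permutation module, with basis the indicator functions.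
\<close>

definition fun_module ::
  "('g, 'x) monoid_scheme \<Rightarrow> 's set \<Rightarrow> ('g \<Rightarrow> 's \<Rightarrow> 's) \<Rightarrow> ('k, 'g, 'a, 'y) gmodule_scheme \<Rightarrow>
     ('k, 'g, 's \<Rightarrow> 'a) gmodule" where
  "fun_module G S sact M = \<lparr>
     carrier = S \<rightarrow>\<^sub>E carrier M,
     monoid.mult = (\<lambda>f f'. \<lambda>s\<in>S. f s \<otimes>\<^bsub>M\<^esub> f' s),
     one = (\<lambda>s\<in>S. \<one>\<^bsub>M\<^esub>),
     scal = (\<lambda>c f. \<lambda>s\<in>S. scal M c (f s)),
     gact = (\<lambda>y f. \<lambda>s\<in>S. gact M y (f (sact (inv\<^bsub>G\<^esub> y) s)))\<rparr>"

definition dsum ::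
  "('k, 'g, 'a, 'x) gmodule_scheme \<Rightarrow> ('k, 'g, 'b, 'y) gmodule_scheme \<Rightarrow>
     ('k, 'g, 'a \<times> 'b) gmodule" where
  "dsum M N = \<lparr>
     carrier = carrier M \<times> carrier N,
     monoid.mult = (\<lambda>(m, n) (m', n'). (m \<otimes>\<^bsub>M\<^esub> m', n \<otimes>\<^bsub>N\<^esub> n')),
     one = (\<one>\<^bsub>M\<^esub>, \<one>\<^bsub>N\<^esub>),
     scal = (\<lambda>c (m, n). (scal M c m, scal N c n)),
     gact = (\<lambda>y (m, n). (gact M y m, gact N y n))\<rparr>"

subsection \<open>Tensor products\<close>

text \<open>
  The tensor product over a ring \<open>K\<close> of scalars, as the free abelian group on pairs modulo the
  usual relations.
\<close>

definition tensor_relations ::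
  "'k set \<Rightarrow> ('k, 'g, 'a, 'x) gmodule_scheme \<Rightarrow> ('k, 'g, 'b, 'y) gmodule_scheme \<Rightarrow>
     ('a \<times> 'b \<Rightarrow>\<^sub>0 int) set" where
  "tensor_relations K M N =
     {frag_of (m \<otimes>\<^bsub>M\<^esub> m', n) - frag_of (m, n) - frag_of (m', n) | m m' n.
        m \<in> carrier M \<and> m' \<in> carrier M \<and> n \<in> carrier N} \<union>
     {frag_of (m, n \<otimes>\<^bsub>N\<^esub> n') - frag_of (m, n) - frag_of (m, n') | m n n'.
        m \<in> carrier M \<and> n \<in> carrier N \<and> n' \<in> carrier N} \<union>
     {frag_of (scal M c m, n) - frag_of (m, scal N c n) | c m n.
        c \<in> K \<and> m \<in> carrier M \<and> n \<in> carrier N}"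

definition tensor_group ::
  "'k set \<Rightarrow> ('k, 'g, 'a, 'x) gmodule_scheme \<Rightarrow> ('k, 'g, 'b, 'y) gmodule_scheme \<Rightarrow>
     ('a \<times> 'b \<Rightarrow>\<^sub>0 int) set monoid" where
  "tensor_group K M N =
     free_Abelian_group (carrier M \<times> carrier N) Mod
       generate (free_Abelian_group (carrier M \<times> carrier N)) (tensor_relations K M N)"

definition pure_tensor ::
  "'k set \<Rightarrow> ('k, 'g, 'a, 'x) gmodule_scheme \<Rightarrow> ('k, 'g, 'b, 'y) gmodule_scheme \<Rightarrow>
     'a \<Rightarrow> 'b \<Rightarrow> ('a \<times> 'b \<Rightarrow>\<^sub>0 int) set" where
  "pure_tensor K M N m n =
     generate (free_Abelian_group (carrier M \<times> carrier N)) (tensor_relations K M N)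
       #>\<^bsub>free_Abelian_group (carrier M \<times> carrier N)\<^esub> frag_of (m, n)"

text \<open>
  The homomorphism given on pure tensors by a biadditive \<open>K\<close>-balanced map \<open>f\<close>; its values outside
  the carrier are fixed by extensionality.
\<close>

definition tensor_lift ::
  "'k set \<Rightarrow> ('k, 'g, 'a, 'x) gmodule_scheme \<Rightarrow> ('k, 'g, 'b, 'y) gmodule_scheme \<Rightarrow>
     ('c, 'z) monoid_scheme \<Rightarrow> ('a \<Rightarrow> 'b \<Rightarrow> 'c) \<Rightarrow> ('a \<times> 'b \<Rightarrow>\<^sub>0 int) set \<Rightarrow> 'c" where
  "tensor_lift K M N L f = (THE h.
     h \<in> hom (tensor_group K M N) L \<inter> extensional (carrier (tensor_group K M N)) \<and>
     (\<forall>m\<in>carrier M. \<forall>n\<in>carrier N. h (pure_tensor K M N m n) = f m n))"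

text \<open>Diagonal action; the scalars act through the second factor.\<close>

definition tensor ::
  "'k set \<Rightarrow> ('k, 'g, 'a, 'x) gmodule_scheme \<Rightarrow> ('k, 'g, 'b, 'y) gmodule_scheme \<Rightarrow>
     ('k, 'g, ('a \<times> 'b \<Rightarrow>\<^sub>0 int) set) gmodule" where
  "tensor K M N = \<lparr>
     carrier = carrier (tensor_group K M N),
     monoid.mult = monoid.mult (tensor_group K M N),
     one = one (tensor_group K M N),
     scal = (\<lambda>c. tensor_lift K M N (tensor_group K M N)
       (\<lambda>m n. pure_tensor K M N m (scal N c n))),
     gact = (\<lambda>y. tensor_lift K M N (tensor_group K M N)
       (\<lambda>m n. pure_tensor K M N (gact M y m) (gact N y n)))\<rparr>"

section \<open>Integral matrices and congruence subgroups\<close>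

type_synonym imat = "int ^ 2 ^ 2"

definition mat2 :: "int \<Rightarrow> int \<Rightarrow> int \<Rightarrow> int \<Rightarrow> imat" where
  "mat2 a b c d = vector [vector [a, b], vector [c, d]]"

text \<open>The main involution \<open>A \<mapsto> det A \<cdot> A\<^sup>-\<^sup>1\<close>.\<close>

definition adj2 :: "imat \<Rightarrow> imat" where
  "adj2 A = mat2 (A$2$2) (- (A$1$2)) (- (A$2$1)) (A$1$1)"

definition Gamma1 :: "int \<Rightarrow> imat monoid" where
  "Gamma1 N = \<lparr>
     carrier = {A. det A = 1 \<and> [A$1$1 = 1] (mod N) \<and> [A$2$2 = 1] (mod N) \<and> [A$2$1 = 0] (mod N)},
     monoid.mult = (**),
     one = mat 1\<rparr>"

text \<open>The intersection of \<open>\<Gamma>\<^sub>1(N)\<close> and \<open>\<Gamma>\<^sub>0(p)\<close>.\<close>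

definition Gamma10 :: "int \<Rightarrow> nat \<Rightarrow> imat set" where
  "Gamma10 N p = {A \<in> carrier (Gamma1 N). [A$2$1 = 0] (mod int p)}"

definition gmat :: "nat \<Rightarrow> imat" where
  "gmat p = mat2 (int p) 0 0 1"

definition gstar :: "nat \<Rightarrow> imat" where
  "gstar p = mat2 1 0 0 (int p)"

text \<open>The integral matrix \<open>g x g\<^sup>-\<^sup>1\<close>, for \<open>x\<close> in \<open>\<Gamma>\<^sub>0(p)\<close>.\<close>

definition gconj :: "nat \<Rightarrow> imat \<Rightarrow> imat" where
  "gconj p x = (THE y. y ** gmat p = gmat p ** x)"

subsection \<open>Hecke operators\<close>

text \<open>
  \<open>T\<^sub>r\<close> is the operator of the union \<open>Hecke_set N r\<close> of \<open>\<Gamma>\<^sub>1(N)\<close>-double cosets (for a prime \<open>r\<close>,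
  the single double coset of \<open>diag(1, r)\<close>).  For representatives \<open>\<delta>\<close> of the left quotient by
  \<open>\<Gamma>\<^sub>1(N)\<close> and \<open>\<delta> x = \<gamma> \<delta>'\<close> with \<open>\<gamma>\<close> in \<open>\<Gamma>\<^sub>1(N)\<close>, it sends the class of \<open>z\<close> to that of
  \<open>x \<mapsto> \<Sum>\<^sub>\<delta> adj2 \<delta> \<cdot> z \<gamma>\<close> (Shimura).  The class does not depend on the representatives.
\<close>

definition Hecke_set :: "int \<Rightarrow> nat \<Rightarrow> imat set" where
  "Hecke_set N r = {A. det A = int r \<and> [A$1$1 = 1] (mod N) \<and> [A$2$1 = 0] (mod N)}"

definition is_Hecke_reps :: "int \<Rightarrow> nat \<Rightarrow> imat set \<Rightarrow> bool" where
  "is_Hecke_reps N r R \<longleftrightarrow> R \<subseteq> Hecke_set N r \<and>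
     (\<forall>A\<in>Hecke_set N r. \<exists>!d. d \<in> R \<and> (\<exists>y\<in>carrier (Gamma1 N). A = y ** d))"

definition Hecke_cochain ::
  "int \<Rightarrow> ('k, imat, 'a, 'y) gmodule_scheme \<Rightarrow> imat set \<Rightarrow> (imat \<Rightarrow> 'a) \<Rightarrow> imat \<Rightarrow> 'a" where
  "Hecke_cochain N M R z = (\<lambda>x\<in>carrier (Gamma1 N).
     finprod M (\<lambda>d. gact M (adj2 d)
       (z (THE y. y \<in> carrier (Gamma1 N) \<and> (\<exists>d'\<in>R. d ** x = y ** d')))) R)"

definition Hecke_T ::
  "int \<Rightarrow> ('k, imat, 'a, 'y) gmodule_scheme \<Rightarrow> nat \<Rightarrow> (imat \<Rightarrow> 'a) set \<Rightarrow> (imat \<Rightarrow> 'a) set" where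
  "Hecke_T N M r =
     H1_map (Gamma1 N) M (Hecke_cochain N M (SOME R. is_Hecke_reps N r R))"

section \<open>Coefficient modules\<close>

text \<open>
  \<open>F[X, Y]\<close> is \<open>(F[X])[Y]\<close>: the coefficient of \<open>X\<^sup>i Y\<^sup>j\<close> in \<open>P\<close> is \<open>coeff (coeff P j) i\<close>.
\<close>

type_synonym 'F bpoly = "'F poly poly"

definition bconst :: "'F::field \<Rightarrow> 'F bpoly" where
  "bconst c = [:[:c:]:]"

definition bX :: "'F::field bpoly" where
  "bX = [:[:0, 1:]:]"

definition bY :: "'F::field bpoly" where
  "bY = [:0, 1:]"

text \<open>The value of \<open>P\<close> at \<open>X = u\<close>, \<open>Y = v\<close>.\<close>

definition bsubst :: "'F::field bpoly \<Rightarrow> 'F bpoly \<Rightarrow> 'F bpoly \<Rightarrow> 'F bpoly" where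
  "bsubst P u v = poly (map_poly (\<lambda>q. poly (map_poly bconst q) u) P) v"

definition mat_bact :: "imat \<Rightarrow> 'F::field bpoly \<Rightarrow> 'F bpoly" where
  "mat_bact A P = bsubst P
     (bconst (of_int (A$1$1)) * bX + bconst (of_int (A$2$1)) * bY)
     (bconst (of_int (A$1$2)) * bX + bconst (of_int (A$2$2)) * bY)"

definition Vk :: "nat \<Rightarrow> ('F::field, imat, 'F bpoly) gmodule" where
  "Vk k = \<lparr>
     carrier = {P. \<forall>i j. coeff (coeff P j) i \<noteq> 0 \<longrightarrow> i + j = k},
     monoid.mult = (+),
     one = 0,
     scal = (\<lambda>c P. bconst c * P),
     gact = mat_bact\<rparr>"

definition prime_subfield :: "'F::field set" where
  "prime_subfield = range of_int"

definition Fp_module :: "('F::field, 'g, 'F) gmodule" where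
  "Fp_module = \<lparr>carrier = prime_subfield, monoid.mult = (+), one = 0,
     scal = (*), gact = (\<lambda>_ c. c)\<rparr>"

text \<open>Points of the projective line over \<open>F\<^sub>p\<close>, as classes of pairs modulo nonzero scalars.\<close>

definition proj_pt :: "'F::field \<Rightarrow> 'F \<Rightarrow> ('F \<times> 'F) set" where
  "proj_pt a b = {(c * a, c * b) | c. c \<in> prime_subfield - {0}}"

definition proj_line :: "('F::field \<times> 'F) set set" where
  "proj_line = {proj_pt a b | a b. a \<in> prime_subfield \<and> b \<in> prime_subfield \<and> (a, b) \<noteq> (0, 0)}"

definition mat_proj :: "imat \<Rightarrow> ('F::field \<times> 'F) set \<Rightarrow> ('F \<times> 'F) set" where
  "mat_proj A = image (\<lambda>(a, b).
     (of_int (A$1$1) * a + of_int (A$1$2) * b, of_int (A$2$1) * a + of_int (A$2$2) * b))"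

definition Fp_cosets :: "int \<Rightarrow> nat \<Rightarrow> ('F::field, imat, imat set \<Rightarrow> 'F) gmodule" where
  "Fp_cosets N p =
     fun_module (Gamma1 N) (lcosets\<^bsub>Gamma1 N\<^esub> (Gamma10 N p)) (l_coset (Gamma1 N)) Fp_module"

definition Fp_proj_line :: "int \<Rightarrow> ('F::field, imat, ('F \<times> 'F) set \<Rightarrow> 'F) gmodule" where
  "Fp_proj_line N = fun_module (Gamma1 N) proj_line mat_proj Fp_module"

text \<open>The form \<open>(a X + b Y)\<^sup>p\<^sup>-\<^sup>1\<close> of a point \<open>(a : b)\<close>; it does not depend on the chosen pair.\<close>

definition line_power :: "nat \<Rightarrow> ('F::field \<times> 'F) set \<Rightarrow> 'F bpoly" where
  "line_power p P = (case SOME v. v \<in> P of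
     (a, b) \<Rightarrow> (bconst a * bX + bconst b * bY) ^ (p - 1))"

text \<open>
  The components \<open>(c, h)\<close> of a function on \<open>S\<close> in the decomposition into constant functions and
  functions with sum of values zero.
\<close>

definition const_zero_split :: "'s set \<Rightarrow> ('s \<Rightarrow> 'v::ab_group_add) \<Rightarrow> 'v \<times> ('s \<Rightarrow> 'v)" where
  "const_zero_split S f = (THE (c, h).
     h \<in> extensional S \<and> sum h S = 0 \<and> (\<forall>s\<in>S. f s = c + h s))"

section \<open>The maps \<open>\<alpha>\<^sub>k\<close>\<close>

definition beta1 ::
  "int \<Rightarrow> nat \<Rightarrow> nat \<Rightarrow> (imat \<Rightarrow> 'F::field bpoly) set \<Rightarrow> (imat \<Rightarrow> 'F bpoly) set" where
  "beta1 N p k = H1_map (subgrp (Gamma1 N) (Gamma10 N p)) (Vk k)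
     (\<lambda>z. \<lambda>x\<in>Gamma10 N p. mat_bact (gstar p) (z (gconj p x)))"

definition beta2 ::
  "int \<Rightarrow> nat \<Rightarrow> nat \<Rightarrow> (imat \<Rightarrow> 'F::field bpoly) set \<Rightarrow> (imat \<Rightarrow> imat \<Rightarrow> 'F bpoly) set" where
  "beta2 N p k = shapiro (Gamma1 N) (Gamma10 N p) (Vk k)"

text \<open>The transversal \<open>x\<^sub>1, \<dots>, x\<^sub>p\<^sub>+\<^sub>1\<close> and the corresponding points of the projective line.\<close>

definition transv :: "int \<Rightarrow> nat \<Rightarrow> int \<Rightarrow> int \<Rightarrow> nat \<Rightarrow> imat" where
  "transv N p A B i =
     (if i \<le> p then mat2 1 0 (N * (int i - 1)) 1 else mat2 (B * int p) (-1) (A * N) 1)"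

definition transv_pt :: "int \<Rightarrow> nat \<Rightarrow> nat \<Rightarrow> ('F::field \<times> 'F) set" where
  "transv_pt N p i = (if i \<le> p then proj_pt 1 (of_int (N * (int i - 1))) else proj_pt 0 1)"

definition transv_coset :: "int \<Rightarrow> nat \<Rightarrow> int \<Rightarrow> int \<Rightarrow> nat \<Rightarrow> imat set" where
  "transv_coset N p A B i = transv N p A B i <#\<^bsub>Gamma1 N\<^esub> Gamma10 N p"

text \<open>\<open>f \<mapsto> \<Sum>\<^sub>i x\<^sub>i\<Gamma>\<^sub>0 \<otimes> x\<^sub>i f(x\<^sub>i)\<close>, the basis element of a coset being its indicator function.\<close>

definition ind_to_tensor ::
  "int \<Rightarrow> nat \<Rightarrow> int \<Rightarrow> int \<Rightarrow> nat \<Rightarrow> (imat \<Rightarrow> 'F::field bpoly) \<Rightarrow>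
     ((imat set \<Rightarrow> 'F) \<times> 'F bpoly \<Rightarrow>\<^sub>0 int) set" where
  "ind_to_tensor N p A B k f =
     finprod (tensor prime_subfield (Fp_cosets N p) (Vk k))
       (\<lambda>i. pure_tensor prime_subfield (Fp_cosets N p) (Vk k)
          (\<lambda>C\<in>lcosets\<^bsub>Gamma1 N\<^esub> (Gamma10 N p). if C = transv_coset N p A B i then 1 else 0)
          (mat_bact (transv N p A B i) (f (transv N p A B i))))
       {1..p + 1}"

text \<open>The linear map with \<open>x\<^sub>i\<Gamma>\<^sub>0 \<mapsto> transv_pt N p i\<close>.\<close>

definition cosets_to_proj ::
  "int \<Rightarrow> nat \<Rightarrow> int \<Rightarrow> int \<Rightarrow> (imat set \<Rightarrow> 'F::field) \<Rightarrow> ('F \<times> 'F) set \<Rightarrow> 'F" where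
  "cosets_to_proj N p A B f =
     (\<lambda>P\<in>proj_line. \<Sum>i | i \<in> {1..p + 1} \<and> transv_pt N p i = P. f (transv_coset N p A B i))"

definition cosets_to_proj_tensor ::
  "int \<Rightarrow> nat \<Rightarrow> int \<Rightarrow> int \<Rightarrow> nat \<Rightarrow> ((imat set \<Rightarrow> 'F::field) \<times> 'F bpoly \<Rightarrow>\<^sub>0 int) set \<Rightarrow>
     ((('F \<times> 'F) set \<Rightarrow> 'F) \<times> 'F bpoly \<Rightarrow>\<^sub>0 int) set" where
  "cosets_to_proj_tensor N p A B k =
     tensor_lift prime_subfield (Fp_cosets N p) (Vk k)
       (tensor prime_subfield (Fp_proj_line N) (Vk k))
       (\<lambda>f v. pure_tensor prime_subfield (Fp_proj_line N) (Vk k) (cosets_to_proj N p A B f) v)"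

definition proj_poly :: "nat \<Rightarrow> (('F::field \<times> 'F) set \<Rightarrow> 'F) \<Rightarrow> 'F bpoly" where
  "proj_poly p f = (\<Sum>P\<in>proj_line. bconst (f P) * line_power p P)"

text \<open>
  The module \<open>V\<^sub>k \<oplus> (V\<^sub>p\<^sub>-\<^sub>1 \<otimes> V\<^sub>k)\<close>; the tensor product in it is over the whole field.
\<close>

definition split_target ::
  "nat \<Rightarrow> nat \<Rightarrow> ('F::field, imat, 'F bpoly \<times> ('F bpoly \<times> 'F bpoly \<Rightarrow>\<^sub>0 int) set) gmodule" where
  "split_target p k = dsum (Vk k) (tensor UNIV (Vk (p - 1)) (Vk k))"

definition proj_split ::
  "int \<Rightarrow> nat \<Rightarrow> nat \<Rightarrow> ((('F::field \<times> 'F) set \<Rightarrow> 'F) \<times> 'F bpoly \<Rightarrow>\<^sub>0 int) set \<Rightarrow>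
     'F bpoly \<times> ('F bpoly \<times> 'F bpoly \<Rightarrow>\<^sub>0 int) set" where
  "proj_split N p k =
     tensor_lift prime_subfield (Fp_proj_line N) (Vk k) (split_target p k)
       (\<lambda>f v. case const_zero_split proj_line f of
          (c, h) \<Rightarrow> (bconst c * v, pure_tensor UNIV (Vk (p - 1)) (Vk k) (proj_poly p h) v))"

definition beta ::
  "int \<Rightarrow> nat \<Rightarrow> int \<Rightarrow> int \<Rightarrow> nat \<Rightarrow> (imat \<Rightarrow> 'F::field bpoly) set \<Rightarrow>
     (imat \<Rightarrow> 'F bpoly) set \<times> (imat \<Rightarrow> ('F bpoly \<times> 'F bpoly \<Rightarrow>\<^sub>0 int) set) set" where
  "beta N p A B k x =
    (let y = beta2 N p k (beta1 N p k x);
         u = H1_coeff (Gamma1 N) (tensor prime_subfield (Fp_cosets N p) (Vk k))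
               (ind_to_tensor N p A B k) y;
         v = H1_coeff (Gamma1 N) (tensor prime_subfield (Fp_proj_line N) (Vk k))
               (cosets_to_proj_tensor N p A B k) u;
         w = H1_coeff (Gamma1 N) (split_target p k) (proj_split N p k) v
     in (H1_coeff (Gamma1 N) (Vk k) fst w,
         H1_coeff (Gamma1 N) (tensor UNIV (Vk (p - 1)) (Vk k)) snd w))"

definition alpha ::
  "int \<Rightarrow> nat \<Rightarrow> int \<Rightarrow> int \<Rightarrow> nat \<Rightarrow> (imat \<Rightarrow> 'F::field bpoly) set \<Rightarrow> (imat \<Rightarrow> 'F bpoly) set" where
  "alpha N p A B k x =
     H1_coeff (Gamma1 N) (Vk (k + (p - 1)))
       (tensor_lift UNIV (Vk (p - 1)) (Vk k) (Vk (k + (p - 1))) (\<lambda>P Q. P * Q))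
       (snd (beta N p A B k x))"

subsection \<open>The map of Edixhoven and Khare\<close>

definition EK_restrict ::
  "int \<Rightarrow> nat \<Rightarrow> (imat \<Rightarrow> 'F::field bpoly) set \<Rightarrow> (imat \<Rightarrow> 'F bpoly) set" where
  "EK_restrict N p = H1_map (subgrp (Gamma1 N) (Gamma10 N p)) (Vk 0)
     (\<lambda>z. \<lambda>x\<in>Gamma10 N p. z (gconj p x))"

text \<open>
  \<open>F\<^sub>p[P\<^sup>1(F\<^sub>p)] \<otimes> V\<^sub>0\<close> is the module of \<open>V\<^sub>0\<close>-valued functions on \<open>P\<^sup>1(F\<^sub>p)\<close>.  As \<open>V\<^sub>0\<close> has
  trivial action, the elements of \<open>Ind\<close> are functions on \<open>\<Gamma>/\<Gamma>\<^sub>0\<close>, which is identified with the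
  projective line through \<open>x\<Gamma>\<^sub>0 \<mapsto> x (1 : 0)\<close>.
\<close>

definition EK_proj_module ::
  "int \<Rightarrow> ('F::field, imat, ('F \<times> 'F) set \<Rightarrow> 'F bpoly) gmodule" where
  "EK_proj_module N = fun_module (Gamma1 N) proj_line mat_proj (Vk 0)"

definition EK_ind_to_proj ::
  "int \<Rightarrow> (imat \<Rightarrow> 'F::field bpoly) \<Rightarrow> ('F \<times> 'F) set \<Rightarrow> 'F bpoly" where
  "EK_ind_to_proj N f =
     (\<lambda>P\<in>proj_line. f (SOME x. x \<in> carrier (Gamma1 N) \<and> mat_proj x (proj_pt 1 0) = P))"

definition EK_split ::
  "nat \<Rightarrow> (('F::field \<times> 'F) set \<Rightarrow> 'F bpoly) \<Rightarrow> 'F bpoly \<times> 'F bpoly" where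
  "EK_split p f = (case const_zero_split proj_line f of
     (c, h) \<Rightarrow> (c, \<Sum>P\<in>proj_line. h P * line_power p P))"

definition alpha_EK ::
  "int \<Rightarrow> nat \<Rightarrow> (imat \<Rightarrow> 'F::field bpoly) set \<Rightarrow> (imat \<Rightarrow> 'F bpoly) set" where
  "alpha_EK N p x =
    (let y = shapiro (Gamma1 N) (Gamma10 N p) (Vk 0) (EK_restrict N p x);
         v = H1_coeff (Gamma1 N) (EK_proj_module N) (EK_ind_to_proj N) y;
         w = H1_coeff (Gamma1 N) (dsum (Vk 0) (Vk (p - 1))) (EK_split p) v
     in H1_coeff (Gamma1 N) (Vk (p - 1)) snd w)"

section \<open>Algebraic closures of the prime field\<close>

definition is_Fp_closure :: "'F::alg_closed_field itself \<Rightarrow> nat \<Rightarrow> bool" where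
  "is_Fp_closure _ p \<longleftrightarrow> CHAR('F) = p \<and>
     (\<forall>x::'F. \<exists>f::'F poly. f \<noteq> 0 \<and> (\<forall>i. coeff f i \<in> prime_subfield) \<and> poly f x = 0)"

end

theory Submission
  imports Defs
begin

text \<open>
  Write \<open>g = diag(p, 1)\<close> and \<open>g\<^sup>* = diag(1, p)\<close>, and let \<open>x\<^sub>i\<close> run through the transversal.  The whole
  composite defining \<open>alpha\<close> is computed on cocycles (\<open>alpha_class\<close>): it sends the class of \<open>z\<close> to
  the class of

  \<open>x \<mapsto> \<Sum>\<^sub>i x\<^sub>i (X\<^sup>p\<^sup>-\<^sup>1 \<cdot> g\<^sup>* z(g e g\<^sup>-\<^sup>1))\<close>, where \<open>e = x\<^sub>i\<^sup>-\<^sup>1 x x\<^sub>j\<close> lies in \<open>\<Gamma>\<^sub>0\<close>,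

  the index \<open>j\<close> being determined by \<open>i\<close> and \<open>x\<close>.  Two facts give this formula.  First, the inverse
  of Shapiro's isomorphism is explicit on cocycles once a transversal is chosen (\<open>shapiro_class\<close>).
  Second, the sum of \<open>(a X + b Y)\<^sup>p\<^sup>-\<^sup>1\<close> over all points \<open>(a : b)\<close> vanishes (\<open>sum_line_power\<close>), so
  that the splitting into constants and functions of sum zero leaves no trace: the indicator
  function of \<open>x\<^sub>i (1 : 0)\<close> and its part of sum zero have the same image, which is \<open>x\<^sub>i X\<^sup>p\<^sup>-\<^sup>1\<close>.  Hence the
  module maps compose to \<open>f \<mapsto> \<Sum>\<^sub>i x\<^sub>i (X\<^sup>p\<^sup>-\<^sup>1 f(x\<^sub>i))\<close> (\<open>ind_to_forms_eq\<close>).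

  The formula is that of a Hecke operator for the matrices \<open>\<delta>\<^sub>i = g x\<^sub>i\<^sup>-\<^sup>1\<close>, whose adjugates are \<open>x\<^sub>i g\<^sup>*\<close>,
  except for the factor \<open>X\<^sup>p\<^sup>-\<^sup>1\<close>.  The factor does no harm, because a matrix that is upper triangular
  modulo \<open>p\<close> multiplies \<open>X\<close> by an element of the prime field and hence fixes \<open>X\<^sup>p\<^sup>-\<^sup>1\<close> if its upper left
  entry is prime to \<open>p\<close> (\<open>bX_power_act\<close>).  Operators of this kind are treated abstractly
  (\<open>hecke_datum\<close>): they act on cocycles, they can be composed, and two of them agree on cohomology
  as soon as their index sets correspond bijectively, up to elements of the group
  (\<open>equivalent_hecke_data\<close>).

  For the commutation with \<open>T\<^sub>r\<close>, whose matrices are denoted \<open>d\<close>, both composites are such operators,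
  with matrices \<open>\<delta>\<^sub>i d\<close> and \<open>d \<delta>\<^sub>i\<close> respectively.  Since \<open>p\<close> does not divide \<open>r\<close>, the matrix \<open>d\<close> permutes
  the projective line over the prime field.  If it sends the \<open>j\<close>-th point to the \<open>i\<close>-th one, then
  \<open>x\<^sub>i\<^sup>-\<^sup>1 d x\<^sub>j\<close> is upper triangular modulo \<open>p\<close>, its conjugate by \<open>g\<close> is integral of determinant \<open>r\<close>, and
  therefore \<open>\<delta>\<^sub>i d = y d' \<delta>\<^sub>j\<close> with \<open>y\<close> in the group and \<open>d'\<close> another representative (\<open>swap_exists\<close>).  The
  resulting map \<open>(d, i) \<mapsto> (j, d')\<close> is injective because \<open>p\<close> and \<open>r\<close> are coprime, and thus bijective
  because there are only finitely many representatives \<open>d\<close> (\<open>Hecke_reps_finite\<close>).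

  In degree zero matrices act trivially and the twist by \<open>g\<^sup>*\<close> disappears, so that the construction of
  Edixhoven and Khare is induced by the same cocycles and the same map on the induced module
  (\<open>alpha_EK_class\<close>).
\<close>

section \<open>Modules over a group and their first cohomology\<close>

lemma carrier_Z1 [simp]: "carrier (Z1 G M) = cocycles G M"
  by (simp add: Z1_def)

lemma (in group) l_inv_cancel:
  "\<lbrakk>a \<in> carrier G; b \<in> carrier G\<rbrakk> \<Longrightarrow> a \<otimes> (inv a \<otimes> b) = b"
  by (simp flip: m_assoc)

locale group_module =
  G: group G + M: comm_group M
  for G :: "('g, 'x) monoid_scheme" and M :: "('k, 'g, 'a, 'y) gmodule_scheme" +
  assumes act_closed [simp, intro]:
      "\<lbrakk>x \<in> carrier G; m \<in> carrier M\<rbrakk> \<Longrightarrow> gact M x m \<in> carrier M"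
    and act_mult: "\<lbrakk>x \<in> carrier G; m \<in> carrier M; n \<in> carrier M\<rbrakk> \<Longrightarrow>
      gact M x (m \<otimes>\<^bsub>M\<^esub> n) = gact M x m \<otimes>\<^bsub>M\<^esub> gact M x n"
    and act_comp: "\<lbrakk>x \<in> carrier G; y \<in> carrier G; m \<in> carrier M\<rbrakk> \<Longrightarrow>
      gact M (x \<otimes>\<^bsub>G\<^esub> y) m = gact M x (gact M y m)"
    and act_one: "m \<in> carrier M \<Longrightarrow> gact M \<one>\<^bsub>G\<^esub> m = m"
begin

lemma act_group_hom: "x \<in> carrier G \<Longrightarrow> group_hom M M (gact M x)"
  by unfold_locales (auto simp: hom_def act_mult)

lemma act_unit [simp]: "x \<in> carrier G \<Longrightarrow> gact M x \<one>\<^bsub>M\<^esub> = \<one>\<^bsub>M\<^esub>"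
  by (rule group_hom.hom_one[OF act_group_hom])

lemma act_inv: "\<lbrakk>x \<in> carrier G; m \<in> carrier M\<rbrakk> \<Longrightarrow> gact M x (inv\<^bsub>M\<^esub> m) = inv\<^bsub>M\<^esub> (gact M x m)"
  by (rule group_hom.hom_inv[OF act_group_hom])

lemma act_inv_cancel [simp]:
  "\<lbrakk>x \<in> carrier G; m \<in> carrier M\<rbrakk> \<Longrightarrow> gact M (inv\<^bsub>G\<^esub> x) (gact M x m) = m"
  "\<lbrakk>x \<in> carrier G; m \<in> carrier M\<rbrakk> \<Longrightarrow> gact M x (gact M (inv\<^bsub>G\<^esub> x) m) = m"
  by (simp_all flip: act_comp add: act_one)

lemma cocycle_closed: "\<lbrakk>z \<in> cocycles G M; x \<in> carrier G\<rbrakk> \<Longrightarrow> z x \<in> carrier M"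
  by (auto simp: cocycles_def)

lemma cocycle_mult: "\<lbrakk>z \<in> cocycles G M; x \<in> carrier G; y \<in> carrier G\<rbrakk> \<Longrightarrow>
    z (x \<otimes>\<^bsub>G\<^esub> y) = z x \<otimes>\<^bsub>M\<^esub> gact M x (z y)"
  by (auto simp: cocycles_def)

lemma cocycle_one: "z \<in> cocycles G M \<Longrightarrow> z \<one>\<^bsub>G\<^esub> = \<one>\<^bsub>M\<^esub>"
  using cocycle_mult[of z "\<one>\<^bsub>G\<^esub>" "\<one>\<^bsub>G\<^esub>"] cocycle_closed[of z "\<one>\<^bsub>G\<^esub>"]
  by (simp add: act_one)

lemma cocycles_PiE: "z \<in> cocycles G M \<Longrightarrow> z \<in> carrier G \<rightarrow>\<^sub>E carrier M"
  by (auto simp: cocycles_def)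

lemma comm_group_Z1: "comm_group (Z1 G M)"
proof (rule comm_groupI)
  fix z w assume zw: "z \<in> carrier (Z1 G M)" "w \<in> carrier (Z1 G M)"
  then have z: "z \<in> cocycles G M" and w: "w \<in> cocycles G M" by (auto simp: Z1_def)
  show "z \<otimes>\<^bsub>Z1 G M\<^esub> w \<in> carrier (Z1 G M)"
    using cocycle_closed[OF z] cocycle_closed[OF w] cocycle_mult[OF z] cocycle_mult[OF w]
    by (auto simp: Z1_def cocycles_def[of G M] act_mult M.m_ac)
  show "z \<otimes>\<^bsub>Z1 G M\<^esub> w = w \<otimes>\<^bsub>Z1 G M\<^esub> z"
    using cocycle_closed[OF z] cocycle_closed[OF w]
    by (auto simp: Z1_def M.m_ac intro!: restrict_ext)
next
  show "\<one>\<^bsub>Z1 G M\<^esub> \<in> carrier (Z1 G M)"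
    by (auto simp: Z1_def cocycles_def)
next
  fix u z w assume "u \<in> carrier (Z1 G M)" "z \<in> carrier (Z1 G M)" "w \<in> carrier (Z1 G M)"
  then have z: "z \<in> cocycles G M" and w: "w \<in> cocycles G M" and u: "u \<in> cocycles G M"
    by (auto simp: Z1_def)
  show "u \<otimes>\<^bsub>Z1 G M\<^esub> z \<otimes>\<^bsub>Z1 G M\<^esub> w = u \<otimes>\<^bsub>Z1 G M\<^esub> (z \<otimes>\<^bsub>Z1 G M\<^esub> w)"
    using cocycle_closed[OF z] cocycle_closed[OF w] cocycle_closed[OF u]
    by (auto simp: Z1_def M.m_assoc intro!: restrict_ext)
next
  fix z assume "z \<in> carrier (Z1 G M)"
  then have z: "z \<in> cocycles G M" by (auto simp: Z1_def)
  show "\<one>\<^bsub>Z1 G M\<^esub> \<otimes>\<^bsub>Z1 G M\<^esub> z = z"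
    using cocycle_closed[OF z] cocycles_PiE[OF z]
    by (auto simp: Z1_def intro!: PiE_ext[where k = "carrier G"])
  have "(\<lambda>x\<in>carrier G. inv\<^bsub>M\<^esub> (z x)) \<in> carrier (Z1 G M)"
    using cocycle_closed[OF z] cocycle_mult[OF z]
    by (auto simp: Z1_def cocycles_def[of G M] act_inv M.inv_mult)
  moreover have "(\<lambda>x\<in>carrier G. inv\<^bsub>M\<^esub> (z x)) \<otimes>\<^bsub>Z1 G M\<^esub> z = \<one>\<^bsub>Z1 G M\<^esub>"
    using cocycle_closed[OF z] by (auto simp: Z1_def intro!: restrict_ext)
  ultimately show "\<exists>y\<in>carrier (Z1 G M). y \<otimes>\<^bsub>Z1 G M\<^esub> z = \<one>\<^bsub>Z1 G M\<^esub>" by blast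
qed

lemma coboundary_in_cocycles:
  assumes "m \<in> carrier M"
  shows "(\<lambda>x\<in>carrier G. gact M x m \<otimes>\<^bsub>M\<^esub> inv\<^bsub>M\<^esub> m) \<in> cocycles G M"
proof -
  have "gact M (x \<otimes>\<^bsub>G\<^esub> y) m \<otimes>\<^bsub>M\<^esub> inv\<^bsub>M\<^esub> m =
      gact M x m \<otimes>\<^bsub>M\<^esub> inv\<^bsub>M\<^esub> m \<otimes>\<^bsub>M\<^esub> gact M x (gact M y m \<otimes>\<^bsub>M\<^esub> inv\<^bsub>M\<^esub> m)"
    if "x \<in> carrier G" "y \<in> carrier G" for x y
  proof -
    have "gact M x m \<otimes>\<^bsub>M\<^esub> inv\<^bsub>M\<^esub> m \<otimes>\<^bsub>M\<^esub> gact M x (gact M y m \<otimes>\<^bsub>M\<^esub> inv\<^bsub>M\<^esub> m)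
      = (gact M x m \<otimes>\<^bsub>M\<^esub> inv\<^bsub>M\<^esub> (gact M x m)) \<otimes>\<^bsub>M\<^esub> (gact M x (gact M y m) \<otimes>\<^bsub>M\<^esub> inv\<^bsub>M\<^esub> m)"
      using that assms by (simp add: act_mult act_inv M.m_ac M.l_inv_cancel)
    also have "gact M x m \<otimes>\<^bsub>M\<^esub> inv\<^bsub>M\<^esub> (gact M x m) = \<one>\<^bsub>M\<^esub>"
      using that assms by (intro M.r_inv) auto
    finally show ?thesis using that assms by (simp add: act_comp)
  qed
  then show ?thesis using assms by (auto simp: cocycles_def)
qed

lemma subgroup_coboundaries: "subgroup (coboundaries G M) (Z1 G M)"
proof -
  interpret Z: comm_group "Z1 G M" by (rule comm_group_Z1)
  let ?d = "\<lambda>m. \<lambda>x\<in>carrier G. gact M x m \<otimes>\<^bsub>M\<^esub> inv\<^bsub>M\<^esub> m"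
  have "group_hom M (Z1 G M) ?d"
  proof
    show "?d \<in> hom M (Z1 G M)"
      using coboundary_in_cocycles
      by (auto simp: hom_def Z1_def act_mult M.inv_mult M.m_ac intro!: restrict_ext)
  qed
  from group_hom.img_is_subgroup[OF this] show ?thesis
    by (simp add: coboundaries_def)
qed

lemma coboundaries_normal: "coboundaries G M \<lhd> Z1 G M"
  using comm_group.subgroup_imp_normal[OF comm_group_Z1 subgroup_coboundaries] .

lemma comm_group_H1: "comm_group (H1 G M)"
  unfolding H1_def
  by (rule comm_group.abelian_FactGroup[OF comm_group_Z1 subgroup_coboundaries])

end

definition H1_class where
  "H1_class G M z = coboundaries G M #>\<^bsub>Z1 G M\<^esub> z"

context group_module begin

lemma carrier_H1: "carrier (H1 G M) = H1_class G M ` cocycles G M"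
  by (simp add: H1_def carrier_FactGroup H1_class_def [abs_def] Z1_def)

lemma H1_classI: "z \<in> cocycles G M \<Longrightarrow> H1_class G M z \<in> carrier (H1 G M)"
  by (simp add: carrier_H1)

lemma H1_class_mult:
  "\<lbrakk>z \<in> cocycles G M; w \<in> cocycles G M\<rbrakk> \<Longrightarrow>
    H1_class G M z \<otimes>\<^bsub>H1 G M\<^esub> H1_class G M w = H1_class G M (z \<otimes>\<^bsub>Z1 G M\<^esub> w)"
  by (simp add: H1_def H1_class_def normal.rcos_sum[OF coboundaries_normal])

lemma H1_class_eq_iff:
  assumes z: "z \<in> cocycles G M" and w: "w \<in> cocycles G M"
  shows "H1_class G M z = H1_class G M w \<longleftrightarrow>
    (\<exists>m\<in>carrier M. \<forall>x\<in>carrier G. z x = gact M x m \<otimes>\<^bsub>M\<^esub> inv\<^bsub>M\<^esub> m \<otimes>\<^bsub>M\<^esub> w x)"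
proof -
  interpret Z: comm_group "Z1 G M" by (rule comm_group_Z1)
  have "H1_class G M z = H1_class G M w \<longleftrightarrow> z \<in> coboundaries G M #>\<^bsub>Z1 G M\<^esub> w"
    unfolding H1_class_def
  proof
    assume "coboundaries G M #>\<^bsub>Z1 G M\<^esub> z = coboundaries G M #>\<^bsub>Z1 G M\<^esub> w"
    then show "z \<in> coboundaries G M #>\<^bsub>Z1 G M\<^esub> w"
      using Z.rcos_self[OF _ subgroup_coboundaries, of z] z by simp
  qed (use Z.repr_independence[OF _ _ subgroup_coboundaries, of z w] w in simp)
  also have "\<dots> \<longleftrightarrow> (\<exists>m\<in>carrier M. z = (\<lambda>x\<in>carrier G. gact M x m \<otimes>\<^bsub>M\<^esub> inv\<^bsub>M\<^esub> m \<otimes>\<^bsub>M\<^esub> w x))"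
    by (auto simp: r_coset_def coboundaries_def Z1_def cong: restrict_cong)
  also have "\<dots> \<longleftrightarrow> (\<exists>m\<in>carrier M. \<forall>x\<in>carrier G. z x = gact M x m \<otimes>\<^bsub>M\<^esub> inv\<^bsub>M\<^esub> m \<otimes>\<^bsub>M\<^esub> w x)"
  proof (rule bex_cong[OF refl])
    fix m
    show "z = (\<lambda>x\<in>carrier G. gact M x m \<otimes>\<^bsub>M\<^esub> inv\<^bsub>M\<^esub> m \<otimes>\<^bsub>M\<^esub> w x) \<longleftrightarrow>
      (\<forall>x\<in>carrier G. z x = gact M x m \<otimes>\<^bsub>M\<^esub> inv\<^bsub>M\<^esub> m \<otimes>\<^bsub>M\<^esub> w x)" (is "z = restrict ?f _ \<longleftrightarrow> _")
      using cocycles_PiE[OF z] extensionalityI[of z "carrier G" "restrict ?f (carrier G)"]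
      by (auto simp: PiE_def)
  qed
  finally show ?thesis .
qed

lemma H1_class_memD:
  assumes "z \<in> cocycles G M" "w \<in> H1_class G M z"
  shows "w \<in> cocycles G M" "H1_class G M w = H1_class G M z"
proof -
  interpret Z: comm_group "Z1 G M" by (rule comm_group_Z1)
  have z: "z \<in> carrier (Z1 G M)" using assms by (simp add: Z1_def)
  show "w \<in> cocycles G M"
    using Z.r_coset_subset_G[OF Z.subgroupE(1)[OF subgroup_coboundaries] z] assms
    by (auto simp: H1_class_def Z1_def)
  show "H1_class G M w = H1_class G M z"
    using Z.repr_independence[OF _ z subgroup_coboundaries] assms by (simp add: H1_class_def)
qed

lemma H1_class_self: "z \<in> cocycles G M \<Longrightarrow> z \<in> H1_class G M z"
  unfolding H1_class_def
  using group.rcos_self[OF comm_group.axioms(2)[OF comm_group_Z1] _ subgroup_coboundaries]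
  by (simp add: Z1_def)

end

text \<open>
  The union in \<open>H1_map\<close> is taken over all cocycles in a class; it is a single coset as soon as its
  terms agree.
\<close>

lemma H1_map_constant:
  assumes "group_module G M"
    and "\<And>w. w \<in> H1_class G M z \<Longrightarrow> H1_class G' M' (\<Phi> w) = H1_class G' M' (\<Phi> z)"
    and "z \<in> cocycles G M"
  shows "H1_map G' M' \<Phi> (H1_class G M z) = H1_class G' M' (\<Phi> z)"
  unfolding H1_map_def H1_class_def[of G' M', symmetric]
  by (rule SUP_eq_const)
    (use group_module.H1_class_self[OF assms(1,3)] in blast, erule assms(2))

text \<open>
  The homomorphisms between groups of cocycles that descend to cohomology.  Source and target
  may belong to different groups, as for restriction to a subgroup.
\<close>

locale cochain_map =
  A: group_module G M + B: group_module G' M'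
  for G :: "('g, 'x) monoid_scheme" and M :: "('k, 'g, 'a, 'y) gmodule_scheme"
    and G' :: "('h, 'z) monoid_scheme" and M' :: "('l, 'h, 'b, 'w) gmodule_scheme"
    and \<Phi> :: "('g \<Rightarrow> 'a) \<Rightarrow> 'h \<Rightarrow> 'b" +
  assumes map_hom: "\<Phi> \<in> hom (Z1 G M) (Z1 G' M')"
    and map_cob: "\<And>b. b \<in> coboundaries G M \<Longrightarrow> \<Phi> b \<in> coboundaries G' M'"
begin

lemma map_cocycle: "z \<in> cocycles G M \<Longrightarrow> \<Phi> z \<in> cocycles G' M'"
  using map_hom by (auto simp: hom_def Z1_def)

lemma H1_map_class: "z \<in> cocycles G M \<Longrightarrow> H1_map G' M' \<Phi> (H1_class G M z) = H1_class G' M' (\<Phi> z)"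
proof (rule H1_map_constant[OF A.group_module_axioms])
  fix w assume z: "z \<in> cocycles G M" and w: "w \<in> H1_class G M z"
  then obtain b where b: "b \<in> coboundaries G M" "w = b \<otimes>\<^bsub>Z1 G M\<^esub> z"
    unfolding H1_class_def r_coset_def by blast
  interpret Z: comm_group "Z1 G M" by (rule A.comm_group_Z1)
  interpret Z': comm_group "Z1 G' M'" by (rule B.comm_group_Z1)
  have bz: "b \<in> carrier (Z1 G M)" "z \<in> carrier (Z1 G M)"
    using subgroup.mem_carrier[OF A.subgroup_coboundaries b(1)] z by simp_all
  have "\<Phi> w = \<Phi> b \<otimes>\<^bsub>Z1 G' M'\<^esub> \<Phi> z"
    unfolding b(2) by (rule hom_mult[OF map_hom bz])
  then have "\<Phi> w \<in> H1_class G' M' (\<Phi> z)"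
    using map_cob[OF b(1)] unfolding H1_class_def r_coset_def by blast
  then show "H1_class G' M' (\<Phi> w) = H1_class G' M' (\<Phi> z)"
    by (rule B.H1_class_memD(2)[OF map_cocycle[OF z]])
qed

lemma H1_map_hom: "H1_map G' M' \<Phi> \<in> hom (H1 G M) (H1 G' M')"
proof (rule homI)
  fix c assume "c \<in> carrier (H1 G M)"
  then obtain z where "z \<in> cocycles G M" "c = H1_class G M z"
    unfolding A.carrier_H1 by (elim imageE)
  then show "H1_map G' M' \<Phi> c \<in> carrier (H1 G' M')"
    by (simp add: H1_map_class B.H1_classI map_cocycle)
next
  fix c d assume "c \<in> carrier (H1 G M)" "d \<in> carrier (H1 G M)"
  then obtain z w where z: "z \<in> cocycles G M" "c = H1_class G M z"
    and w: "w \<in> cocycles G M" "d = H1_class G M w" unfolding A.carrier_H1 by (elim imageE)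
  interpret Z: comm_group "Z1 G M" by (rule A.comm_group_Z1)
  have zw: "z \<otimes>\<^bsub>Z1 G M\<^esub> w \<in> cocycles G M" "\<Phi> (z \<otimes>\<^bsub>Z1 G M\<^esub> w) = \<Phi> z \<otimes>\<^bsub>Z1 G' M'\<^esub> \<Phi> w"
    using Z.m_closed[of z w] hom_mult[OF map_hom, of z w] z w by auto
  show "H1_map G' M' \<Phi> (c \<otimes>\<^bsub>H1 G M\<^esub> d) = H1_map G' M' \<Phi> c \<otimes>\<^bsub>H1 G' M'\<^esub> H1_map G' M' \<Phi> d"
    using z w zw by (simp add: A.H1_class_mult B.H1_class_mult H1_map_class map_cocycle)
qed

end

locale gmodule_hom =
  A: group_module G M + B: group_module G M'
  for G :: "('g, 'x) monoid_scheme" and M :: "('k, 'g, 'a, 'y) gmodule_scheme"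
    and M' :: "('l, 'g, 'b, 'w) gmodule_scheme" and \<phi> :: "'a \<Rightarrow> 'b" +
  assumes hom: "\<phi> \<in> hom M M'"
    and equivariant:
      "\<And>x m. \<lbrakk>x \<in> carrier G; m \<in> carrier M\<rbrakk> \<Longrightarrow> \<phi> (gact M x m) = gact M' x (\<phi> m)"
begin

sublocale group_hom M M' \<phi>
  by unfold_locales (rule hom)

lemma coeff_cochain_map: "cochain_map G M G M' (\<lambda>z. \<lambda>x\<in>carrier G. \<phi> (z x))"
proof
  show "(\<lambda>z. \<lambda>x\<in>carrier G. \<phi> (z x)) \<in> hom (Z1 G M) (Z1 G M')"
  proof (rule homI)
    fix z assume "z \<in> carrier (Z1 G M)"
    then have z: "z \<in> cocycles G M" by (simp add: Z1_def)
    show "(\<lambda>x\<in>carrier G. \<phi> (z x)) \<in> carrier (Z1 G M')"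
      using A.cocycle_closed[OF z] A.cocycle_mult[OF z]
      by (auto simp: Z1_def cocycles_def[of G M'] equivariant)
  next
    fix z w assume "z \<in> carrier (Z1 G M)" "w \<in> carrier (Z1 G M)"
    then have z: "z \<in> cocycles G M" and w: "w \<in> cocycles G M" by simp_all
    show "(\<lambda>x\<in>carrier G. \<phi> ((z \<otimes>\<^bsub>Z1 G M\<^esub> w) x)) =
        (\<lambda>x\<in>carrier G. \<phi> (z x)) \<otimes>\<^bsub>Z1 G M'\<^esub> (\<lambda>x\<in>carrier G. \<phi> (w x))"
      using A.cocycle_closed[OF z] A.cocycle_closed[OF w]
      by (auto simp: Z1_def intro!: restrict_ext)
  qed
next
  fix b assume "b \<in> coboundaries G M"
  then obtain m where m: "m \<in> carrier M" "b = (\<lambda>x\<in>carrier G. gact M x m \<otimes>\<^bsub>M\<^esub> inv\<^bsub>M\<^esub> m)"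
    by (auto simp: coboundaries_def)
  show "(\<lambda>x\<in>carrier G. \<phi> (b x)) \<in> coboundaries G M'"
    unfolding coboundaries_def
    by (rule image_eqI[of _ _ "\<phi> m"]) (auto simp: m equivariant intro!: restrict_ext)
qed

lemma H1_coeff_class: "z \<in> cocycles G M \<Longrightarrow>
    H1_coeff G M' \<phi> (H1_class G M z) = H1_class G M' (\<lambda>x\<in>carrier G. \<phi> (z x))"
  unfolding H1_coeff_def by (rule cochain_map.H1_map_class[OF coeff_cochain_map])

lemma coeff_cocycle: "z \<in> cocycles G M \<Longrightarrow> (\<lambda>x\<in>carrier G. \<phi> (z x)) \<in> cocycles G M'"
  by (rule cochain_map.map_cocycle[OF coeff_cochain_map])

end

lemma gmodule_hom_comp:
  assumes "gmodule_hom G M M' \<phi>" "gmodule_hom G M' M'' \<psi>"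
  shows "gmodule_hom G M M'' (\<psi> \<circ> \<phi>)"
proof -
  interpret a: gmodule_hom G M M' \<phi> by fact
  interpret b: gmodule_hom G M' M'' \<psi> by fact
  show ?thesis
    by unfold_locales (auto simp: hom_def a.equivariant b.equivariant)
qed

text \<open>
  With this a chain of coefficient maps is composed first and applied to a cocycle only once.
\<close>

lemma H1_coeff_comp:
  assumes "gmodule_hom G M M' \<phi>" "gmodule_hom G M' M'' \<psi>" "c \<in> carrier (H1 G M)"
  shows "H1_coeff G M'' \<psi> (H1_coeff G M' \<phi> c) = H1_coeff G M'' (\<psi> \<circ> \<phi>) c"
proof -
  interpret a: gmodule_hom G M M' \<phi> by fact
  interpret b: gmodule_hom G M' M'' \<psi> by fact
  interpret ab: gmodule_hom G M M'' "\<psi> \<circ> \<phi>" by (rule gmodule_hom_comp[OF assms(1,2)])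
  from assms(3) obtain z where z: "z \<in> cocycles G M" "c = H1_class G M z"
    unfolding a.A.carrier_H1 by (elim imageE)
  show ?thesis
    using z a.coeff_cocycle[OF z(1)]
    by (simp add: a.H1_coeff_class b.H1_coeff_class ab.H1_coeff_class cong: restrict_cong)
qed

section \<open>Induced modules and Shapiro's lemma\<close>

lemma (in group_module) group_module_subgroup:
  assumes "subgroup H G"
  shows "group_module (subgrp G H) M"
proof -
  interpret H: subgroup H G by fact
  interpret GH: group "subgrp G H" by (rule H.subgroup_is_group) unfold_locales
  show ?thesis
    by unfold_locales (auto simp: act_mult act_comp act_one)
qed

locale induced_module =
  group_module G M + H: subgroup H G
  for G :: "('g, 'x) monoid_scheme" and M :: "('k, 'g, 'a, 'y) gmodule_scheme" and H
begin

lemma Ind_iff: "f \<in> carrier (Ind G H M) \<longleftrightarrow> f \<in> carrier G \<rightarrow>\<^sub>E carrier M \<and>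
    (\<forall>x\<in>carrier G. \<forall>h\<in>H. f (x \<otimes>\<^bsub>G\<^esub> h) = gact M (inv\<^bsub>G\<^esub> h) (f x))"
  by (simp add: Ind_def)

lemma Ind_closed: "\<lbrakk>f \<in> carrier (Ind G H M); x \<in> carrier G\<rbrakk> \<Longrightarrow> f x \<in> carrier M"
  by (auto simp: Ind_iff)

lemma Ind_PiE: "f \<in> carrier (Ind G H M) \<Longrightarrow> f \<in> carrier G \<rightarrow>\<^sub>E carrier M"
  by (simp add: Ind_iff)

lemma Ind_mult_right:
  "\<lbrakk>f \<in> carrier (Ind G H M); x \<in> carrier G; h \<in> H\<rbrakk> \<Longrightarrow>
    f (x \<otimes>\<^bsub>G\<^esub> h) = gact M (inv\<^bsub>G\<^esub> h) (f x)"
  by (simp add: Ind_iff)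

lemma Ind_mult: "f \<otimes>\<^bsub>Ind G H M\<^esub> f' = (\<lambda>x\<in>carrier G. f x \<otimes>\<^bsub>M\<^esub> f' x)"
  by (simp add: Ind_def)

lemma Ind_one: "\<one>\<^bsub>Ind G H M\<^esub> = (\<lambda>x\<in>carrier G. \<one>\<^bsub>M\<^esub>)"
  by (simp add: Ind_def)

lemma Ind_act: "gact (Ind G H M) y f = (\<lambda>x\<in>carrier G. f (inv\<^bsub>G\<^esub> y \<otimes>\<^bsub>G\<^esub> x))"
  by (simp add: Ind_def)

lemma Ind_inv_closed:
  assumes f: "f \<in> carrier (Ind G H M)"
  shows "(\<lambda>x\<in>carrier G. inv\<^bsub>M\<^esub> (f x)) \<in> carrier (Ind G H M)"
  using Ind_closed[OF f] Ind_mult_right[OF f] by (auto simp: Ind_iff act_inv)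

lemma comm_group_Ind: "comm_group (Ind G H M)"
proof (rule comm_groupI)
  fix f f' assume f: "f \<in> carrier (Ind G H M)" and f': "f' \<in> carrier (Ind G H M)"
  show "f \<otimes>\<^bsub>Ind G H M\<^esub> f' \<in> carrier (Ind G H M)"
    using Ind_closed[OF f] Ind_closed[OF f'] Ind_mult_right[OF f] Ind_mult_right[OF f']
    by (auto simp: Ind_iff[of "restrict _ _"] Ind_mult act_mult)
  show "f \<otimes>\<^bsub>Ind G H M\<^esub> f' = f' \<otimes>\<^bsub>Ind G H M\<^esub> f"
    using Ind_closed[OF f] Ind_closed[OF f'] by (auto simp: Ind_mult M.m_comm intro!: restrict_ext)
next
  show "\<one>\<^bsub>Ind G H M\<^esub> \<in> carrier (Ind G H M)"
    by (auto simp: Ind_iff Ind_one)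
next
  fix f f' f'' assume f: "f \<in> carrier (Ind G H M)" and f': "f' \<in> carrier (Ind G H M)"
    and f'': "f'' \<in> carrier (Ind G H M)"
  show "f \<otimes>\<^bsub>Ind G H M\<^esub> f' \<otimes>\<^bsub>Ind G H M\<^esub> f'' = f \<otimes>\<^bsub>Ind G H M\<^esub> (f' \<otimes>\<^bsub>Ind G H M\<^esub> f'')"
    using Ind_closed[OF f] Ind_closed[OF f'] Ind_closed[OF f'']
    by (auto simp: Ind_mult M.m_assoc intro!: restrict_ext)
next
  fix f assume f: "f \<in> carrier (Ind G H M)"
  show "\<one>\<^bsub>Ind G H M\<^esub> \<otimes>\<^bsub>Ind G H M\<^esub> f = f"
    using Ind_closed[OF f] Ind_PiE[OF f]
    by (auto simp: Ind_mult Ind_one intro!: PiE_ext[where k = "carrier G"])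
  have "(\<lambda>x\<in>carrier G. inv\<^bsub>M\<^esub> (f x)) \<otimes>\<^bsub>Ind G H M\<^esub> f = \<one>\<^bsub>Ind G H M\<^esub>"
    using Ind_closed[OF f] by (auto simp: Ind_mult Ind_one intro!: restrict_ext)
  then show "\<exists>y\<in>carrier (Ind G H M). y \<otimes>\<^bsub>Ind G H M\<^esub> f = \<one>\<^bsub>Ind G H M\<^esub>"
    using Ind_inv_closed[OF f] by blast
qed

lemma Ind_inv:
  assumes f: "f \<in> carrier (Ind G H M)"
  shows "inv\<^bsub>Ind G H M\<^esub> f = (\<lambda>x\<in>carrier G. inv\<^bsub>M\<^esub> (f x))"
proof -
  interpret I: comm_group "Ind G H M" by (rule comm_group_Ind)
  have "(\<lambda>x\<in>carrier G. inv\<^bsub>M\<^esub> (f x)) \<otimes>\<^bsub>Ind G H M\<^esub> f = \<one>\<^bsub>Ind G H M\<^esub>"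
    using Ind_closed[OF f] by (auto simp: Ind_mult Ind_one intro!: restrict_ext)
  then show ?thesis
    by (rule I.inv_equality[OF _ f Ind_inv_closed[OF f]])
qed

lemma group_module_Ind: "group_module G (Ind G H M)"
proof -
  interpret I: comm_group "Ind G H M" by (rule comm_group_Ind)
  show ?thesis
  proof
    fix x f assume x: "x \<in> carrier G" and f: "f \<in> carrier (Ind G H M)"
    show "gact (Ind G H M) x f \<in> carrier (Ind G H M)"
      using x Ind_closed[OF f] Ind_mult_right[OF f]
      by (auto simp: Ind_iff[of "restrict _ _"] Ind_act simp flip: G.m_assoc)
    fix f' assume f': "f' \<in> carrier (Ind G H M)"
    show "gact (Ind G H M) x (f \<otimes>\<^bsub>Ind G H M\<^esub> f') =
        gact (Ind G H M) x f \<otimes>\<^bsub>Ind G H M\<^esub> gact (Ind G H M) x f'"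
      using x by (auto simp: Ind_mult Ind_act intro!: restrict_ext)
  next
    fix x y f assume xy: "x \<in> carrier G" "y \<in> carrier G" and f: "f \<in> carrier (Ind G H M)"
    show "gact (Ind G H M) (x \<otimes>\<^bsub>G\<^esub> y) f = gact (Ind G H M) x (gact (Ind G H M) y f)"
      using xy by (auto simp: Ind_act G.inv_mult_group G.m_assoc intro!: restrict_ext)
  next
    fix f assume f: "f \<in> carrier (Ind G H M)"
    show "gact (Ind G H M) \<one>\<^bsub>G\<^esub> f = f"
      using Ind_PiE[OF f] by (auto simp: Ind_act intro!: PiE_ext[where k = "carrier G"])
  qed
qed

sublocale I: group_module G "Ind G H M"
  by (rule group_module_Ind)

sublocale S: group_module "subgrp G H" M
  by (rule group_module_subgroup) unfold_locales

lemma Ind_at_inverse: "\<lbrakk>f \<in> carrier (Ind G H M); h \<in> H\<rbrakk> \<Longrightarrow> f (inv\<^bsub>G\<^esub> h) = gact M h (f \<one>\<^bsub>G\<^esub>)"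
  using Ind_mult_right[of f "\<one>\<^bsub>G\<^esub>" "inv\<^bsub>G\<^esub> h"] by simp

sublocale eval: cochain_map G "Ind G H M" "subgrp G H" M "\<lambda>z. \<lambda>x\<in>H. z x \<one>\<^bsub>G\<^esub>"
proof
  show "(\<lambda>z. \<lambda>x\<in>H. z x \<one>\<^bsub>G\<^esub>) \<in> hom (Z1 G (Ind G H M)) (Z1 (subgrp G H) M)"
  proof (rule homI)
    fix z assume "z \<in> carrier (Z1 G (Ind G H M))"
    then have z: "z \<in> cocycles G (Ind G H M)" by simp
    have "z (x \<otimes>\<^bsub>G\<^esub> y) \<one>\<^bsub>G\<^esub> = z x \<one>\<^bsub>G\<^esub> \<otimes>\<^bsub>M\<^esub> gact M x (z y \<one>\<^bsub>G\<^esub>)" if "x \<in> H" "y \<in> H" for x y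
      using that I.cocycle_mult[OF z, of x y] Ind_at_inverse[OF I.cocycle_closed[OF z], of y x]
      by (simp add: Ind_mult Ind_act)
    then show "(\<lambda>x\<in>H. z x \<one>\<^bsub>G\<^esub>) \<in> carrier (Z1 (subgrp G H) M)"
      using I.cocycle_closed[OF z] Ind_closed by (auto simp: cocycles_def)
  next
    fix z w assume "z \<in> carrier (Z1 G (Ind G H M))" "w \<in> carrier (Z1 G (Ind G H M))"
    show "(\<lambda>x\<in>H. (z \<otimes>\<^bsub>Z1 G (Ind G H M)\<^esub> w) x \<one>\<^bsub>G\<^esub>) =
        (\<lambda>x\<in>H. z x \<one>\<^bsub>G\<^esub>) \<otimes>\<^bsub>Z1 (subgrp G H) M\<^esub> (\<lambda>x\<in>H. w x \<one>\<^bsub>G\<^esub>)"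
      by (auto simp: Z1_def Ind_mult intro!: restrict_ext)
  qed
next
  fix b assume "b \<in> coboundaries G (Ind G H M)"
  then obtain f where f: "f \<in> carrier (Ind G H M)"
      "b = (\<lambda>x\<in>carrier G. gact (Ind G H M) x f \<otimes>\<^bsub>Ind G H M\<^esub> inv\<^bsub>Ind G H M\<^esub> f)"
    by (auto simp: coboundaries_def)
  show "(\<lambda>x\<in>H. b x \<one>\<^bsub>G\<^esub>) \<in> coboundaries (subgrp G H) M"
    unfolding coboundaries_def
    by (rule image_eqI[of _ _ "f \<one>\<^bsub>G\<^esub>"])
      (auto simp: f Ind_closed Ind_inv Ind_mult Ind_act Ind_at_inverse intro!: restrict_ext)
qed

lemma eval_class: "z \<in> cocycles G (Ind G H M) \<Longrightarrow>
    shapiro_eval G H M (H1_class G (Ind G H M) z) =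
      H1_class (subgrp G H) M (\<lambda>x\<in>H. z x \<one>\<^bsub>G\<^esub>)"
  unfolding shapiro_eval_def by (rule eval.H1_map_class)

text \<open>
  For a cocycle \<open>z\<close> with values in the induced module put \<open>u(t) = z(t)(t)\<close>.  The cocycle identity gives
  \<open>z(x)(t) = u(t) - u(x\<^sup>-\<^sup>1 t)\<close>, so \<open>z\<close> is the coboundary of the function \<open>- u\<close>, which need not lie in
  the induced module.  If \<open>z(h)(1) = h m - m\<close> for \<open>h\<close> in the subgroup, then \<open>m - u\<close> does, and has the
  same coboundary.  The proof applies this to the difference of two cocycles.
\<close>

lemma eval_injective: "inj_on (shapiro_eval G H M) (carrier (H1 G (Ind G H M)))"
proof (rule inj_onI)
  fix c d assume "c \<in> carrier (H1 G (Ind G H M))" "d \<in> carrier (H1 G (Ind G H M))"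
    and eq: "shapiro_eval G H M c = shapiro_eval G H M d"
  then obtain z w where z: "z \<in> cocycles G (Ind G H M)" and c: "c = H1_class G (Ind G H M) z"
    and w: "w \<in> cocycles G (Ind G H M)" and d: "d = H1_class G (Ind G H M) w"
    unfolding I.carrier_H1 by (elim imageE)
  have "\<exists>m\<in>carrier M. \<forall>h\<in>carrier (subgrp G H).
      (\<lambda>x\<in>H. z x \<one>\<^bsub>G\<^esub>) h = gact M h m \<otimes>\<^bsub>M\<^esub> inv\<^bsub>M\<^esub> m \<otimes>\<^bsub>M\<^esub> (\<lambda>x\<in>H. w x \<one>\<^bsub>G\<^esub>) h"
    using eq S.H1_class_eq_iff[OF eval.map_cocycle[OF z] eval.map_cocycle[OF w]]
    by (simp only: c d eval_class[OF z] eval_class[OF w])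
  then obtain m where m: "m \<in> carrier M"
    and zw: "\<And>h. h \<in> H \<Longrightarrow> z h \<one>\<^bsub>G\<^esub> = gact M h m \<otimes>\<^bsub>M\<^esub> inv\<^bsub>M\<^esub> m \<otimes>\<^bsub>M\<^esub> w h \<one>\<^bsub>G\<^esub>"
    by auto
  have val: "v s t \<in> carrier M" if "v \<in> cocycles G (Ind G H M)" "s \<in> carrier G" "t \<in> carrier G" for v s t
    using Ind_closed I.cocycle_closed that by blast
  \<comment> \<open>the value of a cocycle on the diagonal determines it, since \<open>v t t = v x t + v (x\<^sup>-\<^sup>1 t) (x\<^sup>-\<^sup>1 t)\<close>\<close>
  have diag: "v (x \<otimes>\<^bsub>G\<^esub> t) (x \<otimes>\<^bsub>G\<^esub> t) = v x (x \<otimes>\<^bsub>G\<^esub> t) \<otimes>\<^bsub>M\<^esub> v t t"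
    if "v \<in> cocycles G (Ind G H M)" "x \<in> carrier G" "t \<in> carrier G" for v x t
    using I.cocycle_mult[OF that] that by (simp add: Ind_mult Ind_act flip: G.m_assoc)
  have diagH: "v (t \<otimes>\<^bsub>G\<^esub> h) (t \<otimes>\<^bsub>G\<^esub> h) = gact M (inv\<^bsub>G\<^esub> h) (v t t \<otimes>\<^bsub>M\<^esub> v h \<one>\<^bsub>G\<^esub>)"
    if v: "v \<in> cocycles G (Ind G H M)" and t: "t \<in> carrier G" and h: "h \<in> H" for v t h
    using I.cocycle_mult[OF v t, of h] v t h Ind_mult_right[OF I.cocycle_closed[OF v], of "t \<otimes>\<^bsub>G\<^esub> h" t h]
    by (simp add: Ind_mult Ind_act)
  \<comment> \<open>\<open>D\<close> is the function \<open>u\<close> for the difference of the two cocycles\<close>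
  define D where "D t = z t t \<otimes>\<^bsub>M\<^esub> inv\<^bsub>M\<^esub> (w t t)" for t
  define F where "F = (\<lambda>t\<in>carrier G. m \<otimes>\<^bsub>M\<^esub> inv\<^bsub>M\<^esub> (D t))"
  have D: "D t \<in> carrier M" if "t \<in> carrier G" for t
    using that val z w by (simp add: D_def)
  have DH: "D (t \<otimes>\<^bsub>G\<^esub> h) = gact M (inv\<^bsub>G\<^esub> h) (D t) \<otimes>\<^bsub>M\<^esub> (m \<otimes>\<^bsub>M\<^esub> inv\<^bsub>M\<^esub> (gact M (inv\<^bsub>G\<^esub> h) m))"
    if t: "t \<in> carrier G" and h: "h \<in> H" for t h
  proof -
    have hG: "h \<in> carrier G" using h by simp
    have "D (t \<otimes>\<^bsub>G\<^esub> h) = gact M (inv\<^bsub>G\<^esub> h)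
        (z t t \<otimes>\<^bsub>M\<^esub> z h \<one>\<^bsub>G\<^esub> \<otimes>\<^bsub>M\<^esub> inv\<^bsub>M\<^esub> (w t t \<otimes>\<^bsub>M\<^esub> w h \<one>\<^bsub>G\<^esub>))"
      using val[OF z] val[OF w] t hG by (simp add: D_def diagH[OF z t h] diagH[OF w t h] act_mult act_inv)
    also have "z t t \<otimes>\<^bsub>M\<^esub> z h \<one>\<^bsub>G\<^esub> \<otimes>\<^bsub>M\<^esub> inv\<^bsub>M\<^esub> (w t t \<otimes>\<^bsub>M\<^esub> w h \<one>\<^bsub>G\<^esub>) =
        D t \<otimes>\<^bsub>M\<^esub> (gact M h m \<otimes>\<^bsub>M\<^esub> inv\<^bsub>M\<^esub> m \<otimes>\<^bsub>M\<^esub> (w h \<one>\<^bsub>G\<^esub> \<otimes>\<^bsub>M\<^esub> inv\<^bsub>M\<^esub> (w h \<one>\<^bsub>G\<^esub>)))"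
      using val[OF z] val[OF w] t hG m
      by (simp add: D_def zw[OF h] M.inv_mult M.m_ac del: M.r_inv M.l_inv M.Units_r_inv M.Units_l_inv)
    finally show ?thesis
      using val[OF w] t hG m D[OF t] by (simp add: act_mult act_inv)
  qed
  have "F \<in> carrier (Ind G H M)"
  proof -
    have "m \<otimes>\<^bsub>M\<^esub> inv\<^bsub>M\<^esub> (D (t \<otimes>\<^bsub>G\<^esub> h)) = gact M (inv\<^bsub>G\<^esub> h) (m \<otimes>\<^bsub>M\<^esub> inv\<^bsub>M\<^esub> (D t))"
      if t: "t \<in> carrier G" and h: "h \<in> H" for t h
      using t h m D[OF t] by (simp add: DH[OF t h] act_mult act_inv M.inv_mult M.m_ac M.l_inv_cancel)
    then show ?thesis
      using m D by (auto simp: Ind_iff F_def)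
  qed
  moreover have "z x = gact (Ind G H M) x F \<otimes>\<^bsub>Ind G H M\<^esub> inv\<^bsub>Ind G H M\<^esub> F \<otimes>\<^bsub>Ind G H M\<^esub> w x"
    if x: "x \<in> carrier G" for x
  proof (rule PiE_ext[where k = "carrier G"])
    fix t assume t: "t \<in> carrier G"
    define s where "s = inv\<^bsub>G\<^esub> x \<otimes>\<^bsub>G\<^esub> t"
    have s: "s \<in> carrier G" and ts: "t = x \<otimes>\<^bsub>G\<^esub> s"
      using x t by (simp_all add: s_def flip: G.m_assoc)
    have Dt: "D t = z x t \<otimes>\<^bsub>M\<^esub> inv\<^bsub>M\<^esub> (w x t) \<otimes>\<^bsub>M\<^esub> D s"
      using val[OF z] val[OF w] x t s diag[OF z x s] diag[OF w x s]
      by (simp add: D_def M.inv_mult M.m_ac flip: ts)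
    have "(gact (Ind G H M) x F \<otimes>\<^bsub>Ind G H M\<^esub> inv\<^bsub>Ind G H M\<^esub> F \<otimes>\<^bsub>Ind G H M\<^esub> w x) t =
        m \<otimes>\<^bsub>M\<^esub> inv\<^bsub>M\<^esub> (D s) \<otimes>\<^bsub>M\<^esub> (inv\<^bsub>M\<^esub> m \<otimes>\<^bsub>M\<^esub> D t) \<otimes>\<^bsub>M\<^esub> w x t"
      using t s m D[OF t] D[OF s] \<open>F \<in> _\<close>
      by (simp add: Ind_mult Ind_act Ind_inv M.inv_mult flip: s_def) (simp add: F_def M.inv_mult)
    also have "\<dots> = (m \<otimes>\<^bsub>M\<^esub> inv\<^bsub>M\<^esub> m) \<otimes>\<^bsub>M\<^esub> (D s \<otimes>\<^bsub>M\<^esub> inv\<^bsub>M\<^esub> (D s)) \<otimes>\<^bsub>M\<^esub> (w x t \<otimes>\<^bsub>M\<^esub> inv\<^bsub>M\<^esub> (w x t)) \<otimes>\<^bsub>M\<^esub> z x t"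
      using m D[OF s] val[OF z x t] val[OF w x t]
      by (simp add: Dt M.m_ac del: M.r_inv M.l_inv M.Units_r_inv M.Units_l_inv)
    also have "\<dots> = z x t"
      using m D[OF s] val[OF z x t] val[OF w x t] by simp
    finally show "z x t = (gact (Ind G H M) x F \<otimes>\<^bsub>Ind G H M\<^esub> inv\<^bsub>Ind G H M\<^esub> F \<otimes>\<^bsub>Ind G H M\<^esub> w x) t"
      by simp
  next
    show "z x \<in> carrier G \<rightarrow>\<^sub>E carrier M"
      using Ind_PiE I.cocycle_closed[OF z x] by blast
    show "gact (Ind G H M) x F \<otimes>\<^bsub>Ind G H M\<^esub> inv\<^bsub>Ind G H M\<^esub> F \<otimes>\<^bsub>Ind G H M\<^esub> w x \<in> carrier G \<rightarrow>\<^sub>E carrier M"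
      using \<open>F \<in> _\<close> x I.cocycle_closed[OF w x] by (intro Ind_PiE I.M.m_closed I.act_closed I.M.inv_closed)
  qed
  ultimately show "c = d"
    using I.H1_class_eq_iff[OF z w] by (auto simp: c d)
qed

text \<open>
  The function \<open>\<eta>\<close> is the component in the subgroup with respect to a left transversal.  For a
  cocycle \<open>w\<close> on the subgroup, \<open>u(t) = w(\<eta>(t)\<^sup>-\<^sup>1)\<close> satisfies \<open>u(t h) = w(h\<^sup>-\<^sup>1) + h\<^sup>-\<^sup>1 u(t)\<close>; hence
  \<open>W(x)(t) = u(x\<^sup>-\<^sup>1 t) - u(t)\<close> lies in the induced module as a function of \<open>t\<close>.  It is a cocycle, being
  formally a coboundary, and its value at the identity is \<open>w\<close> on the subgroup.
\<close>

lemma shapiro_class: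
  assumes w: "w \<in> cocycles (subgrp G H) M"
    and eta: "\<And>x. x \<in> carrier G \<Longrightarrow> \<eta> x \<in> H" "\<eta> \<one>\<^bsub>G\<^esub> = \<one>\<^bsub>G\<^esub>"
      "\<And>x h. \<lbrakk>x \<in> carrier G; h \<in> H\<rbrakk> \<Longrightarrow> \<eta> (x \<otimes>\<^bsub>G\<^esub> h) = \<eta> x \<otimes>\<^bsub>G\<^esub> h"
  defines "W \<equiv> \<lambda>x\<in>carrier G. \<lambda>t\<in>carrier G.
    w (inv\<^bsub>G\<^esub> (\<eta> (inv\<^bsub>G\<^esub> x \<otimes>\<^bsub>G\<^esub> t))) \<otimes>\<^bsub>M\<^esub> inv\<^bsub>M\<^esub> (w (inv\<^bsub>G\<^esub> (\<eta> t)))"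
  shows "W \<in> cocycles G (Ind G H M)"
    and "shapiro G H M (H1_class (subgrp G H) M w) = H1_class G (Ind G H M) W"
proof -
  define u where "u t = w (inv\<^bsub>G\<^esub> (\<eta> t))" for t
  have u: "u t \<in> carrier M" if "t \<in> carrier G" for t
    using that S.cocycle_closed[OF w] eta(1) by (simp add: u_def)
  have uH: "u (t \<otimes>\<^bsub>G\<^esub> h) = w (inv\<^bsub>G\<^esub> h) \<otimes>\<^bsub>M\<^esub> gact M (inv\<^bsub>G\<^esub> h) (u t)"
    if "t \<in> carrier G" "h \<in> H" for t h
    using that eta S.cocycle_mult[OF w, of "inv\<^bsub>G\<^esub> h" "inv\<^bsub>G\<^esub> (\<eta> t)"]
    by (simp add: u_def G.inv_mult_group)
  have W: "W x t = u (inv\<^bsub>G\<^esub> x \<otimes>\<^bsub>G\<^esub> t) \<otimes>\<^bsub>M\<^esub> inv\<^bsub>M\<^esub> (u t)" if "x \<in> carrier G" "t \<in> carrier G" for x t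
    using that by (simp add: W_def u_def)
  have WI: "W x \<in> carrier (Ind G H M)" if x: "x \<in> carrier G" for x
  proof -
    have "W x (t \<otimes>\<^bsub>G\<^esub> h) = gact M (inv\<^bsub>G\<^esub> h) (W x t)" if t: "t \<in> carrier G" and h: "h \<in> H" for t h
    proof -
      let ?s = "inv\<^bsub>G\<^esub> x \<otimes>\<^bsub>G\<^esub> t"
      have wh: "w (inv\<^bsub>G\<^esub> h) \<in> carrier M" using S.cocycle_closed[OF w] h by simp
      have hG: "h \<in> carrier G" using h by simp
      have s: "?s \<in> carrier G" using x t by simp
      have "W x (t \<otimes>\<^bsub>G\<^esub> h) = u (?s \<otimes>\<^bsub>G\<^esub> h) \<otimes>\<^bsub>M\<^esub> inv\<^bsub>M\<^esub> (u (t \<otimes>\<^bsub>G\<^esub> h))"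
        using x t hG by (simp add: W G.m_assoc)
      also have "\<dots> = w (inv\<^bsub>G\<^esub> h) \<otimes>\<^bsub>M\<^esub> inv\<^bsub>M\<^esub> (w (inv\<^bsub>G\<^esub> h)) \<otimes>\<^bsub>M\<^esub>
          (gact M (inv\<^bsub>G\<^esub> h) (u ?s) \<otimes>\<^bsub>M\<^esub> inv\<^bsub>M\<^esub> (gact M (inv\<^bsub>G\<^esub> h) (u t)))"
        using u[OF s] u[OF t] wh hG
        by (simp add: uH[OF s h] uH[OF t h] M.inv_mult M.m_ac
              del: M.r_inv M.l_inv M.Units_r_inv M.Units_l_inv)
      also have "\<dots> = gact M (inv\<^bsub>G\<^esub> h) (W x t)"
        using u[OF s] u[OF t] wh hG by (simp add: W[OF x t] act_mult act_inv)
      finally show ?thesis .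
    qed
    moreover have "W x \<in> carrier G \<rightarrow>\<^sub>E carrier M"
      using x u by (auto simp: W) (simp add: W_def)
    ultimately show ?thesis by (simp add: Ind_iff)
  qed
  show coc: "W \<in> cocycles G (Ind G H M)"
  proof -
    have "W (x \<otimes>\<^bsub>G\<^esub> y) = W x \<otimes>\<^bsub>Ind G H M\<^esub> gact (Ind G H M) x (W y)"
      if x: "x \<in> carrier G" and y: "y \<in> carrier G" for x y
    proof (rule PiE_ext[where k = "carrier G"])
      fix t assume t: "t \<in> carrier G"
      let ?s = "inv\<^bsub>G\<^esub> x \<otimes>\<^bsub>G\<^esub> t"
      let ?r = "inv\<^bsub>G\<^esub> y \<otimes>\<^bsub>G\<^esub> ?s"
      have s: "?s \<in> carrier G" "?r \<in> carrier G" using x y t by simp_all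
      have "(W x \<otimes>\<^bsub>Ind G H M\<^esub> gact (Ind G H M) x (W y)) t =
          u ?s \<otimes>\<^bsub>M\<^esub> inv\<^bsub>M\<^esub> (u t) \<otimes>\<^bsub>M\<^esub> (u ?r \<otimes>\<^bsub>M\<^esub> inv\<^bsub>M\<^esub> (u ?s))"
        using x y t by (simp add: Ind_mult Ind_act W)
      also have "\<dots> = (u ?s \<otimes>\<^bsub>M\<^esub> inv\<^bsub>M\<^esub> (u ?s)) \<otimes>\<^bsub>M\<^esub> (u ?r \<otimes>\<^bsub>M\<^esub> inv\<^bsub>M\<^esub> (u t))"
        using u[OF s(1)] u[OF s(2)] u[OF t]
        by (simp add: M.m_ac del: M.r_inv M.l_inv M.Units_r_inv M.Units_l_inv)
      also have "\<dots> = W (x \<otimes>\<^bsub>G\<^esub> y) t"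
        using u[OF s(1)] u[OF s(2)] u[OF t] x y t by (simp add: W G.inv_mult_group G.m_assoc)
      finally show "W (x \<otimes>\<^bsub>G\<^esub> y) t = (W x \<otimes>\<^bsub>Ind G H M\<^esub> gact (Ind G H M) x (W y)) t" by simp
    next
      show "W (x \<otimes>\<^bsub>G\<^esub> y) \<in> carrier G \<rightarrow>\<^sub>E carrier M" using WI x y by (simp add: Ind_PiE)
      show "W x \<otimes>\<^bsub>Ind G H M\<^esub> gact (Ind G H M) x (W y) \<in> carrier G \<rightarrow>\<^sub>E carrier M"
        using WI x y by (intro Ind_PiE I.M.m_closed I.act_closed)
    qed
    then show ?thesis
      using WI by (auto simp: cocycles_def) (simp add: W_def)
  qed
  have "(\<lambda>h\<in>H. W h \<one>\<^bsub>G\<^esub>) = w"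
  proof (rule PiE_ext[where k = H])
    fix h assume h: "h \<in> H"
    have "u \<one>\<^bsub>G\<^esub> = \<one>\<^bsub>M\<^esub>"
      using S.cocycle_one[OF w] by (simp add: u_def eta(2))
    then show "(\<lambda>h\<in>H. W h \<one>\<^bsub>G\<^esub>) h = w h"
      using h uH[of "\<one>\<^bsub>G\<^esub>" "inv\<^bsub>G\<^esub> h"] S.cocycle_closed[OF w, of h] by (simp add: W)
  next
    show "(\<lambda>h\<in>H. W h \<one>\<^bsub>G\<^esub>) \<in> H \<rightarrow>\<^sub>E carrier M" using WI Ind_closed by auto
    show "w \<in> H \<rightarrow>\<^sub>E carrier M" using S.cocycles_PiE[OF w] by simp
  qed
  then have "shapiro_eval G H M (H1_class G (Ind G H M) W) = H1_class (subgrp G H) M w"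
    using eval_class[OF coc] by simp
  then show "shapiro G H M (H1_class (subgrp G H) M w) = H1_class G (Ind G H M) W"
    unfolding shapiro_def by (rule inv_into_f_eq[OF eval_injective I.H1_classI[OF coc]])
qed

end

section \<open>Function modules, direct sums and tensor products\<close>

lemma group_module_fun_module:
  assumes "group_module G M"
    and closed: "\<And>x s. \<lbrakk>x \<in> carrier G; s \<in> S\<rbrakk> \<Longrightarrow> sact x s \<in> S"
    and comp: "\<And>x y s. \<lbrakk>x \<in> carrier G; y \<in> carrier G; s \<in> S\<rbrakk> \<Longrightarrow>
      sact (x \<otimes>\<^bsub>G\<^esub> y) s = sact x (sact y s)"
    and one: "\<And>s. s \<in> S \<Longrightarrow> sact \<one>\<^bsub>G\<^esub> s = s"
  shows "group_module G (fun_module G S sact M)"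
proof -
  interpret group_module G M by fact
  let ?F = "fun_module G S sact M"
  have "comm_group ?F"
  proof (rule comm_groupI)
    fix f f' f'' assume "f \<in> carrier ?F" "f' \<in> carrier ?F" "f'' \<in> carrier ?F"
    then show "f \<otimes>\<^bsub>?F\<^esub> f' \<otimes>\<^bsub>?F\<^esub> f'' = f \<otimes>\<^bsub>?F\<^esub> (f' \<otimes>\<^bsub>?F\<^esub> f'')"
      by (auto simp: fun_module_def PiE_mem[of _ S "\<lambda>_. carrier M"] M.m_assoc intro!: restrict_ext)
  next
    fix f assume f: "f \<in> carrier ?F"
    then show "\<one>\<^bsub>?F\<^esub> \<otimes>\<^bsub>?F\<^esub> f = f"
      by (auto simp: fun_module_def PiE_mem[of _ S "\<lambda>_. carrier M"] intro!: PiE_ext[where k = S])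
    have "(\<lambda>s\<in>S. inv\<^bsub>M\<^esub> (f s)) \<in> carrier ?F" "(\<lambda>s\<in>S. inv\<^bsub>M\<^esub> (f s)) \<otimes>\<^bsub>?F\<^esub> f = \<one>\<^bsub>?F\<^esub>"
      using f by (auto simp: fun_module_def PiE_mem[of _ S "\<lambda>_. carrier M"] intro!: restrict_ext)
    then show "\<exists>y\<in>carrier ?F. y \<otimes>\<^bsub>?F\<^esub> f = \<one>\<^bsub>?F\<^esub>" by blast
  qed (auto simp: fun_module_def PiE_mem[of _ S "\<lambda>_. carrier M"] M.m_comm intro!: restrict_ext)
  then interpret F: comm_group ?F .
  show ?thesis
  proof
    fix f assume "f \<in> carrier ?F"
    then show "gact ?F \<one>\<^bsub>G\<^esub> f = f"
      by (auto simp: fun_module_def PiE_mem[of _ S "\<lambda>_. carrier M"] one act_one intro!: PiE_ext[where k = S])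
  qed (auto simp: fun_module_def PiE_mem[of _ S "\<lambda>_. carrier M"] closed comp act_mult act_comp G.inv_mult_group intro!: restrict_ext)
qed

lemma group_module_dsum:
  assumes "group_module G M" "group_module G N"
  shows "group_module G (dsum M N)"
proof -
  interpret M: group_module G M by fact
  interpret N: group_module G N by fact
  have "comm_group (dsum M N)"
  proof (rule comm_groupI)
    fix x assume "x \<in> carrier (dsum M N)"
    then show "\<exists>y\<in>carrier (dsum M N). y \<otimes>\<^bsub>dsum M N\<^esub> x = \<one>\<^bsub>dsum M N\<^esub>"
      by (intro bexI[of _ "(inv\<^bsub>M\<^esub> (fst x), inv\<^bsub>N\<^esub> (snd x))"]) (auto simp: dsum_def)
  qed (auto simp: dsum_def M.M.m_assoc N.M.m_assoc M.M.m_ac N.M.m_ac)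
  then interpret D: comm_group "dsum M N" .
  show ?thesis
    by unfold_locales
      (auto simp: dsum_def M.act_mult N.act_mult M.act_comp N.act_comp M.act_one N.act_one)
qed

text \<open>
  For the tensor product, which occurs both as a group and as a module, with the same operation.
\<close>

lemma comm_group_cong:
  assumes "comm_group G" "carrier H = carrier G" "monoid.mult H = monoid.mult G" "one H = one G"
  shows "comm_group H"
proof -
  interpret comm_group G by fact
  have "\<exists>y\<in>carrier G. y \<otimes>\<^bsub>G\<^esub> x = \<one>\<^bsub>G\<^esub>" if "x \<in> carrier G" for x
    using that l_inv inv_closed by blast
  then show ?thesis
    by (intro comm_groupI) (auto simp: assms m_ac)
qed

locale balanced_map =
  L: comm_group L
  for K :: "'k set" and M :: "('k, 'g, 'a, 'x) gmodule_scheme" and N :: "('k, 'g, 'b, 'y) gmodule_scheme"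
    and L :: "('c, 'z) monoid_scheme" and f :: "'a \<Rightarrow> 'b \<Rightarrow> 'c" +
  assumes bal_closed: "\<lbrakk>m \<in> carrier M; n \<in> carrier N\<rbrakk> \<Longrightarrow> f m n \<in> carrier L"
    and bal_left: "\<lbrakk>m \<in> carrier M; m' \<in> carrier M; n \<in> carrier N\<rbrakk> \<Longrightarrow>
      f (m \<otimes>\<^bsub>M\<^esub> m') n = f m n \<otimes>\<^bsub>L\<^esub> f m' n"
    and bal_right: "\<lbrakk>m \<in> carrier M; n \<in> carrier N; n' \<in> carrier N\<rbrakk> \<Longrightarrow>
      f m (n \<otimes>\<^bsub>N\<^esub> n') = f m n \<otimes>\<^bsub>L\<^esub> f m n'"
    and bal_scal: "\<lbrakk>c \<in> K; m \<in> carrier M; n \<in> carrier N\<rbrakk> \<Longrightarrow>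
      f (scal M c m) n = f m (scal N c n)"

locale tensor_product =
  M: comm_group M + N: comm_group N
  for K :: "'k set" and M :: "('k, 'g, 'a, 'x) gmodule_scheme" and N :: "('k, 'g, 'b, 'y) gmodule_scheme" +
  assumes scalM: "\<lbrakk>c \<in> K; m \<in> carrier M\<rbrakk> \<Longrightarrow> scal M c m \<in> carrier M"
    and scalN: "\<lbrakk>c \<in> K; n \<in> carrier N\<rbrakk> \<Longrightarrow> scal N c n \<in> carrier N"
begin

abbreviation "Free \<equiv> free_Abelian_group (carrier M \<times> carrier N)"
abbreviation "Rels \<equiv> generate Free (tensor_relations K M N)"
abbreviation "T \<equiv> tensor_group K M N"
abbreviation "pure \<equiv> pure_tensor K M N"

lemma tensor_carrier [simp]: "carrier (tensor K M N) = carrier T"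
  and tensor_mult [simp]: "monoid.mult (tensor K M N) = monoid.mult T"
  and tensor_one [simp]: "one (tensor K M N) = one T"
  by (simp_all add: tensor_def)

sublocale Free: comm_group Free
  by (rule abelian_free_Abelian_group)

lemma relations_closed: "tensor_relations K M N \<subseteq> carrier Free"
  unfolding tensor_relations_def
  by (auto simp: scalM scalN dest!: subsetD[OF keys_diff])

lemma Rels_subgroup: "subgroup Rels Free"
  by (rule Free.generate_is_subgroup[OF relations_closed])

lemma Rels_normal: "Rels \<lhd> Free"
  by (rule Free.subgroup_imp_normal[OF Rels_subgroup])

sublocale T: comm_group T
  unfolding tensor_group_def by (rule Free.abelian_FactGroup[OF Rels_subgroup])

sublocale T': comm_group "tensor K M N"
  by (rule comm_group_cong[OF T.comm_group_axioms]) simp_all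

lemma quotient_hom: "(\<lambda>x. Rels #>\<^bsub>Free\<^esub> x) \<in> hom Free T"
  unfolding tensor_group_def by (rule normal.r_coset_hom_Mod[OF Rels_normal])

lemma quotient_group_hom: "group_hom Free T (\<lambda>x. Rels #>\<^bsub>Free\<^esub> x)"
  by unfold_locales (rule quotient_hom)

lemma pure_closed [intro]: "\<lbrakk>m \<in> carrier M; n \<in> carrier N\<rbrakk> \<Longrightarrow> pure m n \<in> carrier T"
  unfolding pure_tensor_def by (rule hom_in_carrier[OF quotient_hom]) simp

text \<open>
  The relations of biadditivity have the form \<open>c - a - b\<close>; with \<open>b = 0\<close> this also covers the
  balancing relation.
\<close>

lemma quotient_relation:
  assumes "c - a - b \<in> tensor_relations K M N"
    "a \<in> carrier Free" "b \<in> carrier Free" "c \<in> carrier Free"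
  shows "Rels #>\<^bsub>Free\<^esub> c = (Rels #>\<^bsub>Free\<^esub> a) \<otimes>\<^bsub>T\<^esub> (Rels #>\<^bsub>Free\<^esub> b)"
proof -
  have ab: "a + b \<in> carrier Free" using Free.m_closed[OF assms(2,3)] by simp
  have "c - (a + b) \<in> Rels"
    using generate.incl[OF assms(1)] by (simp add: diff_diff_eq)
  then have "c \<in> Rels #>\<^bsub>Free\<^esub> (a + b)"
    by (auto simp: r_coset_def intro!: bexI[of _ "c - (a + b)"])
  then have "Rels #>\<^bsub>Free\<^esub> c = Rels #>\<^bsub>Free\<^esub> (a + b)"
    by (rule Free.repr_independence[OF _ ab Rels_subgroup, symmetric])
  also have "\<dots> = (Rels #>\<^bsub>Free\<^esub> a) \<otimes>\<^bsub>T\<^esub> (Rels #>\<^bsub>Free\<^esub> b)"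
    using hom_mult[OF quotient_hom assms(2,3)] by simp
  finally show ?thesis .
qed

lemma pure_balanced: "balanced_map K M N T pure"
proof
  fix m m' n assume "m \<in> carrier M" "m' \<in> carrier M" "n \<in> carrier N"
  then show "pure (m \<otimes>\<^bsub>M\<^esub> m') n = pure m n \<otimes>\<^bsub>T\<^esub> pure m' n"
    unfolding pure_tensor_def
    by (intro quotient_relation) (auto simp: tensor_relations_def)
next
  fix m n n' assume "m \<in> carrier M" "n \<in> carrier N" "n' \<in> carrier N"
  then show "pure m (n \<otimes>\<^bsub>N\<^esub> n') = pure m n \<otimes>\<^bsub>T\<^esub> pure m n'"
    unfolding pure_tensor_def
    by (intro quotient_relation) (auto simp: tensor_relations_def)
next
  fix c m n assume *: "c \<in> K" "m \<in> carrier M" "n \<in> carrier N"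
  have "Rels #>\<^bsub>Free\<^esub> frag_of (scal M c m, n) =
      (Rels #>\<^bsub>Free\<^esub> frag_of (m, scal N c n)) \<otimes>\<^bsub>T\<^esub> (Rels #>\<^bsub>Free\<^esub> 0)"
    using * by (intro quotient_relation) (auto simp: tensor_relations_def scalM scalN)
  moreover have "Rels #>\<^bsub>Free\<^esub> 0 = \<one>\<^bsub>T\<^esub>"
    using group_hom.hom_one[OF quotient_group_hom] by simp
  ultimately show "pure (scal M c m) n = pure m (scal N c n)"
    using pure_closed[OF *(2) scalN[OF *(1,3)]] by (simp add: pure_tensor_def)
qed auto

text \<open>
  A basis element of the free abelian group becomes a pure tensor, and the free abelian group is
  generated by its basis.
\<close>

lemma tensor_induct [consumes 1, case_names one pure diff]:
  assumes c: "c \<in> carrier T"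
    and one: "P \<one>\<^bsub>T\<^esub>"
    and pure: "\<And>m n. \<lbrakk>m \<in> carrier M; n \<in> carrier N\<rbrakk> \<Longrightarrow> P (pure m n)"
    and diff: "\<And>s t. \<lbrakk>s \<in> carrier T; t \<in> carrier T; P s; P t\<rbrakk> \<Longrightarrow> P (s \<otimes>\<^bsub>T\<^esub> inv\<^bsub>T\<^esub> t)"
  shows "P c"
proof -
  interpret q: group_hom Free T "\<lambda>x. Rels #>\<^bsub>Free\<^esub> x" by (rule quotient_group_hom)
  from c obtain x where x: "x \<in> carrier Free" "c = Rels #>\<^bsub>Free\<^esub> x"
    unfolding tensor_group_def carrier_FactGroup by (elim imageE)
  have "P (Rels #>\<^bsub>Free\<^esub> x)"
  proof (rule free_Abelian_group_induct[of x "carrier M \<times> carrier N"])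
    show "Poly_Mapping.keys x \<subseteq> carrier M \<times> carrier N" using x(1) by simp
    show "P (Rels #>\<^bsub>Free\<^esub> 0)" using q.hom_one one by simp
  next
    fix x y assume xy: "Poly_Mapping.keys x \<subseteq> carrier M \<times> carrier N"
      "Poly_Mapping.keys y \<subseteq> carrier M \<times> carrier N"
      and P: "P (Rels #>\<^bsub>Free\<^esub> x)" "P (Rels #>\<^bsub>Free\<^esub> y)"
    have xy': "x \<in> carrier Free" "y \<in> carrier Free" using xy by simp_all
    have "Rels #>\<^bsub>Free\<^esub> (x \<otimes>\<^bsub>Free\<^esub> inv\<^bsub>Free\<^esub> y) = (Rels #>\<^bsub>Free\<^esub> x) \<otimes>\<^bsub>T\<^esub> inv\<^bsub>T\<^esub> (Rels #>\<^bsub>Free\<^esub> y)"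
      using xy' by (simp only: q.hom_mult q.hom_inv Free.inv_closed)
    moreover have "x \<otimes>\<^bsub>Free\<^esub> inv\<^bsub>Free\<^esub> y = x - y" using xy by simp
    ultimately show "P (Rels #>\<^bsub>Free\<^esub> (x - y))"
      using diff[OF q.hom_closed[OF xy'(1)] q.hom_closed[OF xy'(2)] P] by simp
  next
    fix a assume "a \<in> carrier M \<times> carrier N"
    then show "P (Rels #>\<^bsub>Free\<^esub> frag_of a)"
      using pure by (cases a) (auto simp: pure_tensor_def)
  qed
  then show ?thesis by (simp add: x(2))
qed

lemma hom_eq_on_pure:
  assumes h: "h \<in> hom T L" and h': "h' \<in> hom T L" and L: "group L"
    and eq: "\<And>m n. \<lbrakk>m \<in> carrier M; n \<in> carrier N\<rbrakk> \<Longrightarrow> h (pure m n) = h' (pure m n)"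
    and c: "c \<in> carrier T"
  shows "h c = h' c"
proof -
  interpret L: group L by fact
  interpret h: group_hom T L h by unfold_locales (rule h)
  interpret h': group_hom T L h' by unfold_locales (rule h')
  show ?thesis
    using c by (induction rule: tensor_induct) (auto simp: eq)
qed

text \<open>
  Existence comes from the universal properties of the free abelian group and of the quotient,
  uniqueness from the fact that the pure tensors generate.
\<close>

lemma tensor_lift:
  assumes "balanced_map K M N L f"
  shows "tensor_lift K M N L f \<in> hom T L"
    and "\<lbrakk>m \<in> carrier M; n \<in> carrier N\<rbrakk> \<Longrightarrow> tensor_lift K M N L f (pure m n) = f m n"
proof -
  interpret f: balanced_map K M N L f by fact
  have im: "(\<lambda>(m, n). f m n) ` (carrier M \<times> carrier N) \<subseteq> carrier L"
    using f.bal_closed by auto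
  obtain h0 where h0: "h0 \<in> hom Free L"
    and h0_of: "\<And>x. x \<in> carrier M \<times> carrier N \<Longrightarrow> h0 (frag_of x) = (\<lambda>(m, n). f m n) x"
    using f.L.free_Abelian_group_universal[OF im] by blast
  interpret h0: group_hom Free L h0 by unfold_locales (rule h0)
  have diff: "h0 (x - y) = h0 x \<otimes>\<^bsub>L\<^esub> inv\<^bsub>L\<^esub> (h0 y)" if "x \<in> carrier Free" "y \<in> carrier Free" for x y
    using h0.hom_mult[of x "inv\<^bsub>Free\<^esub> y"] h0.hom_inv[of y] that by simp
  have diff_closed: "x - y \<in> carrier Free" if "x \<in> carrier Free" "y \<in> carrier Free" for x y
    using Free.m_closed[of x "inv\<^bsub>Free\<^esub> y"] that by simp
  have "tensor_relations K M N \<subseteq> kernel Free L h0"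
  proof
    fix r assume r: "r \<in> tensor_relations K M N"
    then consider (left) m m' n where "r = frag_of (m \<otimes>\<^bsub>M\<^esub> m', n) - frag_of (m, n) - frag_of (m', n)"
        "m \<in> carrier M" "m' \<in> carrier M" "n \<in> carrier N"
      | (right) m n n' where "r = frag_of (m, n \<otimes>\<^bsub>N\<^esub> n') - frag_of (m, n) - frag_of (m, n')"
        "m \<in> carrier M" "n \<in> carrier N" "n' \<in> carrier N"
      | (scal) c m n where "r = frag_of (scal M c m, n) - frag_of (m, scal N c n)"
        "c \<in> K" "m \<in> carrier M" "n \<in> carrier N"
      unfolding tensor_relations_def by blast
    then have "h0 r = \<one>\<^bsub>L\<^esub>"
    proof cases
      case left
      then have "h0 r = f (m \<otimes>\<^bsub>M\<^esub> m') n \<otimes>\<^bsub>L\<^esub> inv\<^bsub>L\<^esub> (f m n) \<otimes>\<^bsub>L\<^esub> inv\<^bsub>L\<^esub> (f m' n)"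
        by (simp add: diff diff_closed h0_of del: carrier_free_Abelian_group_iff)
      then show ?thesis
        using left f.bal_closed by (simp add: f.bal_left f.L.m_ac f.L.l_inv_cancel)
    next
      case right
      then have "h0 r = f m (n \<otimes>\<^bsub>N\<^esub> n') \<otimes>\<^bsub>L\<^esub> inv\<^bsub>L\<^esub> (f m n) \<otimes>\<^bsub>L\<^esub> inv\<^bsub>L\<^esub> (f m n')"
        by (simp add: diff diff_closed h0_of del: carrier_free_Abelian_group_iff)
      then show ?thesis
        using right f.bal_closed by (simp add: f.bal_right f.L.m_ac f.L.l_inv_cancel)
    next
      case scal
      then have "h0 r = f (scal M c m) n \<otimes>\<^bsub>L\<^esub> inv\<^bsub>L\<^esub> (f m (scal N c n))"
        by (simp add: diff h0_of scalM scalN del: carrier_free_Abelian_group_iff)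
      then show ?thesis
        using scal f.bal_closed by (simp add: f.bal_scal scalN)
    qed
    then show "r \<in> kernel Free L h0"
      using subsetD[OF relations_closed r]
      by (simp add: kernel_def del: carrier_free_Abelian_group_iff)
  qed
  then have "Rels \<subseteq> kernel Free L h0"
    by (rule Free.generate_subgroup_incl[OF _ h0.subgroup_kernel])
  then obtain g where g: "g \<in> hom (Free Mod Rels) L"
    and g_coset: "\<And>x. x \<in> carrier Free \<Longrightarrow> g (Rels #>\<^bsub>Free\<^esub> x) = h0 x"
    using h0.FactGroup_universal_kernel[OF Rels_normal] by blast
  define h where "h = restrict g (carrier T)"
  have h: "h \<in> hom T L" "h \<in> extensional (carrier T)"
    using g T.m_closed by (auto simp: h_def hom_def tensor_group_def)
  have h_pure: "\<forall>m\<in>carrier M. \<forall>n\<in>carrier N. h (pure m n) = f m n"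
  proof (intro ballI)
    fix m n assume mn: "m \<in> carrier M" "n \<in> carrier N"
    have "h (pure m n) = g (pure m n)" using pure_closed[OF mn] by (simp add: h_def)
    also have "\<dots> = h0 (frag_of (m, n))" unfolding pure_tensor_def using mn by (intro g_coset) simp
    finally show "h (pure m n) = f m n" using mn by (simp add: h0_of)
  qed
  have "tensor_lift K M N L f = h"
    unfolding tensor_lift_def
  proof (rule the_equality)
    fix h' assume h': "h' \<in> hom T L \<inter> extensional (carrier T) \<and>
      (\<forall>m\<in>carrier M. \<forall>n\<in>carrier N. h' (pure m n) = f m n)"
    show "h' = h"
    proof (rule extensionalityI[of _ "carrier T"])
      fix c assume c: "c \<in> carrier T"
      show "h' c = h c"
        by (rule hom_eq_on_pure[of h' L h, OF _ h(1) f.L.group_axioms _ c]) (use h' h_pure in auto)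
    qed (use h' h in auto)
  qed (use h h_pure in auto)
  then show "tensor_lift K M N L f \<in> hom T L"
    "\<lbrakk>m \<in> carrier M; n \<in> carrier N\<rbrakk> \<Longrightarrow> tensor_lift K M N L f (pure m n) = f m n"
    using h h_pure by auto
qed

end

locale tensor_module =
  M: group_module G M + N: group_module G N + tensor_product K M N
  for G :: "('g, 'w) monoid_scheme" and K :: "'k set" and M :: "('k, 'g, 'a, 'x) gmodule_scheme"
    and N :: "('k, 'g, 'b, 'y) gmodule_scheme" +
  assumes act_scalM: "\<lbrakk>x \<in> carrier G; c \<in> K; m \<in> carrier M\<rbrakk> \<Longrightarrow>
      gact M x (scal M c m) = scal M c (gact M x m)"
    and act_scalN: "\<lbrakk>x \<in> carrier G; c \<in> K; n \<in> carrier N\<rbrakk> \<Longrightarrow>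
      gact N x (scal N c n) = scal N c (gact N x n)"
begin

lemma act_balanced:
  assumes x: "x \<in> carrier G"
  shows "balanced_map K M N T (\<lambda>m n. pure (gact M x m) (gact N x n))"
proof -
  interpret p: balanced_map K M N T pure by (rule pure_balanced)
  show ?thesis
    using x by unfold_locales (auto simp: M.act_mult N.act_mult p.bal_left p.bal_right act_scalM
        act_scalN p.bal_scal)
qed

lemma tensor_act_hom: "x \<in> carrier G \<Longrightarrow> gact (tensor K M N) x \<in> hom T T"
  using tensor_lift(1)[OF act_balanced] by (simp add: tensor_def)

lemma tensor_act_pure:
  "\<lbrakk>x \<in> carrier G; m \<in> carrier M; n \<in> carrier N\<rbrakk> \<Longrightarrow>
    gact (tensor K M N) x (pure m n) = pure (gact M x m) (gact N x n)"
  using tensor_lift(2)[OF act_balanced] by (simp add: tensor_def)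

lemma group_module_tensor: "group_module G (tensor K M N)"
proof
  fix x s assume x: "x \<in> carrier G" and s: "s \<in> carrier (tensor K M N)"
  show "gact (tensor K M N) x s \<in> carrier (tensor K M N)"
    using hom_in_carrier[OF tensor_act_hom[OF x]] s by simp
  fix t assume t: "t \<in> carrier (tensor K M N)"
  show "gact (tensor K M N) x (s \<otimes>\<^bsub>tensor K M N\<^esub> t) =
      gact (tensor K M N) x s \<otimes>\<^bsub>tensor K M N\<^esub> gact (tensor K M N) x t"
    using hom_mult[OF tensor_act_hom[OF x]] s t by simp
next
  fix x y s assume x: "x \<in> carrier G" and y: "y \<in> carrier G" and s: "s \<in> carrier (tensor K M N)"
  have "gact (tensor K M N) (x \<otimes>\<^bsub>G\<^esub> y) s = (gact (tensor K M N) x \<circ> gact (tensor K M N) y) s"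
  proof (rule hom_eq_on_pure[where L = T and c = s and h = "gact (tensor K M N) (x \<otimes>\<^bsub>G\<^esub> y)"
        and h' = "gact (tensor K M N) x \<circ> gact (tensor K M N) y"])
    show "gact (tensor K M N) (x \<otimes>\<^bsub>G\<^esub> y) \<in> hom T T" using x y by (simp add: tensor_act_hom)
    show "gact (tensor K M N) x \<circ> gact (tensor K M N) y \<in> hom T T"
      by (rule hom_compose[OF tensor_act_hom[OF y] tensor_act_hom[OF x]])
  qed (use x y s in \<open>auto simp: tensor_act_pure M.act_comp N.act_comp\<close>)
  then show "gact (tensor K M N) (x \<otimes>\<^bsub>G\<^esub> y) s = gact (tensor K M N) x (gact (tensor K M N) y s)"
    by simp
next
  fix s assume s: "s \<in> carrier (tensor K M N)"
  have "gact (tensor K M N) \<one>\<^bsub>G\<^esub> s = id s"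
  proof (rule hom_eq_on_pure[where L = T and c = s and h' = id])
    show "gact (tensor K M N) \<one>\<^bsub>G\<^esub> \<in> hom T T" by (simp add: tensor_act_hom)
    show "id \<in> hom T T" by (simp add: hom_def)
  qed (use s in \<open>auto simp: tensor_act_pure M.act_one N.act_one\<close>)
  then show "gact (tensor K M N) \<one>\<^bsub>G\<^esub> s = s" by simp
qed

lemma tensor_lift_module_hom:
  assumes "balanced_map K M N L f" and L: "group_module G L"
    and equi: "\<And>x m n. \<lbrakk>x \<in> carrier G; m \<in> carrier M; n \<in> carrier N\<rbrakk> \<Longrightarrow>
      f (gact M x m) (gact N x n) = gact L x (f m n)"
  shows "gmodule_hom G (tensor K M N) L (tensor_lift K M N L f)"
proof -
  interpret T'': group_module G "tensor K M N" by (rule group_module_tensor)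
  interpret L: group_module G L by fact
  note lift = tensor_lift[OF assms(1)]
  show ?thesis
  proof
    show "tensor_lift K M N L f \<in> hom (tensor K M N) L"
      using lift(1) by (simp add: hom_def)
    fix x t assume x: "x \<in> carrier G" and t: "t \<in> carrier (tensor K M N)"
    have "(tensor_lift K M N L f \<circ> gact (tensor K M N) x) t = (gact L x \<circ> tensor_lift K M N L f) t"
    proof (rule hom_eq_on_pure[where L = L and c = t])
      show "tensor_lift K M N L f \<circ> gact (tensor K M N) x \<in> hom T L"
        by (rule hom_compose[OF tensor_act_hom[OF x] lift(1)])
      show "gact L x \<circ> tensor_lift K M N L f \<in> hom T L"
        by (rule hom_compose[OF lift(1) group_hom.homh[OF L.act_group_hom[OF x]]])
    qed (use x t in \<open>auto simp: tensor_act_pure lift equi\<close>)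
    then show "tensor_lift K M N L f (gact (tensor K M N) x t) = gact L x (tensor_lift K M N L f t)"
      by simp
  qed
qed

end

section \<open>Hecke operators on cocycles\<close>

lemma (in comm_monoid) finprod_cartesian_product:
  assumes "finite A" "finite B" "\<And>a b. \<lbrakk>a \<in> A; b \<in> B\<rbrakk> \<Longrightarrow> f (a, b) \<in> carrier G"
  shows "finprod G f (A \<times> B) = finprod G (\<lambda>a. finprod G (\<lambda>b. f (a, b)) B) A"
  using assms(1,3)
proof (induction A rule: finite_induct)
  case (insert a A)
  have "insert a A \<times> B = Pair a ` B \<union> A \<times> B" by auto
  then have "finprod G f (insert a A \<times> B) = finprod G f (Pair a ` B) \<otimes> finprod G f (A \<times> B)"
    using insert assms(2) by (simp only:, intro finprod_Un_disjoint) auto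
  moreover have "finprod G f (Pair a ` B) = finprod G (\<lambda>b. f (a, b)) B"
    using insert by (intro finprod_reindex) (auto simp: inj_on_def)
  ultimately show ?case
    using insert by (simp add: Pi_def)
qed auto

lemma finprod_hom:
  assumes "comm_group G" "comm_group H" "h \<in> hom G H" "f \<in> S \<rightarrow> carrier G"
  shows "h (finprod G f S) = finprod H (\<lambda>s. h (f s)) S"
proof -
  interpret G: comm_group G by fact
  interpret H: comm_group H by fact
  interpret h: group_hom G H h by unfold_locales (rule assms(3))
  show ?thesis
    using assms(4) by (induction S rule: infinite_finite_induct) (auto simp: Pi_def)
qed

text \<open>
  Double coset operators without matrices.  In the applications the index \<open>s\<close> stands for a matrix
  \<open>\<delta>\<^sub>s\<close>, and \<open>\<delta>\<^sub>s x = \<rho>(s, x) \<delta>\<^sub>t\<close> with \<open>t = \<sigma>(s, x)\<close>; this makes \<open>\<sigma>\<close> a right action on the indices and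
  \<open>\<rho>\<close> a cocycle for it.  The weight \<open>\<phi>\<^sub>s\<close> plays the role of the adjugate of \<open>\<delta>\<^sub>s\<close>, which satisfies
  \<open>adj(\<delta>\<^sub>s) \<rho>(s, x) = x adj(\<delta>\<^sub>t)\<close>.
\<close>

locale hecke_datum =
  A: group_module G M + B: group_module G M'
  for G :: "('g, 'x) monoid_scheme" and M :: "('k, 'g, 'a, 'y) gmodule_scheme"
    and M' :: "('l, 'g, 'b, 'w) gmodule_scheme"
    and S :: "'s set" and \<sigma> :: "'s \<Rightarrow> 'g \<Rightarrow> 's" and \<rho> :: "'s \<Rightarrow> 'g \<Rightarrow> 'g" and \<phi> :: "'s \<Rightarrow> 'a \<Rightarrow> 'b" +
  assumes finite_S [simp]: "finite S"
    and perm_closed [simp]: "\<lbrakk>s \<in> S; x \<in> carrier G\<rbrakk> \<Longrightarrow> \<sigma> s x \<in> S"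
    and perm_mult: "\<lbrakk>s \<in> S; x \<in> carrier G; y \<in> carrier G\<rbrakk> \<Longrightarrow> \<sigma> s (x \<otimes>\<^bsub>G\<^esub> y) = \<sigma> (\<sigma> s x) y"
    and perm_one: "s \<in> S \<Longrightarrow> \<sigma> s \<one>\<^bsub>G\<^esub> = s"
    and fact_closed [simp]: "\<lbrakk>s \<in> S; x \<in> carrier G\<rbrakk> \<Longrightarrow> \<rho> s x \<in> carrier G"
    and fact_mult: "\<lbrakk>s \<in> S; x \<in> carrier G; y \<in> carrier G\<rbrakk> \<Longrightarrow>
      \<rho> s (x \<otimes>\<^bsub>G\<^esub> y) = \<rho> s x \<otimes>\<^bsub>G\<^esub> \<rho> (\<sigma> s x) y"
    and weight_hom: "s \<in> S \<Longrightarrow> \<phi> s \<in> hom M M'"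
    and weight_act: "\<lbrakk>s \<in> S; x \<in> carrier G; m \<in> carrier M\<rbrakk> \<Longrightarrow>
      \<phi> s (gact M (\<rho> s x) m) = gact M' x (\<phi> (\<sigma> s x) m)"
begin

definition operator where
  "operator z = (\<lambda>x\<in>carrier G. finprod M' (\<lambda>s. \<phi> s (z (\<rho> s x))) S)"

lemma weight_closed [simp]: "\<lbrakk>s \<in> S; m \<in> carrier M\<rbrakk> \<Longrightarrow> \<phi> s m \<in> carrier M'"
  using hom_in_carrier[OF weight_hom] .

lemma weight_mult: "\<lbrakk>s \<in> S; m \<in> carrier M; n \<in> carrier M\<rbrakk> \<Longrightarrow>
    \<phi> s (m \<otimes>\<^bsub>M\<^esub> n) = \<phi> s m \<otimes>\<^bsub>M'\<^esub> \<phi> s n"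
  using hom_mult[OF weight_hom] .

lemma weight_inv: "\<lbrakk>s \<in> S; m \<in> carrier M\<rbrakk> \<Longrightarrow> \<phi> s (inv\<^bsub>M\<^esub> m) = inv\<^bsub>M'\<^esub> (\<phi> s m)"
  by (rule group_hom.hom_inv) (unfold_locales, auto intro: weight_hom)

lemma perm_image: "x \<in> carrier G \<Longrightarrow> (\<lambda>s. \<sigma> s x) ` S = S"
proof (intro equalityI subsetI)
  fix s assume "x \<in> carrier G" "s \<in> S"
  moreover from this have "s = \<sigma> (\<sigma> s (inv\<^bsub>G\<^esub> x)) x"
    by (simp flip: perm_mult add: perm_one)
  ultimately show "s \<in> (\<lambda>s. \<sigma> s x) ` S" by auto
qed auto

lemma perm_inj: "x \<in> carrier G \<Longrightarrow> inj_on (\<lambda>s. \<sigma> s x) S"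
  by (rule eq_card_imp_inj_on) (simp_all add: perm_image)

lemma finprod_perm:
  assumes "x \<in> carrier G" "f \<in> S \<rightarrow> carrier M'"
  shows "finprod M' (\<lambda>s. f (\<sigma> s x)) S = finprod M' f S"
  using B.M.finprod_reindex[of f "\<lambda>s. \<sigma> s x" S] assms by (simp add: perm_image perm_inj)

lemma finprod_act_perm:
  assumes x: "x \<in> carrier G" and f: "f \<in> S \<rightarrow> carrier M'"
  shows "finprod M' (\<lambda>s. gact M' x (f (\<sigma> s x))) S = gact M' x (finprod M' f S)"
proof -
  have "gact M' x (finprod M' f S) = gact M' x (finprod M' (\<lambda>s. f (\<sigma> s x)) S)"
    by (simp only: finprod_perm[OF assms])
  also have "\<dots> = finprod M' (\<lambda>s. gact M' x (f (\<sigma> s x))) S"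
    by (rule finprod_hom[OF B.M.comm_group_axioms B.M.comm_group_axioms
          group_hom.homh[OF B.act_group_hom[OF x]]]) (use x f in auto)
  finally show ?thesis by simp
qed

lemma operator_closed:
  "\<lbrakk>z \<in> cocycles G M; x \<in> carrier G\<rbrakk> \<Longrightarrow> operator z x \<in> carrier M'"
  by (auto simp: operator_def A.cocycle_closed intro!: B.M.finprod_closed)

text \<open>
  For fixed \<open>x\<close> the map \<open>s \<mapsto> \<sigma>(s, x)\<close> permutes the indices, so the terms in which \<open>x\<close> acts on
  \<open>\<phi>\<^sub>t\<close> with \<open>t = \<sigma>(s, x)\<close> can be summed over \<open>t\<close>.  Thus a cocycle goes to a cocycle, and the
  coboundary of \<open>m\<close> to the coboundary of \<open>\<Sum>\<^sub>s \<phi>\<^sub>s(m)\<close>.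
\<close>

lemma operator_cochain_map: "cochain_map G M G M' operator"
proof
  show "operator \<in> hom (Z1 G M) (Z1 G M')"
  proof (rule homI)
    fix z assume "z \<in> carrier (Z1 G M)"
    then have z: "z \<in> cocycles G M" by simp
    note zc [simp] = A.cocycle_closed[OF z]
    have "operator z (x \<otimes>\<^bsub>G\<^esub> y) = operator z x \<otimes>\<^bsub>M'\<^esub> gact M' x (operator z y)"
      if x: "x \<in> carrier G" and y: "y \<in> carrier G" for x y
    proof -
      have "operator z (x \<otimes>\<^bsub>G\<^esub> y) = finprod M' (\<lambda>s. \<phi> s (z (\<rho> s (x \<otimes>\<^bsub>G\<^esub> y)))) S"
        using x y by (simp add: operator_def)
      also have "\<dots> = finprod M' (\<lambda>s. \<phi> s (z (\<rho> s x)) \<otimes>\<^bsub>M'\<^esub>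
          gact M' x ((\<lambda>t. \<phi> t (z (\<rho> t y))) (\<sigma> s x))) S"
        using x y by (intro B.M.finprod_cong'[OF refl])
          (auto simp: fact_mult A.cocycle_mult[OF z] weight_mult weight_act)
      also have "\<dots> = finprod M' (\<lambda>s. \<phi> s (z (\<rho> s x))) S \<otimes>\<^bsub>M'\<^esub>
          finprod M' (\<lambda>s. gact M' x ((\<lambda>t. \<phi> t (z (\<rho> t y))) (\<sigma> s x))) S"
        using x y by (intro B.M.finprod_multf) auto
      also have "finprod M' (\<lambda>s. gact M' x ((\<lambda>t. \<phi> t (z (\<rho> t y))) (\<sigma> s x))) S =
          gact M' x (finprod M' (\<lambda>t. \<phi> t (z (\<rho> t y))) S)"
        using x y by (intro finprod_act_perm) auto
      finally show ?thesis using x y by (simp add: operator_def)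
    qed
    then show "operator z \<in> carrier (Z1 G M')"
      using operator_closed[OF z] by (auto simp: cocycles_def operator_def)
  next
    fix z w assume "z \<in> carrier (Z1 G M)" "w \<in> carrier (Z1 G M)"
    then have z: "z \<in> cocycles G M" and w: "w \<in> cocycles G M" by simp_all
    note [simp] = A.cocycle_closed[OF z] A.cocycle_closed[OF w]
    have "finprod M' (\<lambda>s. \<phi> s (z (\<rho> s x) \<otimes>\<^bsub>M\<^esub> w (\<rho> s x))) S =
        finprod M' (\<lambda>s. \<phi> s (z (\<rho> s x))) S \<otimes>\<^bsub>M'\<^esub> finprod M' (\<lambda>s. \<phi> s (w (\<rho> s x))) S"
      if x: "x \<in> carrier G" for x
    proof -
      have "finprod M' (\<lambda>s. \<phi> s (z (\<rho> s x) \<otimes>\<^bsub>M\<^esub> w (\<rho> s x))) S =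
          finprod M' (\<lambda>s. \<phi> s (z (\<rho> s x)) \<otimes>\<^bsub>M'\<^esub> \<phi> s (w (\<rho> s x))) S"
        using x by (intro B.M.finprod_cong') (auto simp: weight_mult)
      then show ?thesis using x by (subst (asm) B.M.finprod_multf) auto
    qed
    moreover have "finprod M' (\<lambda>s. \<phi> s ((z \<otimes>\<^bsub>Z1 G M\<^esub> w) (\<rho> s x))) S =
        finprod M' (\<lambda>s. \<phi> s (z (\<rho> s x) \<otimes>\<^bsub>M\<^esub> w (\<rho> s x))) S" if x: "x \<in> carrier G" for x
      using x by (intro B.M.finprod_cong') (auto simp: Z1_def)
    ultimately show "operator (z \<otimes>\<^bsub>Z1 G M\<^esub> w) = operator z \<otimes>\<^bsub>Z1 G M'\<^esub> operator w"
      unfolding operator_def by (auto simp: Z1_def[of G M'] intro!: restrict_ext)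
  qed
next
  fix b assume "b \<in> coboundaries G M"
  then obtain m where m: "m \<in> carrier M" "b = (\<lambda>x\<in>carrier G. gact M x m \<otimes>\<^bsub>M\<^esub> inv\<^bsub>M\<^esub> m)"
    by (auto simp: coboundaries_def)
  define n where "n = finprod M' (\<lambda>s. \<phi> s m) S"
  have n: "n \<in> carrier M'" using m by (auto simp: n_def intro!: B.M.finprod_closed)
  have "operator b x = gact M' x n \<otimes>\<^bsub>M'\<^esub> inv\<^bsub>M'\<^esub> n" if x: "x \<in> carrier G" for x
  proof -
    have eq: "\<phi> s (b (\<rho> s x)) \<otimes>\<^bsub>M'\<^esub> \<phi> s m = gact M' x (\<phi> (\<sigma> s x) m)" if "s \<in> S" for s
      using that m x by (simp add: weight_mult weight_inv weight_act B.M.m_assoc)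
    have b: "\<phi> s (b (\<rho> s x)) \<in> carrier M'" if "s \<in> S" for s
      using that m x by simp
    have "operator b x \<otimes>\<^bsub>M'\<^esub> n = finprod M' (\<lambda>s. \<phi> s (b (\<rho> s x)) \<otimes>\<^bsub>M'\<^esub> \<phi> s m) S"
      unfolding n_def operator_def using x m b by (subst B.M.finprod_multf) auto
    also have "\<dots> = finprod M' (\<lambda>s. gact M' x (\<phi> (\<sigma> s x) m)) S"
      by (rule B.M.finprod_cong'[OF refl]) (use m x in force, erule eq)
    also have "\<dots> = gact M' x n"
      unfolding n_def using m x by (intro finprod_act_perm[of x "\<lambda>s. \<phi> s m"]) auto
    finally have "operator b x \<otimes>\<^bsub>M'\<^esub> n = gact M' x n" .
    moreover have "operator b x \<in> carrier M'"
      using b x by (auto simp: operator_def intro!: B.M.finprod_closed)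
    ultimately show ?thesis using n x by (metis B.M.inv_solve_right B.act_closed)
  qed
  then show "operator b \<in> coboundaries G M'"
    unfolding coboundaries_def
    by (intro image_eqI[of _ _ n]) (auto simp: n operator_def intro!: extensionalityI[of _ "carrier G"])
qed

end

text \<open>
  If the first operator belongs to the matrices \<open>\<delta>\<^sub>s\<close> and the second one to \<open>\<delta>'\<^sub>t\<close>, then the composite
  belongs to the products \<open>\<delta>\<^sub>s \<delta>'\<^sub>t\<close>.
\<close>

lemma hecke_datum_comp:
  assumes "hecke_datum G M M' S \<sigma> \<rho> \<phi>" and "hecke_datum G M' M'' S' \<sigma>' \<rho>' \<phi>'"
  shows "hecke_datum G M M'' (S' \<times> S) (\<lambda>(s', s) x. (\<sigma>' s' x, \<sigma> s (\<rho>' s' x)))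
    (\<lambda>(s', s) x. \<rho> s (\<rho>' s' x)) (\<lambda>(s', s). \<phi>' s' \<circ> \<phi> s)"
proof -
  interpret a: hecke_datum G M M' S \<sigma> \<rho> \<phi> by fact
  interpret b: hecke_datum G M' M'' S' \<sigma>' \<rho>' \<phi>' by fact
  have one: "\<rho>' s' \<one>\<^bsub>G\<^esub> = \<one>\<^bsub>G\<^esub>" if "s' \<in> S'" for s'
    using b.fact_mult[OF that, of "\<one>\<^bsub>G\<^esub>" "\<one>\<^bsub>G\<^esub>"] that by (simp add: b.perm_one)
  show ?thesis
    by unfold_locales
      (auto simp: a.perm_mult b.perm_mult a.perm_one b.perm_one a.fact_mult b.fact_mult one
        a.weight_act b.weight_act intro!: homI simp: a.weight_mult b.weight_mult)
qed

lemma operator_comp: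
  assumes "hecke_datum G M M' S \<sigma> \<rho> \<phi>" and "hecke_datum G M' M'' S' \<sigma>' \<rho>' \<phi>'"
    and z: "z \<in> cocycles G M"
  shows "hecke_datum.operator G M'' S' \<rho>' \<phi>' (hecke_datum.operator G M' S \<rho> \<phi> z) =
    hecke_datum.operator G M'' (S' \<times> S) (\<lambda>(s', s) x. \<rho> s (\<rho>' s' x)) (\<lambda>(s', s). \<phi>' s' \<circ> \<phi> s) z"
proof -
  interpret a: hecke_datum G M M' S \<sigma> \<rho> \<phi> by fact
  interpret b: hecke_datum G M' M'' S' \<sigma>' \<rho>' \<phi>' by fact
  interpret c: hecke_datum G M M'' "S' \<times> S" "\<lambda>(s', s) x. (\<sigma>' s' x, \<sigma> s (\<rho>' s' x))"
    "\<lambda>(s', s) x. \<rho> s (\<rho>' s' x)" "\<lambda>(s', s). \<phi>' s' \<circ> \<phi> s"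
    by (rule hecke_datum_comp[OF assms(1,2)])
  note [simp] = a.A.cocycle_closed[OF z]
  show ?thesis
    unfolding b.operator_def c.operator_def
  proof (rule restrict_ext)
    fix x assume x: "x \<in> carrier G"
    have "finprod M'' (\<lambda>s'. \<phi>' s' (a.operator z (\<rho>' s' x))) S' =
        finprod M'' (\<lambda>s'. finprod M'' (\<lambda>s. \<phi>' s' (\<phi> s (z (\<rho> s (\<rho>' s' x))))) S) S'"
    proof (rule b.B.M.finprod_cong')
      fix s' assume s': "s' \<in> S'"
      show "\<phi>' s' (a.operator z (\<rho>' s' x)) = finprod M'' (\<lambda>s. \<phi>' s' (\<phi> s (z (\<rho> s (\<rho>' s' x))))) S"
        using s' x unfolding a.operator_def
        by (simp, intro finprod_hom[OF a.B.M.comm_group_axioms b.B.M.comm_group_axioms b.weight_hom]) auto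
    qed (use x in \<open>auto intro!: b.B.M.finprod_closed\<close>)
    also have "\<dots> = finprod M'' (\<lambda>p. (case p of (s', s) \<Rightarrow> \<phi>' s' \<circ> \<phi> s)
        (z ((case p of (s', s) \<Rightarrow> \<lambda>x. \<rho> s (\<rho>' s' x)) x))) (S' \<times> S)"
      using x by (subst b.B.M.finprod_cartesian_product) auto
    finally show "finprod M'' (\<lambda>s'. \<phi>' s' (a.operator z (\<rho>' s' x))) S' = \<dots>" .
  qed
qed

text \<open>
  In terms of matrices the hypotheses say that \<open>\<delta>\<^sub>s = y\<^sub>s \<delta>'\<^sub>t\<close> with \<open>t = f(s)\<close>.  Expanding the
  cocycle at both sides of \<open>\<rho>(s, x) y\<^sub>u = y\<^sub>s \<rho>'(t, x)\<close>, where \<open>u = \<sigma>(s, x)\<close>, then applying \<open>\<phi>\<^sub>s\<close> and summing, one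
  finds that the two operators differ by the coboundary of \<open>\<Sum>\<^sub>s \<phi>\<^sub>s(z(y\<^sub>s))\<close>, up to sign.
\<close>

lemma equivalent_hecke_data:
  assumes "hecke_datum G M M' S \<sigma> \<rho> \<phi>" and "hecke_datum G M M' S' \<sigma>' \<rho>' \<phi>'"
    and f: "bij_betw f S S'" and y: "\<And>s. s \<in> S \<Longrightarrow> y s \<in> carrier G"
    and fact: "\<And>s x. \<lbrakk>s \<in> S; x \<in> carrier G\<rbrakk> \<Longrightarrow> \<rho> s x \<otimes>\<^bsub>G\<^esub> y (\<sigma> s x) = y s \<otimes>\<^bsub>G\<^esub> \<rho>' (f s) x"
    and weight: "\<And>s m. \<lbrakk>s \<in> S; m \<in> carrier M\<rbrakk> \<Longrightarrow> \<phi> s (gact M (y s) m) = \<phi>' (f s) m"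
    and z: "z \<in> cocycles G M"
  shows "H1_class G M' (hecke_datum.operator G M' S \<rho> \<phi> z) =
    H1_class G M' (hecke_datum.operator G M' S' \<rho>' \<phi>' z)"
proof -
  interpret a: hecke_datum G M M' S \<sigma> \<rho> \<phi> by fact
  interpret b: hecke_datum G M M' S' \<sigma>' \<rho>' \<phi>' by fact
  note [simp] = a.A.cocycle_closed[OF z] y
  have f_in: "f s \<in> S'" if "s \<in> S" for s using that f by (auto simp: bij_betw_def)
  \<comment> \<open>the coboundary of \<open>n\<^sup>-\<^sup>1\<close> accounts for the difference\<close>
  define n where "n = finprod M' (\<lambda>s. \<phi> s (z (y s))) S"
  have n: "n \<in> carrier M'" by (auto simp: n_def intro!: a.B.M.finprod_closed)
  have eq: "a.operator z x \<otimes>\<^bsub>M'\<^esub> gact M' x n = n \<otimes>\<^bsub>M'\<^esub> b.operator z x" if x: "x \<in> carrier G" for x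
  proof -
    have "\<phi> s (z (\<rho> s x)) \<otimes>\<^bsub>M'\<^esub> gact M' x ((\<lambda>t. \<phi> t (z (y t))) (\<sigma> s x)) =
        \<phi> s (z (y s)) \<otimes>\<^bsub>M'\<^esub> \<phi>' (f s) (z (\<rho>' (f s) x))" if s: "s \<in> S" for s
    proof -
      have "z (\<rho> s x) \<otimes>\<^bsub>M\<^esub> gact M (\<rho> s x) (z (y (\<sigma> s x))) =
          z (y s) \<otimes>\<^bsub>M\<^esub> gact M (y s) (z (\<rho>' (f s) x))"
        using s x fact[OF s x] f_in[OF s] by (simp flip: a.A.cocycle_mult[OF z])
      then have "\<phi> s (z (\<rho> s x) \<otimes>\<^bsub>M\<^esub> gact M (\<rho> s x) (z (y (\<sigma> s x)))) =
          \<phi> s (z (y s) \<otimes>\<^bsub>M\<^esub> gact M (y s) (z (\<rho>' (f s) x)))" by simp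
      then show ?thesis
        using s x f_in[OF s] by (simp add: a.weight_mult a.weight_act weight)
    qed
    then have "finprod M' (\<lambda>s. \<phi> s (z (\<rho> s x)) \<otimes>\<^bsub>M'\<^esub> gact M' x ((\<lambda>t. \<phi> t (z (y t))) (\<sigma> s x))) S =
        finprod M' (\<lambda>s. \<phi> s (z (y s)) \<otimes>\<^bsub>M'\<^esub> \<phi>' (f s) (z (\<rho>' (f s) x))) S"
      using x f_in by (intro a.B.M.finprod_cong') auto
    moreover have "finprod M' (\<lambda>s. \<phi> s (z (\<rho> s x)) \<otimes>\<^bsub>M'\<^esub> gact M' x ((\<lambda>t. \<phi> t (z (y t))) (\<sigma> s x))) S =
        a.operator z x \<otimes>\<^bsub>M'\<^esub> gact M' x n"
      using x by (subst a.B.M.finprod_multf, force, force, subst a.finprod_act_perm)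
        (auto simp: a.operator_def n_def)
    moreover have "finprod M' (\<lambda>s. \<phi> s (z (y s)) \<otimes>\<^bsub>M'\<^esub> \<phi>' (f s) (z (\<rho>' (f s) x))) S =
        n \<otimes>\<^bsub>M'\<^esub> finprod M' (\<lambda>s. \<phi>' (f s) (z (\<rho>' (f s) x))) S"
      using x f_in by (subst a.B.M.finprod_multf) (auto simp: n_def)
    moreover have "finprod M' (\<lambda>s. \<phi>' (f s) (z (\<rho>' (f s) x))) S = b.operator z x"
      using x f a.B.M.finprod_reindex[of "\<lambda>s. \<phi>' s (z (\<rho>' s x))" f S]
      by (auto simp: b.operator_def bij_betw_def)
    ultimately show ?thesis by simp
  qed
  have "a.operator z x = gact M' x (inv\<^bsub>M'\<^esub> n) \<otimes>\<^bsub>M'\<^esub> inv\<^bsub>M'\<^esub> (inv\<^bsub>M'\<^esub> n) \<otimes>\<^bsub>M'\<^esub> b.operator z x"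
    if x: "x \<in> carrier G" for x
  proof -
    have c: "a.operator z x \<in> carrier M'" "b.operator z x \<in> carrier M'"
      using a.operator_closed[OF z x] b.operator_closed[OF z x] .
    have "a.operator z x = a.operator z x \<otimes>\<^bsub>M'\<^esub> gact M' x n \<otimes>\<^bsub>M'\<^esub> inv\<^bsub>M'\<^esub> (gact M' x n)"
      using c n x by (simp add: a.B.M.m_assoc)
    then show ?thesis
      using c n x by (simp add: eq[OF x] a.B.act_inv a.B.M.m_ac)
  qed
  then show ?thesis
    unfolding a.B.H1_class_eq_iff[OF cochain_map.map_cocycle[OF a.operator_cochain_map z]
        cochain_map.map_cocycle[OF b.operator_cochain_map z]]
    using n by (intro bexI[of _ "inv\<^bsub>M'\<^esub> n"]) auto
qed

section \<open>The action of matrices on polynomials in two variables\<close>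

lemma poly_map_poly_add:
  assumes "h 0 = 0" "\<And>a b. h (a + b) = h a + h b"
  shows "poly (map_poly h (p + q)) u = poly (map_poly h p) u + poly (map_poly h q) u"
  by (induction p q rule: poly_induct2) (simp_all add: map_poly_pCons assms algebra_simps)

lemma poly_map_poly_mult:
  fixes h :: "'a::comm_ring_1 \<Rightarrow> 'b::comm_ring_1"
  assumes "h 0 = 0" "\<And>a b. h (a + b) = h a + h b" "\<And>a b. h (a * b) = h a * h b"
  shows "poly (map_poly h (p * q)) u = poly (map_poly h p) u * poly (map_poly h q) u"
proof -
  have smult: "poly (map_poly h (smult a q)) u = h a * poly (map_poly h q) u" for a
    by (induction q) (simp_all add: map_poly_pCons assms algebra_simps)
  show ?thesis
    by (induction p)
      (simp_all add: map_poly_pCons assms smult poly_map_poly_add mult_pCons_left algebra_simps)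
qed

lemma bconst_0 [simp]: "bconst 0 = 0"
  and bconst_1 [simp]: "bconst 1 = 1"
  and bconst_add: "bconst (a + b) = bconst a + bconst b"
  and bconst_mult: "bconst (a * b) = bconst a * bconst b"
  and bconst_uminus: "bconst (- a) = - bconst a"
  and bconst_diff: "bconst (a - b) = bconst a - bconst b"
  by (simp_all add: bconst_def one_pCons)

lemma bconst_power: "bconst (a ^ n) = bconst a ^ n"
  by (induction n) (simp_all add: bconst_mult)

lemma bconst_sum: "bconst (sum f A) = (\<Sum>x\<in>A. bconst (f x))"
  by (induction A rule: infinite_finite_induct) (simp_all add: bconst_add)

lemma bconst_of_nat: "bconst (of_nat n) = of_nat n"
  by (induction n) (simp_all add: bconst_add)

lemma bsubst_bconst [simp]: "bsubst (bconst c) u v = bconst c"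
  by (simp add: bsubst_def bconst_def map_poly_pCons)

lemma bsubst_bX [simp]: "bsubst bX u v = u"
  by (simp add: bsubst_def bX_def map_poly_pCons flip: bconst_0 bconst_1)
    (simp add: bconst_def map_poly_pCons flip: one_pCons)

lemma bsubst_bY [simp]: "bsubst bY u v = v"
proof -
  have "poly (map_poly bconst (1::'a poly)) u = 1"
    by (simp add: one_pCons map_poly_pCons bconst_def del: bconst_1)
  then show ?thesis by (simp add: bsubst_def bY_def map_poly_pCons)
qed

lemma bsubst_add: "bsubst (P + Q) u v = bsubst P u v + bsubst Q u v"
  unfolding bsubst_def by (intro poly_map_poly_add) (simp_all add: bconst_add)

lemma bsubst_mult: "bsubst (P * Q) u v = bsubst P u v * bsubst Q u v"
  unfolding bsubst_def
  by (intro poly_map_poly_mult) (simp_all add: bconst_add bconst_mult poly_map_poly_add poly_map_poly_mult)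

text \<open>
  Two ring homomorphisms on \<open>F[X, Y]\<close> agree if they agree on constants, on \<open>X\<close> and on \<open>Y\<close>.
\<close>

lemma bpoly_induct [case_names const add X Y]:
  fixes P :: "'F::field bpoly"
  assumes const: "\<And>c. Q (bconst c)" and add: "\<And>P P'. \<lbrakk>Q P; Q P'\<rbrakk> \<Longrightarrow> Q (P + P')"
    and X: "\<And>P. Q P \<Longrightarrow> Q (bX * P)" and Y: "\<And>P. Q P \<Longrightarrow> Q (bY * P)"
  shows "Q P"
proof (induction P)
  case 0
  then show ?case using const[of 0] by simp
next
  case (pCons q P)
  have "Q [:q:]"
  proof (induction q)
    case 0
    then show ?case using const[of 0] by simp
  next
    case (pCons c q)
    have "[:pCons c q:] = bconst c + bX * [:q:]"
      by (simp add: bconst_def bX_def)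
    moreover have "Q (bconst c + bX * [:q:])" by (intro const add X pCons.IH)
    ultimately show ?case by (simp only:)
  qed
  moreover have "pCons q P = [:q:] + bY * P"
    by (simp add: bY_def)
  ultimately show ?case using add Y pCons by (simp only:)
qed

lemma mat_bact_add: "mat_bact A (P + Q) = mat_bact A P + mat_bact A Q"
  and mat_bact_mult: "mat_bact A (P * Q) = mat_bact A P * mat_bact A Q"
  and mat_bact_bconst [simp]: "mat_bact A (bconst c) = bconst c"
  and mat_bact_bX: "mat_bact A bX = bconst (of_int (A$1$1)) * bX + bconst (of_int (A$2$1)) * bY"
  and mat_bact_bY: "mat_bact A bY = bconst (of_int (A$1$2)) * bX + bconst (of_int (A$2$2)) * bY"
  by (simp_all add: mat_bact_def bsubst_add bsubst_mult)

lemma mat_bact_0 [simp]: "mat_bact A 0 = 0"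
  and mat_bact_1 [simp]: "mat_bact A 1 = 1"
  using mat_bact_bconst[of A 0] mat_bact_bconst[of A 1] by simp_all

lemma mat_bact_power: "mat_bact A (P ^ n) = mat_bact A P ^ n"
  by (induction n) (simp_all add: mat_bact_mult)

lemma mat_bact_uminus: "mat_bact A (- P) = - mat_bact A P"
  using mat_bact_add[of A P "- P"] by (simp add: eq_neg_iff_add_eq_0 add.commute)

lemma mat_bact_diff: "mat_bact M (P - Q) = mat_bact M P - mat_bact M Q"
  using mat_bact_add[of M P "- Q"] by (simp add: mat_bact_uminus)

lemma mat_bact_sum: "mat_bact A (sum f S) = (\<Sum>s\<in>S. mat_bact A (f s))"
  by (induction S rule: infinite_finite_induct) (simp_all add: mat_bact_add)

lemma mat_bact_matmul: "mat_bact (A ** B) P = mat_bact A (mat_bact B P)"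
  by (induction P rule: bpoly_induct)
    (simp_all add: mat_bact_add mat_bact_mult mat_bact_bX mat_bact_bY matrix_matrix_mult_def
      sum_2 bconst_add bconst_mult algebra_simps)

lemma mat_bact_mat1 [simp]: "mat_bact (mat 1) P = P"
  by (induction P rule: bpoly_induct)
    (simp_all add: mat_bact_add mat_bact_mult mat_bact_bX mat_bact_bY mat_def)

section \<open>Binary forms of a given degree\<close>

definition form :: "nat \<Rightarrow> 'F::field bpoly \<Rightarrow> bool" where
  "form k P \<longleftrightarrow> (\<forall>i j. coeff (coeff P j) i \<noteq> 0 \<longrightarrow> i + j = k)"

lemma carrier_Vk [simp]: "P \<in> carrier (Vk k) \<longleftrightarrow> form k P"
  by (simp add: Vk_def form_def)

lemma Vk_mult [simp]: "P \<otimes>\<^bsub>Vk k\<^esub> Q = P + Q"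
  and Vk_one [simp]: "\<one>\<^bsub>Vk k\<^esub> = 0"
  and Vk_scal [simp]: "scal (Vk k) c P = bconst c * P"
  and Vk_act [simp]: "gact (Vk k) A P = mat_bact A P"
  by (simp_all add: Vk_def)

lemma form_0 [simp]: "form k 0"
  by (simp add: form_def)

lemma form_add: "\<lbrakk>form k P; form k Q\<rbrakk> \<Longrightarrow> form k (P + Q)"
  unfolding form_def by (metis add.left_neutral coeff_add)

lemma form_uminus: "form k P \<Longrightarrow> form k (- P)"
  by (simp add: form_def)

lemma form_sum: "(\<And>s. s \<in> S \<Longrightarrow> form k (f s)) \<Longrightarrow> form k (sum f S)"
  by (induction S rule: infinite_finite_induct) (auto intro: form_add)

lemma form_mult:
  assumes "form k P" "form l Q"
  shows "form (k + l) (P * Q)"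
  unfolding form_def
proof (intro allI impI)
  fix i j assume "coeff (coeff (P * Q) j) i \<noteq> 0"
  then have "(\<Sum>b\<le>j. \<Sum>a\<le>i. coeff (coeff P b) a * coeff (coeff Q (j - b)) (i - a)) \<noteq> 0"
    by (simp add: coeff_mult coeff_sum)
  then obtain b where b: "b \<le> j"
    and "(\<Sum>a\<le>i. coeff (coeff P b) a * coeff (coeff Q (j - b)) (i - a)) \<noteq> 0"
    by (metis (no_types, lifting) atMost_iff sum.neutral)
  then obtain a where a: "a \<le> i" and "coeff (coeff P b) a * coeff (coeff Q (j - b)) (i - a) \<noteq> 0"
    by (metis (no_types, lifting) atMost_iff sum.neutral)
  then have "coeff (coeff P b) a \<noteq> 0" "coeff (coeff Q (j - b)) (i - a) \<noteq> 0" by auto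
  then have "a + b = k" "(i - a) + (j - b) = l"
    using assms by (auto simp: form_def)
  then show "i + j = k + l" using a b by simp
qed

lemma form_bconst: "form 0 (bconst c)"
  by (auto simp: form_def bconst_def coeff_pCons split: nat.splits)

lemma form_bconst_mult: "form k P \<Longrightarrow> form k (bconst c * P)"
  using form_mult[OF form_bconst, of k P c] by simp

lemma form_bX: "form 1 bX" and form_bY: "form 1 bY"
  by (auto simp: form_def bX_def bY_def coeff_pCons one_pCons split: nat.splits)

lemma form_power: "form k P \<Longrightarrow> form (n * k) (P ^ n)"
proof (induction n)
  case 0
  then show ?case using form_bconst[of 1] by simp
next
  case (Suc n)
  then show ?case using form_mult[of k P "n * k" "P ^ n"] by simp
qed

lemma form_linear: "form 1 (bconst a * bX + bconst b * bY)"
  by (intro form_add form_bconst_mult form_bX form_bY)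

lemma form_linear_power: "form n ((bconst a * bX + bconst b * bY) ^ n)"
  using form_power[OF form_linear[of a b], of n] by simp

lemma form_bX_power: "form n (bX ^ n)"
  using form_power[OF form_bX, of n] by simp

text \<open>
  A monomial of degree \<open>k\<close> is sent to a product of \<open>k\<close> linear forms.
\<close>

lemma form_mat_bact:
  assumes P: "form k P"
  shows "form k (mat_bact A P)"
proof -
  let ?u = "bconst (of_int (A$1$1)) * bX + bconst (of_int (A$2$1)) * bY :: 'a bpoly"
  let ?v = "bconst (of_int (A$1$2)) * bX + bconst (of_int (A$2$2)) * bY :: 'a bpoly"
  have monomial: "form k (bconst (coeff (coeff P j) i) * ?u ^ i * ?v ^ j)" for i j
  proof (cases "coeff (coeff P j) i = 0")
    case False
    then have k: "k = i + j" using P by (simp add: form_def)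
    show ?thesis
      unfolding k mult.assoc by (intro form_bconst_mult form_mult form_linear_power)
  qed simp
  have "mat_bact A P = (\<Sum>j\<le>degree (map_poly (\<lambda>q. poly (map_poly bconst q) ?u) P).
      (\<Sum>i\<le>degree (map_poly bconst (coeff P j)). bconst (coeff (coeff P j) i) * ?u ^ i) * ?v ^ j)"
    unfolding mat_bact_def bsubst_def poly_altdef[of "map_poly (\<lambda>q. poly (map_poly bconst q) ?u) P"]
    by (simp add: coeff_map_poly poly_altdef)
  then show ?thesis
    using monomial by (auto simp: sum_distrib_right intro!: form_sum)
qed

lemma form_0_eq_bconst: "form 0 P \<Longrightarrow> \<exists>c. P = bconst c"
proof
  assume P: "form 0 P"
  show "P = bconst (coeff (coeff P 0) 0)"
  proof (intro poly_eqI)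
    fix i j
    show "coeff (coeff P j) i = coeff (coeff (bconst (coeff (coeff P 0) 0)) j) i"
      using P unfolding form_def by (cases i; cases j) (auto simp: bconst_def coeff_pCons)
  qed
qed

lemma mat_bact_form_0: "form 0 P \<Longrightarrow> mat_bact A P = P"
  by (auto dest: form_0_eq_bconst)

lemma comm_group_Vk: "comm_group (Vk k)"
proof (rule comm_groupI)
  fix P :: "'a bpoly" assume "P \<in> carrier (Vk k)"
  then show "\<exists>Q\<in>carrier (Vk k). Q \<otimes>\<^bsub>Vk k\<^esub> P = \<one>\<^bsub>Vk k\<^esub>"
    by (intro bexI[of _ "- P"]) (simp_all add: form_uminus)
qed (simp_all add: form_add algebra_simps)

lemma Vk_inv: "form k P \<Longrightarrow> inv\<^bsub>Vk k\<^esub> P = - P"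
  by (rule group.inv_equality[OF comm_group.axioms(2)[OF comm_group_Vk]]) (simp_all add: form_uminus)

lemma Vk_finprod: "(\<And>s. s \<in> S \<Longrightarrow> form k (f s)) \<Longrightarrow> finprod (Vk k) f S = sum f S"
proof (induction S rule: infinite_finite_induct)
  case (insert s S)
  interpret comm_group "Vk k" by (rule comm_group_Vk)
  show ?case using insert by (subst finprod_insert) auto
next
  case (infinite S)
  interpret comm_group "Vk k" by (rule comm_group_Vk)
  show ?case using infinite by simp
next
  case empty
  interpret comm_group "Vk k" by (rule comm_group_Vk)
  show ?case by simp
qed

section \<open>Integral two by two matrices\<close>

lemma mat2_nth [simp]:
  "mat2 a b c d $ 1 $ 1 = a" "mat2 a b c d $ 1 $ 2 = b"
  "mat2 a b c d $ 2 $ 1 = c" "mat2 a b c d $ 2 $ 2 = d"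
  by (simp_all add: mat2_def)

lemma matmul_nth: "((A::imat) ** B) $ i $ j = A$i$1 * B$1$j + A$i$2 * B$2$j"
  by (simp add: matrix_matrix_mult_def sum_2)

lemma dvd_matmul_right:
  fixes C M :: imat
  shows "(\<And>i j. q dvd M $ i $ j) \<Longrightarrow> q dvd (C ** M) $ i $ j"
  by (simp add: matmul_nth)

lemma imat_eq_iff: "(A::imat) = B \<longleftrightarrow>
    A$1$1 = B$1$1 \<and> A$1$2 = B$1$2 \<and> A$2$1 = B$2$1 \<and> A$2$2 = B$2$2"
  by (simp add: vec_eq_iff forall_2)

lemma imat_1_nth [simp]:
  "(mat 1 :: imat) $ 1 $ 1 = 1" "(mat 1 :: imat) $ 1 $ 2 = 0"
  "(mat 1 :: imat) $ 2 $ 1 = 0" "(mat 1 :: imat) $ 2 $ 2 = 1"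
  by (simp_all add: mat_def)

lemma adj2_nth [simp]:
  "adj2 A $ 1 $ 1 = A$2$2" "adj2 A $ 1 $ 2 = - (A$1$2)"
  "adj2 A $ 2 $ 1 = - (A$2$1)" "adj2 A $ 2 $ 2 = A$1$1"
  by (simp_all add: adj2_def)

lemma adj2_matmul: "adj2 (A ** B) = adj2 B ** adj2 A"
  by (simp add: imat_eq_iff matmul_nth)

lemma adj2_adj2 [simp]: "adj2 (adj2 A) = A"
  by (simp add: imat_eq_iff)

lemma adj2_mat_1 [simp]: "adj2 (mat 1) = mat 1"
  by (simp add: imat_eq_iff)

lemma det_adj2 [simp]: "det (adj2 A) = det A"
  by (simp add: det_2)

lemma adj2_inverse:
  assumes "det A = 1"
  shows "A ** adj2 A = mat 1" "adj2 A ** A = mat 1"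
  using assms by (simp_all add: imat_eq_iff matmul_nth det_2 algebra_simps)

lemma adj2_scalar:
  fixes A C :: imat
  shows "(A ** (C ** adj2 C)) $ i $ j = det C * A $ i $ j"
  "(A ** (adj2 C ** C)) $ i $ j = det C * A $ i $ j"
proof -
  have "\<forall>i j. (A ** (C ** adj2 C)) $ i $ j = det C * A $ i $ j"
    "\<forall>i j. (A ** (adj2 C ** C)) $ i $ j = det C * A $ i $ j"
    by (simp_all add: forall_2 matmul_nth det_2 algebra_simps)
  then show "(A ** (C ** adj2 C)) $ i $ j = det C * A $ i $ j"
    "(A ** (adj2 C ** C)) $ i $ j = det C * A $ i $ j" by blast+
qed

lemma adj2_scalar_left:
  fixes C M :: imat
  shows "(adj2 C ** (C ** M)) $ i $ j = det C * M $ i $ j"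
proof -
  have "\<forall>i j. (adj2 C ** (C ** M)) $ i $ j = det C * M $ i $ j"
    by (simp add: forall_2 matmul_nth det_2 algebra_simps)
  then show ?thesis by blast
qed

lemma imat_right_cancel:
  assumes "(A::imat) ** C = B ** C" "det C \<noteq> 0"
  shows "A = B"
proof -
  have "(A ** (C ** adj2 C)) = B ** (C ** adj2 C)"
    using assms(1) by (metis matrix_mul_assoc)
  then have "det C * A $ i $ j = det C * B $ i $ j" for i j
    by (metis adj2_scalar(1))
  then show ?thesis
    using assms(2) by (simp add: vec_eq_iff)
qed

section \<open>Congruence subgroups and Hecke sets\<close>

lemma Hecke_set_mult:
  assumes "A \<in> Hecke_set N r" "B \<in> Hecke_set N s"
  shows "A ** B \<in> Hecke_set N (r * s)"
proof -
  have "[A$1$1 * B$1$1 + A$1$2 * B$2$1 = 1 * 1 + A$1$2 * 0] (mod N)"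
    "[A$2$1 * B$1$1 + A$2$2 * B$2$1 = 0 * 1 + A$2$2 * 0] (mod N)"
    by (intro cong_add cong_mult cong_refl; use assms in \<open>simp add: Hecke_set_def\<close>)+
  then show ?thesis
    using assms by (simp add: Hecke_set_def matmul_nth det_mul)
qed

text \<open>
  The first column of \<open>B\<close> is \<open>(1, 0)\<close> modulo \<open>N\<close>, so that the first columns of \<open>E\<close> and \<open>E B\<close>
  agree modulo \<open>N\<close>.
\<close>

lemma Hecke_set_left_factor:
  assumes "E ** B = A" "A \<in> Hecke_set N (r * s)" "B \<in> Hecke_set N s" "s > 0"
  shows "E \<in> Hecke_set N r"
proof -
  have "det E * int s = int r * int s"
    using assms by (auto simp: Hecke_set_def det_mul)
  then have "det E = int r" using assms(4) by simp
  have "[E$1$1 * B$1$1 + E$1$2 * B$2$1 = E$1$1 * 1 + E$1$2 * 0] (mod N)"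
    "[E$2$1 * B$1$1 + E$2$2 * B$2$1 = E$2$1 * 1 + E$2$2 * 0] (mod N)"
    by (intro cong_add cong_mult cong_refl; use assms in \<open>simp add: Hecke_set_def\<close>)+
  then have "[A$1$1 = E$1$1] (mod N)" "[A$2$1 = E$2$1] (mod N)"
    by (simp_all add: matmul_nth flip: assms(1))
  then have "[E$1$1 = 1] (mod N)" "[E$2$1 = 0] (mod N)"
    using assms(2) unfolding Hecke_set_def by (blast intro: cong_trans cong_sym)+
  then show ?thesis using \<open>det E = int r\<close> by (simp add: Hecke_set_def)
qed

text \<open>
  In determinant one the congruence for the lower right entry follows from the other two, so
  that facts about products in the Hecke sets also serve for the group.
\<close>

lemma carrier_Gamma1: "carrier (Gamma1 N) = Hecke_set N 1"
proof -
  have "[A$2$2 = 1] (mod N)" if "det A = 1" "[A$1$1 = 1] (mod N)" "[A$2$1 = 0] (mod N)" for A :: imat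
  proof -
    have "[A$1$1 * A$2$2 - A$1$2 * A$2$1 = 1 * A$2$2 - A$1$2 * 0] (mod N)"
      using that by (intro cong_diff cong_mult cong_refl)
    then show ?thesis using that(1) by (simp add: det_2 cong_sym)
  qed
  then show ?thesis by (auto simp: Gamma1_def Hecke_set_def)
qed

lemma Gamma1_iff: "A \<in> carrier (Gamma1 N) \<longleftrightarrow>
    det A = 1 \<and> [A$1$1 = 1] (mod N) \<and> [A$2$2 = 1] (mod N) \<and> [A$2$1 = 0] (mod N)"
  by (simp add: Gamma1_def)

lemma Gamma1_mult [simp]: "A \<otimes>\<^bsub>Gamma1 N\<^esub> B = A ** B"
  and Gamma1_one [simp]: "\<one>\<^bsub>Gamma1 N\<^esub> = mat 1"
  by (simp_all add: Gamma1_def)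

lemma Gamma1_det: "A \<in> carrier (Gamma1 N) \<Longrightarrow> det A = 1"
  by (simp add: Gamma1_def)

lemma Gamma1_closed: "\<lbrakk>A \<in> carrier (Gamma1 N); B \<in> carrier (Gamma1 N)\<rbrakk> \<Longrightarrow> A ** B \<in> carrier (Gamma1 N)"
  using Hecke_set_mult[of A N 1 B 1] by (simp add: carrier_Gamma1)

lemma mat_1_Gamma1 [simp]: "mat 1 \<in> carrier (Gamma1 N)"
  by (simp add: Gamma1_iff)

lemma adj2_Gamma1: "A \<in> carrier (Gamma1 N) \<Longrightarrow> adj2 A \<in> carrier (Gamma1 N)"
  using cong_minus_minus_iff[of "A$2$1" 0 N] by (auto simp: Gamma1_iff)

lemma group_Gamma1: "group (Gamma1 N)"
proof (rule groupI)
  fix A assume A: "A \<in> carrier (Gamma1 N)"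
  show "\<exists>B\<in>carrier (Gamma1 N). B \<otimes>\<^bsub>Gamma1 N\<^esub> A = \<one>\<^bsub>Gamma1 N\<^esub>"
    using adj2_Gamma1[OF A] adj2_inverse[OF Gamma1_det[OF A]] by auto
qed (simp_all add: Gamma1_closed matrix_mul_assoc)

lemma Gamma1_inv: "A \<in> carrier (Gamma1 N) \<Longrightarrow> inv\<^bsub>Gamma1 N\<^esub> A = adj2 A"
  by (rule group.inv_equality[OF group_Gamma1])
    (simp_all add: adj2_inverse Gamma1_det adj2_Gamma1)

lemma Gamma10_iff: "A \<in> Gamma10 N p \<longleftrightarrow> A \<in> carrier (Gamma1 N) \<and> int p dvd A$2$1"
  by (simp add: Gamma10_def cong_0_iff)

lemma subgroup_Gamma10: "subgroup (Gamma10 N p) (Gamma1 N)"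
proof (rule group.subgroupI[OF group_Gamma1])
  show "Gamma10 N p \<noteq> {}"
    using Gamma10_iff[of "mat 1" N p] by auto
qed (auto simp: Gamma10_iff Gamma1_inv adj2_Gamma1 Gamma1_closed matmul_nth)

lemma group_module_Vk: "group_module (Gamma1 N) (Vk k)"
proof -
  interpret group "Gamma1 N" by (rule group_Gamma1)
  interpret V: comm_group "Vk k" by (rule comm_group_Vk)
  show ?thesis
    by unfold_locales (simp_all add: form_mat_bact mat_bact_add mat_bact_matmul)
qed

text \<open>
  The matrix \<open>E\<close> is \<open>A B\<^sup>-\<^sup>1\<close>, because the adjugate of \<open>B\<close> is \<open>r B\<^sup>-\<^sup>1\<close>.
\<close>

lemma Hecke_set_left_quotient:
  assumes A: "A \<in> Hecke_set N r" and B: "B \<in> Hecke_set N r" and r: "r > 0"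
    and E: "\<And>i j. (A ** adj2 B) $ i $ j = int r * E $ i $ j"
  shows "E \<in> carrier (Gamma1 N)" "A = E ** B"
proof -
  have det: "det B = int r" using B by (simp add: Hecke_set_def)
  have "int r * ((E ** B) $ i $ j) = ((A ** adj2 B) ** B) $ i $ j" for i j
    by (simp add: matmul_nth[of E] matmul_nth[of "A ** adj2 B"] E algebra_simps)
  also have "\<dots> i j = (A ** (adj2 B ** B)) $ i $ j" for i j
    by (simp add: matrix_mul_assoc)
  also have "\<dots> i j = int r * A $ i $ j" for i j
    by (simp add: adj2_scalar det)
  finally have "int r * ((E ** B) $ i $ j) = int r * A $ i $ j" for i j .
  then have "(E ** B) $ i $ j = A $ i $ j" for i j
    using r by simp
  then show AEB: "A = E ** B" by (simp add: vec_eq_iff)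
  show "E \<in> carrier (Gamma1 N)"
    using Hecke_set_left_factor[of E B A N 1 r] A B r AEB by (simp add: carrier_Gamma1)
qed

text \<open>
  Modulo \<open>r\<close> the product of \<open>A\<close> and the adjugate of \<open>B\<close> is \<open>B adj(B) = r\<close>, that is, zero.
\<close>

lemma Hecke_set_cong_orbit:
  assumes A: "A \<in> Hecke_set N r" and B: "B \<in> Hecke_set N r" and r: "r > 0"
    and cong: "\<And>i j. [A $ i $ j = B $ i $ j] (mod int r)"
  shows "\<exists>y\<in>carrier (Gamma1 N). A = y ** B"
proof -
  have det: "det B = int r" using B by (simp add: Hecke_set_def)
  have "int r dvd (A ** adj2 B) $ i $ j" for i j
  proof -
    have "[(A ** adj2 B) $ i $ j = (B ** adj2 B) $ i $ j] (mod int r)"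
      unfolding matmul_nth using cong by (intro cong_add cong_mult cong_refl)
    moreover have "int r dvd (B ** adj2 B) $ i $ j"
    proof -
      have "\<forall>i j. int r dvd (B ** adj2 B) $ i $ j"
        using det by (simp add: forall_2 matmul_nth det_2 algebra_simps)
      then show ?thesis by blast
    qed
    ultimately show ?thesis by (simp add: cong_dvd_iff)
  qed
  then obtain e where e: "\<And>i j. (A ** adj2 B) $ i $ j = int r * e i j"
    unfolding dvd_def by metis
  define E :: imat where "E = (\<chi> i j. e i j)"
  have "\<And>i j. (A ** adj2 B) $ i $ j = int r * E $ i $ j" by (simp add: E_def e)
  from Hecke_set_left_quotient[OF A B r this] show ?thesis by blast
qed

lemma Hecke_reps_exist:
  "\<exists>R. is_Hecke_reps N r R"
proof -
  interpret group "Gamma1 N" by (rule group_Gamma1)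
  define orb where "orb A = {y ** A | y. y \<in> carrier (Gamma1 N)}" for A :: imat
  define c where "c X = (SOME d. d \<in> X)" for X :: "imat set"
  have self: "A \<in> orb A" for A
    unfolding orb_def using one_closed by (auto intro!: exI[of _ "mat 1"])
  have orb_eq: "orb (y ** A) = orb A" if y: "y \<in> carrier (Gamma1 N)" for y A
  proof (intro equalityI subsetI)
    fix B assume "B \<in> orb (y ** A)"
    then obtain x where x: "x \<in> carrier (Gamma1 N)" "B = (x ** y) ** A"
      by (auto simp: orb_def matrix_mul_assoc)
    then show "B \<in> orb A"
      unfolding orb_def using Gamma1_closed[OF x(1) y] by blast
  next
    fix B assume "B \<in> orb A"
    then obtain x where x: "x \<in> carrier (Gamma1 N)" "B = x ** A" by (auto simp: orb_def)
    have "B = (x ** adj2 y) ** (y ** A)"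
      using adj2_inverse(2)[OF Gamma1_det[OF y]] x(2)
      by (metis matrix_mul_assoc matrix_mul_rid)
    then show "B \<in> orb (y ** A)"
      unfolding orb_def using Gamma1_closed[OF x(1) adj2_Gamma1[OF y]] by blast
  qed
  have c: "\<exists>y\<in>carrier (Gamma1 N). c (orb A) = y ** A" for A
    using someI[of "\<lambda>d. d \<in> orb A", OF self] by (auto simp: c_def orb_def)
  have sub: "y ** A \<in> Hecke_set N r" if "y \<in> carrier (Gamma1 N)" "A \<in> Hecke_set N r" for y A
    using Hecke_set_mult[of y N 1 A r] that by (simp add: carrier_Gamma1)
  have "is_Hecke_reps N r ((\<lambda>A. c (orb A)) ` Hecke_set N r)"
    unfolding is_Hecke_reps_def
  proof (intro conjI ballI)
    show "(\<lambda>A. c (orb A)) ` Hecke_set N r \<subseteq> Hecke_set N r"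
      using c sub by (metis image_subsetI)
  next
    fix A assume A: "A \<in> Hecke_set N r"
    from c[of A] obtain y where y: "y \<in> carrier (Gamma1 N)" "c (orb A) = y ** A" by blast
    have "A = adj2 y ** c (orb A)"
      using adj2_inverse(2)[OF Gamma1_det[OF y(1)]] by (simp add: y(2) matrix_mul_assoc)
    then show "\<exists>!d. d \<in> (\<lambda>A. c (orb A)) ` Hecke_set N r \<and> (\<exists>y\<in>carrier (Gamma1 N). A = y ** d)"
    proof (intro ex1I[of _ "c (orb A)"] conjI)
      show "\<exists>y'\<in>carrier (Gamma1 N). A = y' ** c (orb A)" if "A = adj2 y ** c (orb A)"
        using that adj2_Gamma1[OF y(1)] by blast
    next
      fix d assume d: "d \<in> (\<lambda>A. c (orb A)) ` Hecke_set N r \<and> (\<exists>y\<in>carrier (Gamma1 N). A = y ** d)"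
      then obtain B x where B: "d = c (orb B)" and x: "x \<in> carrier (Gamma1 N)" "A = x ** d" by blast
      obtain u where u: "u \<in> carrier (Gamma1 N)" "d = u ** B" using c[of B] B by auto
      have "orb A = orb B" by (simp only: x(2) u(2) orb_eq[OF x(1)] orb_eq[OF u(1)])
      then show "d = c (orb A)" using B by simp
    qed (use A in auto)
  qed
  then show ?thesis ..
qed

text \<open>
  Representatives with the same entries modulo \<open>r\<close> lie in one orbit, and so coincide.
\<close>

lemma Hecke_reps_finite:
  assumes R: "is_Hecke_reps N r R" and r: "r > 0"
  shows "finite R"
proof -
  \<comment> \<open>reduction of all entries modulo \<open>r\<close>\<close>
  define red where "red A = (\<lambda>(i::2, j::2). (A::imat) $ i $ j mod int r)" for A
  have "inj_on red R"
  proof (rule inj_onI)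
    fix A B assume A: "A \<in> R" and B: "B \<in> R" and "red A = red B"
    then have "[A $ i $ j = B $ i $ j] (mod int r)" for i j
      by (auto simp: red_def fun_eq_iff cong_def)
    then obtain y where y: "y \<in> carrier (Gamma1 N)" "A = y ** B"
      using Hecke_set_cong_orbit[OF _ _ r, of A N B] A B R by (auto simp: is_Hecke_reps_def)
    moreover have "A = mat 1 ** A" "mat 1 \<in> carrier (Gamma1 N)" by (simp_all add: Gamma1_iff)
    ultimately show "A = B"
      using R A B unfolding is_Hecke_reps_def by (metis subsetD)
  qed
  moreover have "red ` R \<subseteq> UNIV \<rightarrow>\<^sub>E {0..<int r}"
    using r by (auto simp: red_def)
  then have "finite (red ` R)" by (rule finite_subset) (simp add: finite_PiE)
  ultimately show ?thesis by (metis finite_imageD)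
qed

section \<open>Constant functions and functions of sum zero\<close>

text \<open>
  The hypothesis holds for a set of \<open>p + 1\<close> elements in characteristic \<open>p\<close>.  It makes the sum over \<open>S\<close>
  a projection to the constants.
\<close>

lemma const_zero_split_eq:
  fixes f :: "'s \<Rightarrow> 'v::ab_group_add"
  assumes const: "\<And>c::'v. (\<Sum>s\<in>S. c) = c"
  shows "const_zero_split S f = (sum f S, \<lambda>s\<in>S. f s - sum f S)"
  unfolding const_zero_split_def
proof (rule the_equality)
  show "case (sum f S, \<lambda>s\<in>S. f s - sum f S) of (c, h) \<Rightarrow>
      h \<in> extensional S \<and> sum h S = 0 \<and> (\<forall>s\<in>S. f s = c + h s)"
    by (simp add: sum_subtractf const)
next
  fix ch :: "'v \<times> ('s \<Rightarrow> 'v)"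
  assume "case ch of (c, h) \<Rightarrow> h \<in> extensional S \<and> sum h S = 0 \<and> (\<forall>s\<in>S. f s = c + h s)"
  then obtain c h where ch: "ch = (c, h)" and h: "h \<in> extensional S" "sum h S = 0"
    and f: "\<And>s. s \<in> S \<Longrightarrow> f s = c + h s" by (cases ch) auto
  have "sum f S = (\<Sum>s\<in>S. c + h s)" using f by (intro sum.cong) auto
  also have "\<dots> = c" by (simp add: sum.distrib h const)
  finally have c: "sum f S = c" .
  have "h = (\<lambda>s\<in>S. f s - sum f S)"
    unfolding c using h(1) by (intro extensionalityI[of _ S]) (auto simp: f)
  then show "ch = (sum f S, \<lambda>s\<in>S. f s - sum f S)" by (simp add: ch c)
qed

section \<open>The prime field\<close>

lemma prime_subfield_of_int [simp]: "of_int n \<in> prime_subfield"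
  by (simp add: prime_subfield_def)

lemma prime_subfield_0 [simp]: "0 \<in> prime_subfield" and prime_subfield_1 [simp]: "1 \<in> prime_subfield"
  using prime_subfield_of_int[of 0] prime_subfield_of_int[of 1] by simp_all

lemma prime_subfield_add: "\<lbrakk>a \<in> prime_subfield; b \<in> prime_subfield\<rbrakk> \<Longrightarrow> a + b \<in> prime_subfield"
  by (auto simp: prime_subfield_def simp flip: of_int_add)

lemma prime_subfield_mult: "\<lbrakk>a \<in> prime_subfield; b \<in> prime_subfield\<rbrakk> \<Longrightarrow> a * b \<in> prime_subfield"
  by (auto simp: prime_subfield_def simp flip: of_int_mult)

lemma prime_subfield_uminus: "a \<in> prime_subfield \<Longrightarrow> - a \<in> prime_subfield"
  by (auto simp: prime_subfield_def simp flip: of_int_minus)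

lemma prime_subfield_power: "a \<in> prime_subfield \<Longrightarrow> a ^ n \<in> prime_subfield"
  by (induction n) (auto intro: prime_subfield_mult)

locale prime_char =
  fixes p :: nat and F :: "'F::field itself"
  assumes prime_p: "prime p" and char_p: "CHAR('F) = p"
begin

lemma of_int_eq_0: "of_int n = (0::'F) \<longleftrightarrow> int p dvd n"
  using of_int_eq_0_iff_char_dvd[where 'a = 'F] by (simp add: char_p)

lemma of_nat_p [simp]: "of_nat p = (0::'F)"
  using of_nat_CHAR[where 'a = 'F] by (simp add: char_p)

lemma prime_subfield_of_nat:
  assumes "(c::'F) \<in> prime_subfield"
  obtains n where "c = of_nat n"
proof -
  obtain a where a: "c = of_int a" using assms by (auto simp: prime_subfield_def)
  have "int p > 0" using prime_p by (simp add: prime_gt_0_nat)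
  then have "c = of_int (int (nat (a mod int p)))"
    using of_int_eq_iff_cong_CHAR[where 'a = 'F, of a "a mod int p"] by (simp add: a char_p)
  then show thesis by (intro that[of "nat (a mod int p)"]) simp
qed

lemma fermat_prime_subfield:
  assumes "(c::'F) \<in> prime_subfield" "c \<noteq> 0"
  shows "c ^ (p - 1) = 1"
proof -
  obtain n where n: "c = of_nat n" using prime_subfield_of_nat assms(1) .
  have "of_nat n ^ p = (of_nat n :: 'F)"
  proof (induction n)
    case 0
    then show ?case using prime_gt_0_nat[OF prime_p] by simp
  next
    case (Suc n)
    have "(1 + of_nat n :: 'F) ^ p = 1 ^ p + of_nat n ^ p"
      by (rule freshmans_dream) (simp_all add: char_p prime_p)
    then show ?case using Suc by simp
  qed
  moreover have "c * c ^ (p - 1) = c ^ p"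
    using prime_gt_0_nat[OF prime_p] by (simp flip: power_Suc)
  ultimately have "c * c ^ (p - 1) = c" by (simp add: n)
  then show ?thesis using assms(2) by simp
qed

lemma prime_subfield_inverse:
  assumes "(c::'F) \<in> prime_subfield"
  shows "inverse c \<in> prime_subfield"
proof (cases "c = 0")
  case False
  have "p - 1 = Suc (p - 2)" using prime_gt_1_nat[OF prime_p] by simp
  then have "c * c ^ (p - 2) = 1"
    using fermat_prime_subfield[OF assms False] by (metis power_Suc)
  then have "inverse c = c ^ (p - 2)" using inverse_unique by blast
  then show ?thesis using prime_subfield_power[OF assms] by simp
qed simp

text \<open>
  The telescoping sum of \<open>(n + 1)\<^sup>m\<^sup>+\<^sup>1 - n\<^sup>m\<^sup>+\<^sup>1\<close> over \<open>n < p\<close> is zero.  By induction only the term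
  \<open>(m + 1) n\<^sup>m\<close> of the binomial expansion contributes to it, and \<open>m + 1\<close> is invertible.
\<close>

lemma power_sum_eq_0: "m < p - 1 \<Longrightarrow> (\<Sum>n<p. of_nat n ^ m) = (0::'F)"
proof (induction m rule: less_induct)
  case (less m)
  define S where "S k = (\<Sum>n<p. of_nat n ^ k :: 'F)" for k
  have "0 = (\<Sum>n<p. of_nat (Suc n) ^ Suc m - of_nat n ^ Suc m :: 'F)"
    using sum_lessThan_telescope[of "\<lambda>n. of_nat n ^ Suc m :: 'F" p] by simp
  also have "\<dots> = (\<Sum>n<p. \<Sum>k\<le>m. of_nat (Suc m choose k) * of_nat n ^ k)"
  proof (rule sum.cong[OF refl])
    fix n
    have "of_nat (Suc n) ^ Suc m = (\<Sum>k\<le>Suc m. of_nat (Suc m choose k) * of_nat n ^ k :: 'F)"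
      using binomial_ring[of "of_nat n :: 'F" 1 "Suc m"] by (simp add: add.commute)
    then show "of_nat (Suc n) ^ Suc m - of_nat n ^ Suc m =
        (\<Sum>k\<le>m. of_nat (Suc m choose k) * of_nat n ^ k :: 'F)"
      by (simp only: sum.atMost_Suc) simp
  qed
  also have "\<dots> = (\<Sum>k\<le>m. of_nat (Suc m choose k) * S k)"
    unfolding S_def sum_distrib_left by (rule sum.swap)
  also have "\<dots> = of_nat (Suc m choose m) * S m"
  proof (rule sum.remove[THEN trans])
    have "(\<Sum>k\<in>{..m} - {m}. of_nat (Suc m choose k) * S k) = 0"
      using less by (intro sum.neutral) (auto simp: S_def)
    then show "of_nat (Suc m choose m) * S m + (\<Sum>k\<in>{..m} - {m}. of_nat (Suc m choose k) * S k) =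
      of_nat (Suc m choose m) * S m" by simp
  qed auto
  finally have "of_nat (Suc m) * S m = 0" by (simp del: of_nat_Suc)
  moreover have "of_nat (Suc m) \<noteq> (0::'F)"
    using less.prems of_nat_eq_0_iff_char_dvd[where 'a = 'F, of "Suc m"] char_p
    by (auto dest!: dvd_imp_le simp del: of_nat_Suc)
  ultimately show ?case by (simp add: S_def del: of_nat_Suc)
qed

lemma power_sum_eq_minus_1: "(\<Sum>n<p. of_nat n ^ (p - 1)) = (-1::'F)"
proof -
  have p: "p > 1" using prime_p by (rule prime_gt_1_nat)
  have "(\<Sum>n<p. of_nat n ^ (p - 1)) = (\<Sum>n\<in>{..<p} - {0}. of_nat n ^ (p - 1) :: 'F)"
    using p by (intro sum.mono_neutral_right) auto
  also have "\<dots> = (\<Sum>n\<in>{..<p} - {0}. 1)"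
  proof (intro sum.cong refl fermat_prime_subfield)
    fix n assume n: "n \<in> {..<p} - {0}"
    show "of_nat n \<in> (prime_subfield :: 'F set)"
      using prime_subfield_of_int[of "int n"] by simp
    show "of_nat n \<noteq> (0::'F)"
      using n of_nat_eq_0_iff_char_dvd[where 'a = 'F, of n] char_p by (auto dest!: dvd_imp_le)
  qed
  also have "\<dots> = of_nat (p - 1)" using p by simp
  also have "\<dots> = -1" using p by (simp add: of_nat_diff)
  finally show ?thesis .
qed

section \<open>The projective line over the prime field\<close>

lemma proj_pt_eq_iff:
  assumes "a \<in> prime_subfield" "b \<in> prime_subfield" "c \<in> prime_subfield" "d \<in> prime_subfield"
    and "(a, b) \<noteq> (0, 0 :: 'F)" "(c, d) \<noteq> (0, 0)"
  shows "proj_pt a b = proj_pt c d \<longleftrightarrow> a * d = b * c"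
proof
  assume eq: "proj_pt a b = proj_pt c d"
  have "(c, d) \<in> proj_pt c d" by (auto simp: proj_pt_def intro!: exI[of _ 1])
  then have "(c, d) \<in> proj_pt a b" by (simp only: eq)
  then obtain t where "c = t * a" "d = t * b" unfolding proj_pt_def by blast
  then show "a * d = b * c" by simp
next
  assume eq: "a * d = b * c"
  \<comment> \<open>the two pairs of coordinates are proportional\<close>
  obtain t where t: "t \<in> prime_subfield" "t \<noteq> 0" "c = t * a" "d = t * b"
  proof (cases "a = 0")
    case True
    then have "b \<noteq> 0" "c = 0" "d \<noteq> 0" using assms(5,6) eq by auto
    then show thesis
      using True assms by (intro that[of "d * inverse b"])
        (simp_all add: prime_subfield_mult prime_subfield_inverse)
  next
    case False
    then have "d = b * c * inverse a" using eq by (simp add: field_simps)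
    moreover from this have "c \<noteq> 0" using assms(6) by auto
    ultimately show thesis
      using False assms by (intro that[of "c * inverse a"])
        (simp_all add: prime_subfield_mult prime_subfield_inverse)
  qed
  show "proj_pt a b = proj_pt c d"
  proof (intro equalityI subsetI)
    fix v assume "v \<in> proj_pt a b"
    then obtain s where s: "s \<in> prime_subfield" "s \<noteq> 0" "v = (s * a, s * b)" by (auto simp: proj_pt_def)
    then have "v = ((s * inverse t) * c, (s * inverse t) * d)" using t by simp
    moreover have "s * inverse t \<in> prime_subfield - {0}"
      using s t by (auto intro: prime_subfield_mult prime_subfield_inverse)
    ultimately show "v \<in> proj_pt c d" unfolding proj_pt_def by blast
  next
    fix v assume "v \<in> proj_pt c d"
    then obtain s where s: "s \<in> prime_subfield" "s \<noteq> 0" "v = (s * c, s * d)" by (auto simp: proj_pt_def)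
    then have "v = ((s * t) * a, (s * t) * b)" using t by simp
    moreover have "s * t \<in> prime_subfield - {0}"
      using s t by (auto intro: prime_subfield_mult)
    ultimately show "v \<in> proj_pt a b" unfolding proj_pt_def by blast
  qed
qed

lemma mat_proj_pt: "mat_proj M (proj_pt a b) =
    proj_pt (of_int (M$1$1) * a + of_int (M$1$2) * b) (of_int (M$2$1) * a + of_int (M$2$2) * (b::'F))"
  unfolding mat_proj_def proj_pt_def Setcompr_eq_image image_image
  by (rule image_cong) (auto simp: algebra_simps)

lemma mat_proj_mult: "mat_proj (M ** M') P = mat_proj M (mat_proj M' (P :: ('F \<times> 'F) set))"
  unfolding mat_proj_def image_image by (rule image_cong) (auto simp: matmul_nth algebra_simps)

lemma mat_proj_1 [simp]: "mat_proj (mat 1) (P :: ('F \<times> 'F) set) = P"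
  by (simp add: mat_proj_def)

lemma mat_proj_closed:
  assumes M: "det M = 1" and P: "(P :: ('F \<times> 'F) set) \<in> proj_line"
  shows "mat_proj M P \<in> proj_line"
proof -
  obtain a b :: 'F where ab: "P = proj_pt a b" "a \<in> prime_subfield" "b \<in> prime_subfield" "(a, b) \<noteq> (0, 0)"
    using P unfolding proj_line_def by blast
  let ?a = "of_int (M$1$1) * a + of_int (M$1$2) * b" and ?b = "of_int (M$2$1) * a + of_int (M$2$2) * b"
  have det: "of_int (M$1$1) * of_int (M$2$2) - of_int (M$1$2) * of_int (M$2$1) = (1::'F)"
    using M by (simp add: det_2 flip: of_int_mult of_int_diff)
  have "of_int (M$2$2) * ?a - of_int (M$1$2) * ?b =
      (of_int (M$1$1) * of_int (M$2$2) - of_int (M$1$2) * of_int (M$2$1)) * a"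
    "of_int (M$1$1) * ?b - of_int (M$2$1) * ?a =
      (of_int (M$1$1) * of_int (M$2$2) - of_int (M$1$2) * of_int (M$2$1)) * b"
    by (simp_all add: algebra_simps)
  then have "(?a, ?b) \<noteq> (0, 0)" using ab(4) unfolding det by auto
  moreover have "?a \<in> prime_subfield" "?b \<in> prime_subfield"
    using ab by (auto intro!: prime_subfield_add prime_subfield_mult)
  ultimately show ?thesis
    unfolding ab(1) mat_proj_pt proj_line_def by blast
qed

text \<open>
  The exponent \<open>p - 1\<close> makes the form independent of the chosen coordinates, by Fermat's theorem.
\<close>

lemma line_power_pt:
  assumes "(a::'F) \<in> prime_subfield" "b \<in> prime_subfield"
  shows "line_power p (proj_pt a b) = (bconst a * bX + bconst b * bY) ^ (p - 1)"
proof -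
  have "(1 * a, 1 * b) \<in> proj_pt a b" unfolding proj_pt_def by (intro CollectI exI[of _ 1]) auto
  then have "(SOME v. v \<in> proj_pt a b) \<in> proj_pt a b" by (rule someI)
  then obtain c where c: "c \<in> prime_subfield" "c \<noteq> 0" "(SOME v. v \<in> proj_pt a b) = (c * a, c * b)"
    by (auto simp: proj_pt_def)
  have "bconst (c * a) * bX + bconst (c * b) * bY = bconst c * (bconst a * bX + bconst b * bY)"
    by (simp add: bconst_mult algebra_simps)
  then show ?thesis
    using fermat_prime_subfield[OF c(1,2)]
    by (simp add: line_power_def c(3) power_mult_distrib flip: bconst_power)
qed

lemma line_power_form: "P \<in> proj_line \<Longrightarrow> form (p - 1) (line_power p (P :: ('F \<times> 'F) set))"
  by (auto simp: proj_line_def line_power_pt form_linear_power)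

lemma line_power_act:
  assumes "(P :: ('F \<times> 'F) set) \<in> proj_line"
  shows "line_power p (mat_proj M P) = mat_bact M (line_power p P)"
proof -
  obtain a b :: 'F where ab: "P = proj_pt a b" "a \<in> prime_subfield" "b \<in> prime_subfield"
    using assms unfolding proj_line_def by blast
  show ?thesis
    unfolding ab(1) mat_proj_pt
    using ab(2,3)
    by (simp add: line_power_pt prime_subfield_add prime_subfield_mult mat_bact_power)
      (simp add: mat_bact_add mat_bact_mult mat_bact_bX mat_bact_bY bconst_add bconst_mult algebra_simps)
qed

end

section \<open>The transversal and the points of the projective line\<close>

locale level_p = prime_char p F
  for p :: nat and F :: "'F::field itself" +
  fixes N A B :: int
  assumes not_dvd_N: "\<not> int p dvd N" and bezout: "A * N + B * int p = 1"
begin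

abbreviation "\<Gamma> \<equiv> Gamma1 N"
abbreviation "\<Gamma>\<^sub>0 \<equiv> Gamma10 N p"
abbreviation "rep \<equiv> transv N p A B"

text \<open>
  A constant rather than an abbreviation, because the simplifier would rewrite the interval.
\<close>

definition I :: "nat set" where "I = {1..p + 1}"

lemma finite_I [simp]: "finite I" and card_I: "card I = p + 1"
  by (simp_all add: I_def)

lemma p_gt_1: "p > 1"
  using prime_p by (rule prime_gt_1_nat)

sublocale \<Gamma>: group \<Gamma>
  by (rule group_Gamma1)

sublocale \<Gamma>\<^sub>0: subgroup \<Gamma>\<^sub>0 \<Gamma>
  by (rule subgroup_Gamma10)

text \<open>
  The orbit map \<open>x \<mapsto> x (1 : 0)\<close> of the group on the projective line.  The stabilizer of \<open>(1 : 0)\<close> is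
  \<open>\<Gamma>\<^sub>0\<close>, so this identifies left cosets with points.
\<close>

definition pt :: "imat \<Rightarrow> ('F \<times> 'F) set" where
  "pt x = mat_proj x (proj_pt 1 0)"

lemma pt_eq: "pt x = proj_pt (of_int (x$1$1)) (of_int (x$2$1))"
  by (simp add: pt_def mat_proj_pt)

lemma pt_mult: "pt (x ** y) = mat_proj x (pt y)"
  by (simp add: pt_def mat_proj_mult)

lemma pt_in_line: "det x = 1 \<Longrightarrow> pt x \<in> proj_line"
  unfolding pt_def
proof (rule mat_proj_closed)
  show "(proj_pt 1 0 :: ('F \<times> 'F) set) \<in> proj_line"
    unfolding proj_line_def by (rule CollectI, rule exI[of _ 1], rule exI[of _ 0]) simp
qed

lemma of_int_col_nonzero:
  fixes x :: imat
  assumes "\<not> int p dvd x$1$1 * u - x$2$1 * v"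
  shows "(of_int (x$1$1) :: 'F, of_int (x$2$1) :: 'F) \<noteq> (0, 0)"
  using assms by (auto simp: of_int_eq_0)

lemma not_p_dvd_1: "\<not> int p dvd 1"
  using p_gt_1 by simp

lemma col_nonzero:
  fixes x :: imat
  assumes "det x = 1"
  shows "(of_int (x$1$1) :: 'F, of_int (x$2$1) :: 'F) \<noteq> (0, 0)"
  using of_int_col_nonzero[of x "x$2$2" "x$1$2"] not_p_dvd_1 assms
  by (simp add: det_2 algebra_simps)

text \<open>
  Two points agree exactly if the determinant of their coordinates vanishes, and this determinant is the
  lower left entry of \<open>x\<^sup>-\<^sup>1 y\<close>.
\<close>

lemma pt_eq_iff_dvd:
  assumes "det x = 1" "det y = 1"
  shows "pt x = pt y \<longleftrightarrow> int p dvd (adj2 x ** y)$2$1"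
proof -
  have "pt x = pt y \<longleftrightarrow> of_int (x$1$1) * of_int (y$2$1) = (of_int (x$2$1) * of_int (y$1$1) :: 'F)"
    unfolding pt_eq by (rule proj_pt_eq_iff) (use col_nonzero assms in auto)
  also have "\<dots> \<longleftrightarrow> of_int (x$1$1 * y$2$1 - x$2$1 * y$1$1) = (0::'F)" by simp
  also have "\<dots> \<longleftrightarrow> int p dvd (adj2 x ** y)$2$1"
    by (simp only: of_int_eq_0) (simp add: matmul_nth)
  finally show ?thesis .
qed

lemma pt_eq_iff:
  assumes "x \<in> carrier \<Gamma>" "y \<in> carrier \<Gamma>"
  shows "pt x = pt y \<longleftrightarrow> adj2 x ** y \<in> \<Gamma>\<^sub>0"
  using assms by (simp add: pt_eq_iff_dvd Gamma1_det Gamma10_iff Gamma1_closed adj2_Gamma1)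

lemma rep_closed: "rep i \<in> carrier \<Gamma>"
proof -
  have "[B * int p = 1] (mod N)"
    unfolding cong_iff_dvd_diff
  proof
    show "B * int p - 1 = N * (- A)" using bezout by (simp add: mult.commute)
  qed
  then show ?thesis
    using bezout by (cases "i \<le> p") (simp_all add: transv_def Gamma1_iff det_2 cong_0_iff)
qed

lemma det_rep [simp]: "det (rep i) = 1"
  using Gamma1_det[OF rep_closed] .

lemma AN_cong: "of_int A * of_int N = (1::'F)"
proof -
  have "of_int (A * N + B * int p) = (1::'F)" by (simp only: bezout of_int_1)
  then show ?thesis by simp
qed

lemma pt_rep: "pt (rep i) = transv_pt N p i"
  using AN_cong by (auto simp: pt_eq transv_pt_def transv_def)

lemma of_int_N_nonzero: "of_int N \<noteq> (0::'F)"
  using not_dvd_N by (simp add: of_int_eq_0)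

lemma inj_transv_pt: "inj_on (transv_pt N p :: nat \<Rightarrow> ('F \<times> 'F) set) I"
proof (rule inj_onI)
  fix i j assume i: "i \<in> I" and j: "j \<in> I" and eq: "transv_pt N p i = (transv_pt N p j :: ('F \<times> 'F) set)"
  have eq1: "of_int (N * (int j - 1)) = (of_int (N * (int i - 1)) :: 'F)" if "i \<le> p" "j \<le> p"
    using eq proj_pt_eq_iff[of 1 "of_int (N * (int i - 1))" 1 "of_int (N * (int j - 1))"] that
    by (simp add: transv_pt_def prime_subfield_of_int del: of_int_mult of_int_diff)
  have eq2: False if "i \<le> p" "\<not> j \<le> p"
    using eq proj_pt_eq_iff[of 1 "of_int (N * (int i - 1))" 0 1] that
    by (simp add: transv_pt_def del: of_int_mult of_int_diff)
  have eq3: False if "\<not> i \<le> p" "j \<le> p"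
    using eq proj_pt_eq_iff[of 0 1 1 "of_int (N * (int j - 1))"] that
    by (simp add: transv_pt_def del: of_int_mult of_int_diff)
  show "i = j"
  proof (cases "i \<le> p \<and> j \<le> p")
    case True
    then have "of_int N * of_int (int j - int i) = (0::'F)" using eq1 by (simp add: algebra_simps)
    then have "int p dvd int j - int i"
      using of_int_N_nonzero by (simp only: mult_eq_0_iff of_int_eq_0) auto
    moreover have "\<bar>int j - int i\<bar> < int p" using True i j by (auto simp: I_def)
    ultimately show ?thesis using zdvd_not_zless[of "\<bar>int j - int i\<bar>" "int p"] by (cases "i = j") auto
  next
    case False
    then have "\<not> i \<le> p" "\<not> j \<le> p" using eq2 eq3 by blast+
    then show ?thesis using i j by (simp add: I_def)
  qed
qed

text \<open>
  A point \<open>(a : b)\<close> with \<open>a \<noteq> 0\<close> is \<open>(1 : n N)\<close> with \<open>n = A b / a\<close>, as \<open>A\<close> is inverse to \<open>N\<close> modulo \<open>p\<close>.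
\<close>

lemma transv_pt_image: "transv_pt N p ` I = (proj_line :: ('F \<times> 'F) set set)"
proof (intro equalityI subsetI)
  fix P :: "('F \<times> 'F) set" assume "P \<in> transv_pt N p ` I"
  then show "P \<in> proj_line" using pt_in_line[OF det_rep] by (auto simp flip: pt_rep)
next
  fix P :: "('F \<times> 'F) set" assume "P \<in> proj_line"
  then obtain a b :: 'F where P: "P = proj_pt a b" "a \<in> prime_subfield" "b \<in> prime_subfield" "(a, b) \<noteq> (0, 0)"
    unfolding proj_line_def by blast
  show "P \<in> transv_pt N p ` I"
  proof (cases "a = 0")
    case True
    then have "P = transv_pt N p (p + 1)"
      using P proj_pt_eq_iff[of a b 0 1] by (simp add: transv_pt_def)
    then show ?thesis by (rule image_eqI) (simp add: I_def)
  next
    case False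
    have "of_int A * b * inverse a \<in> prime_subfield"
      by (intro prime_subfield_mult prime_subfield_inverse P prime_subfield_of_int)
    then obtain n where n: "of_int A * b * inverse a = of_nat n" using prime_subfield_of_nat by blast
    define i where "i = n mod p + 1"
    have "of_nat (n mod p) = (of_nat n :: 'F)"
      using of_nat_eq_iff_cong_CHAR[where 'a = 'F, of "n mod p" n] by (simp add: char_p)
    then have "of_int (N * (int i - 1)) = of_int N * (of_int A * b * inverse a)"
      by (simp add: i_def n)
    also have "\<dots> = (of_int A * of_int N) * b * inverse a" by (simp only: mult_ac)
    also have "\<dots> = b * inverse a" using AN_cong by simp
    finally have *: "of_int (N * (int i - 1)) = b * inverse a" .
    have i: "i \<le> p" using p_gt_1 by (simp add: i_def Suc_le_eq)
    have "P = transv_pt N p i"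
      using P False proj_pt_eq_iff[of a b 1 "b * inverse a"] i
      by (simp add: transv_pt_def * prime_subfield_mult prime_subfield_inverse del: of_int_mult)
    moreover have "i \<in> I" using i by (simp add: I_def) (simp add: i_def)
    ultimately show ?thesis by (rule image_eqI)
  qed
qed

lemma transv_pt_bij: "bij_betw (transv_pt N p) I (proj_line :: ('F \<times> 'F) set set)"
  using inj_transv_pt transv_pt_image by (simp add: bij_betw_def)

lemma finite_proj_line: "finite (proj_line :: ('F \<times> 'F) set set)"
  and card_proj_line: "card (proj_line :: ('F \<times> 'F) set set) = p + 1"
  using bij_betw_finite[OF transv_pt_bij] bij_betw_same_card[OF transv_pt_bij] by (simp_all add: card_I)

lemma sum_proj_line: "(\<Sum>P\<in>proj_line. f P) = (\<Sum>i\<in>I. f (pt (rep i)))"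
  using sum.reindex_bij_betw[OF transv_pt_bij, of f] by (simp add: pt_rep)

definition idx :: "imat \<Rightarrow> nat" where
  "idx x = the_inv_into I (transv_pt N p) (pt x)"

lemma idx_in: "x \<in> carrier \<Gamma> \<Longrightarrow> idx x \<in> I"
  unfolding idx_def
  by (rule the_inv_into_into[OF inj_transv_pt])
    (simp_all add: transv_pt_image pt_in_line Gamma1_det)

lemma pt_idx: "x \<in> carrier \<Gamma> \<Longrightarrow> pt (rep (idx x)) = pt x"
  unfolding idx_def pt_rep
  by (rule f_the_inv_into_f[OF inj_transv_pt]) (simp add: transv_pt_image pt_in_line Gamma1_det)

lemma idx_unique: "\<lbrakk>i \<in> I; pt (rep i) = pt x\<rbrakk> \<Longrightarrow> idx x = i"
  unfolding idx_def pt_rep by (rule the_inv_into_f_eq[OF inj_transv_pt])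

lemma idx_rep: "i \<in> I \<Longrightarrow> idx (rep i) = i"
  by (rule idx_unique) simp_all

lemma idx_cong: "pt x = pt y \<Longrightarrow> idx x = idx y"
  by (simp add: idx_def)

lemma pt_rep_inj: "\<lbrakk>i \<in> I; j \<in> I; pt (rep i) = pt (rep j)\<rbrakk> \<Longrightarrow> i = j"
  using idx_unique[of i "rep j"] idx_rep by simp

definition eta :: "imat \<Rightarrow> imat" where
  "eta x = adj2 (rep (idx x)) ** x"

lemma eta_in: "x \<in> carrier \<Gamma> \<Longrightarrow> eta x \<in> \<Gamma>\<^sub>0"
  unfolding eta_def using pt_eq_iff[OF rep_closed, of x "idx x"] pt_idx by simp

lemma rep_eta: "rep (idx x) ** eta x = x"
  by (simp add: eta_def matrix_mul_assoc adj2_inverse)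

lemma pt_mult_Gamma10:
  assumes "x \<in> carrier \<Gamma>" "h \<in> \<Gamma>\<^sub>0"
  shows "pt (x ** h) = pt x"
proof -
  have "adj2 x ** (x ** h) = h"
    using assms by (simp add: matrix_mul_assoc adj2_inverse Gamma1_det)
  then have "pt x = pt (x ** h)"
    using assms pt_eq_iff[of x "x ** h"] by (simp add: Gamma1_closed)
  then show ?thesis by simp
qed

text \<open>
  With \<open>rep_eta\<close> this makes \<open>eta\<close> the component in \<open>\<Gamma>\<^sub>0\<close> that \<open>shapiro_class\<close> asks for.
\<close>

lemma eta_mult: "\<lbrakk>x \<in> carrier \<Gamma>; h \<in> \<Gamma>\<^sub>0\<rbrakk> \<Longrightarrow> eta (x ** h) = eta x ** h"
  using idx_cong[OF pt_mult_Gamma10] by (simp add: eta_def matrix_mul_assoc)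

lemma rep_1: "rep 1 = mat 1"
  using p_gt_1 by (simp add: transv_def imat_eq_iff)

lemma eta_rep: "i \<in> I \<Longrightarrow> eta (rep i) = mat 1"
  by (simp add: eta_def idx_rep adj2_inverse)

lemma eta_1: "eta (mat 1) = mat 1"
  using eta_rep[of 1] rep_1 by (simp add: I_def)

lemma line_power_rep: "line_power p (pt (rep i)) = mat_bact (rep i) (bX ^ (p - 1) :: 'F bpoly)"
  by (simp add: pt_eq line_power_pt mat_bact_power mat_bact_bX)

text \<open>
  In the expansion of the sum of \<open>(X + n N Y)\<^sup>p\<^sup>-\<^sup>1\<close> over \<open>n < p\<close> all power sums but that of exponent
  \<open>p - 1\<close> vanish.  What remains is \<open>- Y\<^sup>p\<^sup>-\<^sup>1\<close>, which cancels the contribution of the point \<open>(0 : 1)\<close>.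
\<close>

lemma sum_line_power: "(\<Sum>P\<in>proj_line. line_power p P) = (0 :: 'F bpoly)"
proof -
  define q where "q = p - 1"
  define t where "t n = of_int N * (of_nat n :: 'F)" for n
  have power_sums: "(\<Sum>n<p. t n ^ k) = (if k = q then -1 else 0)" if "k \<le> q" for k
  proof -
    have "of_int N ^ q = (1::'F)"
      unfolding q_def by (intro fermat_prime_subfield of_int_N_nonzero prime_subfield_of_int)
    moreover have "(\<Sum>n<p. t n ^ k) = of_int N ^ k * (\<Sum>n<p. of_nat n ^ k)"
      by (simp add: t_def power_mult_distrib sum_distrib_left)
    ultimately show ?thesis
      using that power_sum_eq_0[of k] power_sum_eq_minus_1 by (auto simp: q_def)
  qed
  have "(\<Sum>P\<in>proj_line. line_power p P) = (\<Sum>i\<in>I. line_power p (transv_pt N p i) :: 'F bpoly)"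
    by (simp add: sum_proj_line pt_rep)
  also have "I = insert (p + 1) (Suc ` {..<p})"
    by (auto simp: image_Suc_lessThan I_def)
  also have "(\<Sum>i\<in>insert (p + 1) (Suc ` {..<p}). line_power p (transv_pt N p i) :: 'F bpoly) =
      line_power p (proj_pt 0 1) + (\<Sum>n<p. line_power p (transv_pt N p (Suc n)))"
    by (subst sum.insert) (auto simp: sum.reindex transv_pt_def)
  also have "line_power p (proj_pt 0 1) = (bY ^ q :: 'F bpoly)"
    by (simp add: line_power_pt q_def)
  also have "(\<Sum>n<p. line_power p (transv_pt N p (Suc n))) = (\<Sum>n<p. (bconst (t n) * bY + bX) ^ q)"
  proof (rule sum.cong[OF refl])
    fix n assume "n \<in> {..<p}"
    then show "line_power p (transv_pt N p (Suc n)) = (bconst (t n) * bY + bX) ^ q"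
      using line_power_pt[of 1 "t n"] prime_subfield_of_int[of "N * int n"]
      by (simp add: transv_pt_def t_def q_def add.commute)
  qed
  also have "\<dots> = (\<Sum>n<p. \<Sum>k\<le>q. bconst (t n ^ k) * (of_nat (q choose k) * bY ^ k * bX ^ (q - k)))"
    by (simp add: binomial_ring power_mult_distrib bconst_power mult_ac)
  also have "\<dots> = (\<Sum>k\<le>q. bconst (\<Sum>n<p. t n ^ k) * (of_nat (q choose k) * bY ^ k * bX ^ (q - k)))"
    unfolding bconst_sum sum_distrib_right by (rule sum.swap)
  also have "\<dots> = (\<Sum>k\<le>q. if k = q then - (bY ^ q) else 0)"
    by (intro sum.cong refl) (simp add: power_sums bconst_uminus)
  also have "\<dots> = - (bY ^ q)" by simp
  finally show ?thesis by simp
qed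

lemma sum_proj_line_const:
  "(\<Sum>P\<in>(proj_line :: ('F \<times> 'F) set set). (c::'F)) = c"
  "(\<Sum>P\<in>(proj_line :: ('F \<times> 'F) set set). (C::'F bpoly)) = C"
  using bconst_of_nat[of p, where 'a = 'F] by (simp_all add: card_proj_line algebra_simps)

(* The simplifier would otherwise write p - Suc 0 for the degree p - 1. *)
declare One_nat_def [simp del]

section \<open>Functions on cosets and on points\<close>

abbreviation V :: "nat \<Rightarrow> ('F, imat, 'F bpoly) gmodule" where
  "V \<equiv> Vk"

abbreviation coset_funs :: "('F, imat, imat set \<Rightarrow> 'F) gmodule" where
  "coset_funs \<equiv> Fp_cosets N p"

abbreviation line_funs :: "('F, imat, ('F \<times> 'F) set \<Rightarrow> 'F) gmodule" where
  "line_funs \<equiv> Fp_proj_line N"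

abbreviation split :: "nat \<Rightarrow> ('F, imat, 'F bpoly \<times> ('F bpoly \<times> 'F bpoly \<Rightarrow>\<^sub>0 int) set) gmodule" where
  "split \<equiv> split_target p"

lemma group_module_V: "group_module \<Gamma> (V k)"
  by (rule group_module_Vk)

lemma group_module_Fp: "group_module \<Gamma> (Fp_module :: ('F, imat, 'F) gmodule)"
proof -
  have "comm_group (Fp_module :: ('F, imat, 'F) gmodule)"
  proof (rule comm_groupI)
    fix c :: 'F assume "c \<in> carrier Fp_module"
    then show "\<exists>d\<in>carrier Fp_module. d \<otimes>\<^bsub>Fp_module\<^esub> c = \<one>\<^bsub>Fp_module\<^esub>"
      by (intro bexI[of _ "- c"]) (simp_all add: Fp_module_def prime_subfield_uminus)
  qed (simp_all add: Fp_module_def prime_subfield_add)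
  then interpret F: comm_group "Fp_module :: ('F, imat, 'F) gmodule" .
  show ?thesis by unfold_locales (simp_all add: Fp_module_def)
qed

abbreviation coset :: "imat \<Rightarrow> imat set" where
  "coset x \<equiv> x <#\<^bsub>\<Gamma>\<^esub> \<Gamma>\<^sub>0"

abbreviation cosets :: "imat set set" where
  "cosets \<equiv> lcosets\<^bsub>\<Gamma>\<^esub> \<Gamma>\<^sub>0"

lemma cosets_cases: "C \<in> cosets \<Longrightarrow> \<exists>x\<in>carrier \<Gamma>. C = coset x"
  by (auto simp: LCOSETS_def)

lemma coset_in [simp]: "x \<in> carrier \<Gamma> \<Longrightarrow> coset x \<in> cosets"
  by (auto simp: LCOSETS_def)

lemma coset_eq_iff:
  assumes x: "x \<in> carrier \<Gamma>" and y: "y \<in> carrier \<Gamma>"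
  shows "coset x = coset y \<longleftrightarrow> pt x = pt y"
proof
  assume "coset x = coset y"
  then have "y \<in> coset x" using \<Gamma>.lcos_self[OF y subgroup_Gamma10] by simp
  then have "inv\<^bsub>\<Gamma>\<^esub> x \<otimes>\<^bsub>\<Gamma>\<^esub> y \<in> \<Gamma>\<^sub>0" by (rule \<Gamma>\<^sub>0.lcos_module_imp[OF group_Gamma1 x])
  then show "pt x = pt y" by (simp add: pt_eq_iff x y Gamma1_inv)
next
  assume "pt x = pt y"
  then have "inv\<^bsub>\<Gamma>\<^esub> x \<otimes>\<^bsub>\<Gamma>\<^esub> y \<in> \<Gamma>\<^sub>0" by (simp add: pt_eq_iff x y Gamma1_inv)
  then have "y \<in> coset x" by (rule \<Gamma>\<^sub>0.lcos_module_rev[OF group_Gamma1 x y])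
  then show "coset x = coset y" by (rule \<Gamma>.l_repr_independence[OF _ x subgroup_Gamma10])
qed

lemma coset_mult: "\<lbrakk>x \<in> carrier \<Gamma>; y \<in> carrier \<Gamma>\<rbrakk> \<Longrightarrow> x <#\<^bsub>\<Gamma>\<^esub> coset y = coset (x ** y)"
  using \<Gamma>.lcos_m_assoc[OF \<Gamma>\<^sub>0.subset] by simp

lemma l_coset_act:
  "\<lbrakk>x \<in> carrier \<Gamma>; C \<in> cosets\<rbrakk> \<Longrightarrow> x <#\<^bsub>\<Gamma>\<^esub> C \<in> cosets"
  "\<lbrakk>x \<in> carrier \<Gamma>; y \<in> carrier \<Gamma>; C \<in> cosets\<rbrakk> \<Longrightarrow> (x ** y) <#\<^bsub>\<Gamma>\<^esub> C = x <#\<^bsub>\<Gamma>\<^esub> (y <#\<^bsub>\<Gamma>\<^esub> C)"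
  "C \<in> cosets \<Longrightarrow> mat 1 <#\<^bsub>\<Gamma>\<^esub> C = C"
  by (auto dest!: cosets_cases simp: coset_mult Gamma1_closed matrix_mul_assoc)

lemma line_cases: "P \<in> proj_line \<Longrightarrow> \<exists>x\<in>carrier \<Gamma>. P = pt x"
  using transv_pt_image rep_closed pt_rep by (metis imageE)

lemma pt_in [simp]: "x \<in> carrier \<Gamma> \<Longrightarrow> pt x \<in> proj_line"
  by (simp add: pt_in_line Gamma1_det)

lemma group_module_cosets: "group_module \<Gamma> coset_funs"
  unfolding Fp_cosets_def
  by (rule group_module_fun_module[OF group_module_Fp]) (simp_all add: l_coset_act)

lemma group_module_line: "group_module \<Gamma> line_funs"
  unfolding Fp_proj_line_def
  by (rule group_module_fun_module[OF group_module_Fp])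
    (simp_all add: mat_proj_closed mat_proj_mult Gamma1_det)

lemma cosets_carrier: "f \<in> carrier coset_funs \<longleftrightarrow> f \<in> cosets \<rightarrow>\<^sub>E (prime_subfield :: 'F set)"
  and cosets_mult_eq: "f \<otimes>\<^bsub>coset_funs\<^esub> f' = (\<lambda>C\<in>cosets. f C + f' C :: 'F)"
  and cosets_scal: "scal coset_funs c f = (\<lambda>C\<in>cosets. c * f C)"
  by (simp_all add: Fp_cosets_def fun_module_def Fp_module_def)

lemma cosets_act: "y \<in> carrier \<Gamma> \<Longrightarrow>
    gact coset_funs y f = (\<lambda>C\<in>cosets. f (adj2 y <#\<^bsub>\<Gamma>\<^esub> C) :: 'F)"
  by (simp add: Fp_cosets_def fun_module_def Fp_module_def Gamma1_inv)

lemma line_carrier: "f \<in> carrier line_funs \<longleftrightarrow> f \<in> proj_line \<rightarrow>\<^sub>E (prime_subfield :: 'F set)"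
  and line_mult_eq: "f \<otimes>\<^bsub>line_funs\<^esub> f' = (\<lambda>P\<in>proj_line. f P + f' P :: 'F)"
  and line_scal: "scal line_funs c f = (\<lambda>P\<in>proj_line. c * f P)"
  by (simp_all add: Fp_proj_line_def fun_module_def Fp_module_def)

lemma line_act: "y \<in> carrier \<Gamma> \<Longrightarrow>
    gact line_funs y f = (\<lambda>P\<in>proj_line. f (mat_proj (adj2 y) P) :: 'F)"
  by (simp add: Fp_proj_line_def fun_module_def Fp_module_def Gamma1_inv)

text \<open>
  When cosets and points are both written as images of group elements, the map becomes the
  identity.  Its additivity and equivariance are then immediate.
\<close>

lemma cosets_to_proj_pt:
  assumes x: "x \<in> carrier \<Gamma>"
  shows "cosets_to_proj N p A B f (pt x) = (f (coset x) :: 'F)"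
proof -
  have "{i \<in> {1..p + 1}. transv_pt N p i = pt x} = {idx x}"
  proof (intro equalityI subsetI)
    fix i assume "i \<in> {i \<in> {1..p + 1}. transv_pt N p i = pt x}"
    then have "idx x = i" by (intro idx_unique) (simp_all only: I_def pt_rep mem_Collect_eq)
    then show "i \<in> {idx x}" by simp
  qed (use idx_in[OF x] pt_idx[OF x] in \<open>simp add: pt_rep I_def\<close>)
  moreover have "transv_coset N p A B (idx x) = coset x"
    unfolding transv_coset_def by (simp add: coset_eq_iff rep_closed x pt_idx)
  ultimately show ?thesis using x by (simp add: cosets_to_proj_def)
qed

lemma cosets_to_proj_closed:
  assumes f: "f \<in> carrier coset_funs"
  shows "cosets_to_proj N p A B f \<in> carrier line_funs"
proof -
  have "f (coset x) \<in> prime_subfield" if "x \<in> carrier \<Gamma>" for x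
    using f that by (simp add: cosets_carrier PiE_iff)
  then have "cosets_to_proj N p A B f P \<in> prime_subfield" if "P \<in> proj_line" for P :: "('F \<times> 'F) set"
    using line_cases[OF that] cosets_to_proj_pt by auto
  then show ?thesis by (simp add: line_carrier PiE_iff) (simp add: cosets_to_proj_def)
qed

lemma line_ext:
  assumes "f \<in> extensional proj_line" "g \<in> extensional proj_line"
    and "\<And>x. x \<in> carrier \<Gamma> \<Longrightarrow> f (pt x) = g (pt x)"
  shows "f = g"
  using assms(1,2) by (rule extensionalityI) (use line_cases assms(3) in blast)

lemma cosets_to_proj_ext: "cosets_to_proj N p A B (f :: imat set \<Rightarrow> 'F) \<in> extensional proj_line"
  by (simp add: cosets_to_proj_def)

lemma cosets_to_proj_mult: "cosets_to_proj N p A B (f \<otimes>\<^bsub>coset_funs\<^esub> f') =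
    cosets_to_proj N p A B f \<otimes>\<^bsub>line_funs\<^esub> (cosets_to_proj N p A B f' :: ('F \<times> 'F) set \<Rightarrow> 'F)"
  by (rule line_ext) (simp_all add: cosets_to_proj_ext line_mult_eq cosets_mult_eq cosets_to_proj_pt)

lemma cosets_to_proj_scal: "cosets_to_proj N p A B (scal coset_funs c f) =
    scal line_funs c (cosets_to_proj N p A B f :: ('F \<times> 'F) set \<Rightarrow> 'F)"
  by (rule line_ext) (simp_all add: cosets_to_proj_ext line_scal cosets_scal cosets_to_proj_pt)

lemma cosets_to_proj_act: "y \<in> carrier \<Gamma> \<Longrightarrow> cosets_to_proj N p A B (gact coset_funs y f) =
    gact line_funs y (cosets_to_proj N p A B f :: ('F \<times> 'F) set \<Rightarrow> 'F)"
  by (rule line_ext)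
    (simp_all add: cosets_to_proj_ext line_act cosets_act cosets_to_proj_pt coset_mult adj2_Gamma1
      Gamma1_closed flip: pt_mult)

lemma tensor_module_cosets:
  "tensor_module \<Gamma> prime_subfield coset_funs (V k)"
proof -
  interpret c: group_module \<Gamma> coset_funs
    by (rule group_module_cosets)
  interpret v: group_module \<Gamma> "V k" by (rule group_module_V)
  show ?thesis
    by unfold_locales (auto simp: cosets_carrier cosets_scal cosets_act PiE_iff prime_subfield_mult
        form_bconst_mult mat_bact_mult l_coset_act adj2_Gamma1 intro!: restrict_ext)
qed

lemma tensor_module_line:
  "tensor_module \<Gamma> prime_subfield line_funs (V k)"
proof -
  interpret c: group_module \<Gamma> line_funs
    by (rule group_module_line)
  interpret v: group_module \<Gamma> "V k" by (rule group_module_V)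
  show ?thesis
    by unfold_locales (auto simp: line_carrier line_scal line_act PiE_iff prime_subfield_mult
        form_bconst_mult mat_bact_mult mat_proj_closed Gamma1_det intro!: restrict_ext)
qed

lemma tensor_module_forms:
  "tensor_module \<Gamma> UNIV (V l) (V k)"
proof -
  interpret c: group_module \<Gamma> "V l" by (rule group_module_V)
  interpret v: group_module \<Gamma> "V k" by (rule group_module_V)
  show ?thesis
    by unfold_locales (simp_all add: form_bconst_mult mat_bact_mult)
qed

lemma module_hom_cosets_to_proj_tensor:
  "gmodule_hom \<Gamma> (tensor prime_subfield coset_funs (V k))
    (tensor prime_subfield line_funs (V k)) (cosets_to_proj_tensor N p A B k)"
  and cosets_to_proj_tensor_pure:
  "\<lbrakk>e \<in> carrier coset_funs; form k (v :: 'F bpoly)\<rbrakk> \<Longrightarrow>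
    cosets_to_proj_tensor N p A B k (pure_tensor prime_subfield coset_funs (V k) e v) =
      pure_tensor prime_subfield line_funs (V k) (cosets_to_proj N p A B e) v"
proof -
  interpret c: tensor_module \<Gamma> prime_subfield coset_funs
    "V k" by (rule tensor_module_cosets)
  interpret l: tensor_module \<Gamma> prime_subfield
    line_funs
    "V k" by (rule tensor_module_line)
  interpret b: balanced_map prime_subfield
    line_funs
    "V k" l.T l.pure by (rule l.pure_balanced)
  have bal: "balanced_map prime_subfield coset_funs (V k)
      (tensor prime_subfield line_funs (V k))
      (\<lambda>f v. l.pure (cosets_to_proj N p A B f) v)"
    by unfold_locales
      (simp_all only: l.tensor_carrier l.tensor_mult cosets_to_proj_mult cosets_to_proj_scal
        b.bal_closed b.bal_left b.bal_right b.bal_scal cosets_to_proj_closed)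
  show "gmodule_hom \<Gamma> (tensor prime_subfield coset_funs (V k))
      (tensor prime_subfield line_funs (V k)) (cosets_to_proj_tensor N p A B k)"
    unfolding cosets_to_proj_tensor_def
    by (rule c.tensor_lift_module_hom[OF bal l.group_module_tensor])
      (simp only: cosets_to_proj_act l.tensor_act_pure cosets_to_proj_closed)
  show "cosets_to_proj_tensor N p A B k (c.pure e v) = l.pure (cosets_to_proj N p A B e) v"
    if "e \<in> carrier coset_funs" "form k v"
    unfolding cosets_to_proj_tensor_def using that by (intro c.tensor_lift(2)[OF bal]) simp_all
qed

section \<open>Functions on the projective line as forms\<close>

text \<open>
  An element of the group permutes the points.
\<close>

lemma sum_line_act:
  assumes y: "y \<in> carrier \<Gamma>"
  shows "(\<Sum>P\<in>proj_line. f (mat_proj y P)) = (\<Sum>P\<in>(proj_line :: ('F \<times> 'F) set set). f P)"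
proof (rule sum.reindex_bij_betw, rule bij_betwI)
  show "mat_proj y \<in> proj_line \<rightarrow> (proj_line :: ('F \<times> 'F) set set)"
    "mat_proj (adj2 y) \<in> proj_line \<rightarrow> (proj_line :: ('F \<times> 'F) set set)"
    using y by (auto intro: mat_proj_closed simp: Gamma1_det)
qed (use y in \<open>simp_all add: Gamma1_det adj2_inverse flip: mat_proj_mult\<close>)

lemma sum_line_act_inv:
  assumes y: "y \<in> carrier \<Gamma>"
  shows "(\<Sum>P\<in>proj_line. f (mat_proj (adj2 y) P)) = (\<Sum>P\<in>(proj_line :: ('F \<times> 'F) set set). f P)"
  by (rule sum_line_act) (rule adj2_Gamma1[OF y])

lemma proj_poly_form: "form (p - 1) (proj_poly p (f :: ('F \<times> 'F) set \<Rightarrow> 'F))"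
  unfolding proj_poly_def by (intro form_sum form_bconst_mult line_power_form)

lemma proj_poly_add: "proj_poly p (\<lambda>P\<in>proj_line. f P + g P :: 'F) = proj_poly p f + proj_poly p g"
  by (simp add: proj_poly_def bconst_add algebra_simps sum.distrib)

lemma proj_poly_scal: "proj_poly p (\<lambda>P\<in>proj_line. c * f P :: 'F) = bconst c * proj_poly p f"
  by (simp add: proj_poly_def bconst_mult sum_distrib_left mult.assoc)

lemma proj_poly_act:
  assumes y: "y \<in> carrier \<Gamma>"
  shows "proj_poly p (\<lambda>P\<in>proj_line. f (mat_proj (adj2 y) P) :: 'F) = mat_bact y (proj_poly p f)"
proof -
  have "proj_poly p (\<lambda>P\<in>proj_line. f (mat_proj (adj2 y) P) :: 'F) =
      (\<Sum>P\<in>proj_line. bconst (f (mat_proj (adj2 y) P)) * line_power p P)"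
    by (simp add: proj_poly_def)
  also have "\<dots> = (\<Sum>P\<in>proj_line. bconst (f (mat_proj (adj2 y) (mat_proj y P))) * line_power p (mat_proj y P))"
    by (rule sum_line_act[OF y, symmetric])
  also have "\<dots> = (\<Sum>P\<in>proj_line. bconst (f P) * mat_bact y (line_power p P))"
    using y by (intro sum.cong refl)
      (simp add: line_power_act adj2_inverse Gamma1_det flip: mat_proj_mult)
  also have "\<dots> = mat_bact y (proj_poly p f)"
    by (simp add: proj_poly_def mat_bact_sum mat_bact_mult)
  finally show ?thesis .
qed

text \<open>
  The constant functions are in the kernel, by the vanishing of the sum of all forms \<open>line_power\<close>.
\<close>

lemma proj_poly_zero_part: "proj_poly p (\<lambda>P\<in>proj_line. f P - c) = proj_poly p (f :: ('F \<times> 'F) set \<Rightarrow> 'F)"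
proof -
  have "proj_poly p (\<lambda>P\<in>proj_line. f P - c) =
      (\<Sum>P\<in>proj_line. bconst (f P) * line_power p P) - bconst c * (\<Sum>P\<in>proj_line. line_power p P)"
    by (simp add: proj_poly_def bconst_diff algebra_simps sum_subtractf sum_distrib_left)
  then show ?thesis by (simp add: sum_line_power proj_poly_def)
qed

text \<open>
  As there are \<open>p + 1\<close> points, the constant part of \<open>f\<close> is just the sum of its values.
\<close>

lemma split_fun_eq:
  "(case const_zero_split proj_line (f :: ('F \<times> 'F) set \<Rightarrow> 'F) of
      (c, h) \<Rightarrow> (bconst c * v, pure_tensor UNIV (V (p - 1)) (V k) (proj_poly p h) v)) =
    (bconst (sum f proj_line) * v, pure_tensor UNIV (V (p - 1)) (V k) (proj_poly p f) v)"
  by (simp only: const_zero_split_eq[OF sum_proj_line_const(1)] prod.case proj_poly_zero_part)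

lemma group_module_split_target:
  "group_module \<Gamma> (split k)"
  unfolding split_target_def
  by (rule group_module_dsum[OF group_module_V tensor_module.group_module_tensor[OF tensor_module_forms]])

lemma module_hom_proj_split:
  "gmodule_hom \<Gamma> (tensor prime_subfield line_funs (V k))
    (split k) (proj_split N p k)"
  and proj_split_pure:
  "\<lbrakk>f \<in> carrier line_funs; form k (v :: 'F bpoly)\<rbrakk> \<Longrightarrow>
    proj_split N p k (pure_tensor prime_subfield line_funs (V k) f v) =
      (bconst (sum f proj_line) * v, pure_tensor UNIV (V (p - 1)) (V k) (proj_poly p f) v)"
proof -
  interpret l: tensor_module \<Gamma> prime_subfield
    line_funs
    "V k" by (rule tensor_module_line)
  interpret v: tensor_module \<Gamma> UNIV "V (p - 1)"
    "V k" by (rule tensor_module_forms)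
  interpret t: group_module \<Gamma>
    "split k"
    by (rule group_module_split_target)
  interpret b: balanced_map UNIV "V (p - 1)"
    "V k" v.T v.pure by (rule v.pure_balanced)
  have mult: "(a, s) \<otimes>\<^bsub>split k\<^esub> (b, t) = (a + b, s \<otimes>\<^bsub>v.T\<^esub> t)" for a b :: "'F bpoly" and s t
    by (simp add: split_target_def dsum_def)
  have carr: "(a, s) \<in> carrier (split k) \<longleftrightarrow> form k a \<and> s \<in> carrier v.T" for a :: "'F bpoly" and s
    by (simp add: split_target_def dsum_def)
  have act: "gact (split k) y (a, s) = (mat_bact y a, gact (tensor UNIV (V (p - 1)) (V k)) y s)"
    for y and a :: "'F bpoly" and s
    by (simp add: split_target_def dsum_def)
  have bal: "balanced_map prime_subfield line_funs (V k) (split k)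
      (\<lambda>f v. case const_zero_split proj_line (f :: ('F \<times> 'F) set \<Rightarrow> 'F) of
          (c, h) \<Rightarrow> (bconst c * v, pure_tensor UNIV (V (p - 1)) (V k) (proj_poly p h) v))"
    unfolding split_fun_eq
  proof
    fix f :: "('F \<times> 'F) set \<Rightarrow> 'F" and v :: "'F bpoly" assume "v \<in> carrier (V k)"
    then show "(bconst (sum f proj_line) * v, v.pure (proj_poly p f) v) \<in> carrier (split k)"
      unfolding carr by (auto intro!: form_bconst_mult v.pure_closed proj_poly_form)
  next
    fix f f' :: "('F \<times> 'F) set \<Rightarrow> 'F" and v :: "'F bpoly" assume v: "v \<in> carrier (V k)"
    have "v.pure (proj_poly p f + proj_poly p f') v = v.pure (proj_poly p f) v \<otimes>\<^bsub>v.T\<^esub> v.pure (proj_poly p f') v"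
      using b.bal_left[of "proj_poly p f" "proj_poly p f'" v] v by (simp add: proj_poly_form)
    then show "(bconst (sum (f \<otimes>\<^bsub>line_funs\<^esub> f') proj_line) * v, v.pure (proj_poly p (f \<otimes>\<^bsub>line_funs\<^esub> f')) v) =
        (bconst (sum f proj_line) * v, v.pure (proj_poly p f) v) \<otimes>\<^bsub>split k\<^esub>
        (bconst (sum f' proj_line) * v, v.pure (proj_poly p f') v)"
      by (simp add: mult line_mult_eq proj_poly_add sum.distrib bconst_add algebra_simps)
  next
    fix f :: "('F \<times> 'F) set \<Rightarrow> 'F" and v v' :: "'F bpoly"
    assume v: "v \<in> carrier (V k)" "v' \<in> carrier (V k)"
    have "v.pure (proj_poly p f) (v + v') = v.pure (proj_poly p f) v \<otimes>\<^bsub>v.T\<^esub> v.pure (proj_poly p f) v'"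
      using b.bal_right[of "proj_poly p f" v v'] v by (simp add: proj_poly_form)
    then show "(bconst (sum f proj_line) * (v \<otimes>\<^bsub>V k\<^esub> v'), v.pure (proj_poly p f) (v \<otimes>\<^bsub>V k\<^esub> v')) =
        (bconst (sum f proj_line) * v, v.pure (proj_poly p f) v) \<otimes>\<^bsub>split k\<^esub>
        (bconst (sum f proj_line) * v', v.pure (proj_poly p f) v')"
      by (simp add: mult algebra_simps)
  next
    fix c :: 'F and f :: "('F \<times> 'F) set \<Rightarrow> 'F" and v :: "'F bpoly" assume v: "v \<in> carrier (V k)"
    have "v.pure (bconst c * proj_poly p f) v = v.pure (proj_poly p f) (bconst c * v)"
      using b.bal_scal[of c "proj_poly p f" v] v by (simp add: proj_poly_form)
    then show "(bconst (sum (scal line_funs c f) proj_line) * v, v.pure (proj_poly p (scal line_funs c f)) v) =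
        (bconst (sum f proj_line) * scal (V k) c v, v.pure (proj_poly p f) (scal (V k) c v))"
      by (simp add: line_scal proj_poly_scal bconst_mult algebra_simps flip: sum_distrib_left)
  qed
  show "gmodule_hom \<Gamma> (tensor prime_subfield line_funs (V k)) (split k) (proj_split N p k)"
    unfolding proj_split_def
  proof (rule l.tensor_lift_module_hom[OF bal group_module_split_target], unfold split_fun_eq)
    fix y and f :: "('F \<times> 'F) set \<Rightarrow> 'F" and v :: "'F bpoly"
    assume y: "y \<in> carrier \<Gamma>" and f: "f \<in> carrier line_funs" and v: "v \<in> carrier (V k)"
    show "(bconst (sum (gact line_funs y f) proj_line) * gact (V k) y v,
          v.pure (proj_poly p (gact line_funs y f)) (gact (V k) y v)) =
        gact (split k) y (bconst (sum f proj_line) * v, v.pure (proj_poly p f) v)"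
      using v.tensor_act_pure[of y "proj_poly p f" v] y v
      by (simp add: act line_act proj_poly_act proj_poly_form mat_bact_mult sum_line_act_inv)
  qed
  show "proj_split N p k (l.pure f v) =
      (bconst (sum f proj_line) * v, v.pure (proj_poly p f) v)"
    if "f \<in> carrier line_funs" "form k v"
    unfolding proj_split_def using l.tensor_lift(2)[OF bal, of f v] that by (simp add: split_fun_eq)
qed

lemma module_hom_snd:
  "gmodule_hom \<Gamma> (split k)
    (tensor UNIV (V (p - 1)) (V k)) snd"
proof -
  interpret t: group_module \<Gamma>
    "split k"
    by (rule group_module_split_target)
  interpret v: group_module \<Gamma> "tensor UNIV (V (p - 1)) (V k)"
    by (rule tensor_module.group_module_tensor[OF tensor_module_forms])
  show ?thesis
    by unfold_locales (auto simp: split_target_def dsum_def hom_def)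
qed

abbreviation multiply where
  "multiply k \<equiv> tensor_lift UNIV (V (p - 1)) (V k)
    (V (k + (p - 1))) (\<lambda>P Q. P * Q)"

lemma module_hom_multiply:
  "gmodule_hom \<Gamma> (tensor UNIV (V (p - 1)) (V k)) (V (k + (p - 1))) (multiply k)"
  and multiply_pure:
  "\<lbrakk>form (p - 1) P; form k Q\<rbrakk> \<Longrightarrow> multiply k (pure_tensor UNIV (V (p - 1)) (V k) P Q) = P * Q"
proof -
  interpret v: tensor_module \<Gamma> UNIV "V (p - 1)"
    "V k" by (rule tensor_module_forms)
  interpret m: comm_group "V (k + (p - 1))" by (rule comm_group_Vk)
  have form: "form (k + (p - 1)) (P * Q)" if "form (p - 1) P" "form k Q" for P Q :: "'F bpoly"
    using form_mult[OF that] by (simp add: add.commute)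
  have bal: "balanced_map UNIV (V (p - 1)) (V k) (V (k + (p - 1))) (\<lambda>P Q. P * Q)"
    by unfold_locales (simp_all add: form algebra_simps)
  show "gmodule_hom \<Gamma> (tensor UNIV (V (p - 1)) (V k)) (V (k + (p - 1))) (multiply k)"
    by (rule v.tensor_lift_module_hom[OF bal group_module_V]) (simp add: mat_bact_mult)
  show "\<lbrakk>form (p - 1) P; form k Q\<rbrakk> \<Longrightarrow> multiply k (v.pure P Q) = P * Q"
    by (rule v.tensor_lift(2)[OF bal]) simp_all
qed

section \<open>From the induced module to forms\<close>

lemma induced_module: "induced_module \<Gamma> (V k) \<Gamma>\<^sub>0"
  by (intro induced_module.intro group_module_V subgroup_Gamma10)

abbreviation ind :: "nat \<Rightarrow> ('F, imat, imat \<Rightarrow> 'F bpoly) gmodule" where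
  "ind k \<equiv> Ind \<Gamma> \<Gamma>\<^sub>0 (V k)"

definition coset_indicator :: "imat \<Rightarrow> imat set \<Rightarrow> 'F" where
  "coset_indicator x = (\<lambda>C\<in>cosets. if C = coset x then 1 else 0)"

lemma coset_indicator_closed: "coset_indicator x \<in> carrier coset_funs"
  by (simp add: coset_indicator_def cosets_carrier)

lemma coset_indicator_cong:
  "\<lbrakk>x \<in> carrier \<Gamma>; y \<in> carrier \<Gamma>; pt x = pt y\<rbrakk> \<Longrightarrow> coset_indicator x = coset_indicator y"
  using coset_eq_iff[of x y] by (simp add: coset_indicator_def)

lemma coset_indicator_act:
  assumes y: "y \<in> carrier \<Gamma>" and x: "x \<in> carrier \<Gamma>"
  shows "gact coset_funs y (coset_indicator x) = coset_indicator (y ** x)"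
proof -
  have "adj2 y <#\<^bsub>\<Gamma>\<^esub> C = coset x \<longleftrightarrow> C = coset (y ** x)" if C: "C \<in> cosets" for C
  proof
    assume "adj2 y <#\<^bsub>\<Gamma>\<^esub> C = coset x"
    then have "y <#\<^bsub>\<Gamma>\<^esub> (adj2 y <#\<^bsub>\<Gamma>\<^esub> C) = coset (y ** x)" using y x by (simp add: coset_mult)
    then show "C = coset (y ** x)"
      using y C by (simp add: adj2_Gamma1 adj2_inverse Gamma1_det l_coset_act(3) flip: l_coset_act(2))
  next
    assume "C = coset (y ** x)"
    then show "adj2 y <#\<^bsub>\<Gamma>\<^esub> C = coset x"
      using y x by (simp add: coset_mult adj2_Gamma1 Gamma1_closed matrix_mul_assoc adj2_inverse Gamma1_det)
  qed
  then show ?thesis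
    using y by (auto simp: cosets_act coset_indicator_def l_coset_act adj2_Gamma1 intro!: restrict_ext)
qed

lemma ind_to_tensor_eq:
  "ind_to_tensor N p A B k f = finprod (tensor prime_subfield coset_funs (V k))
    (\<lambda>i. pure_tensor prime_subfield coset_funs (V k) (coset_indicator (rep i))
      (mat_bact (rep i) (f (rep i) :: 'F bpoly))) I"
  by (simp add: ind_to_tensor_def coset_indicator_def transv_coset_def I_def cong: restrict_cong)

text \<open>
  The element \<open>y\<close> permutes the cosets.  If \<open>y x\<^sub>i = x\<^sub>j h\<close> with \<open>h\<close> in \<open>\<Gamma>\<^sub>0\<close>, then
  \<open>(y f)(x\<^sub>j) = f(x\<^sub>i h\<^sup>-\<^sup>1) = h f(x\<^sub>i)\<close>, so that \<open>y\<close> carries the \<open>i\<close>-th term for \<open>f\<close> to the \<open>j\<close>-th term for \<open>y f\<close>.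
\<close>

lemma gmodule_hom_ind_to_tensor:
  "gmodule_hom \<Gamma> (ind k) (tensor prime_subfield coset_funs (V k)) (ind_to_tensor N p A B k)"
proof -
  interpret i: induced_module \<Gamma> "V k" \<Gamma>\<^sub>0 by (rule induced_module)
  interpret c: tensor_module \<Gamma> prime_subfield coset_funs
    "V k" by (rule tensor_module_cosets)
  interpret b: balanced_map prime_subfield coset_funs
    "V k" c.T c.pure by (rule c.pure_balanced)
  interpret t: group_module \<Gamma> "tensor prime_subfield coset_funs
    (V k)" by (rule c.group_module_tensor)
  let ?T = "tensor prime_subfield coset_funs
    (V k)"
  let ?t = "\<lambda>f i. c.pure (coset_indicator (rep i)) (mat_bact (rep i) (f (rep i)))"
  have form: "form k (f x)" if "f \<in> carrier (ind k)" "x \<in> carrier \<Gamma>" for f x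
    using i.Ind_closed[OF that] by simp
  have closed: "?t f \<in> I \<rightarrow> carrier ?T" if "f \<in> carrier (ind k)" for f
    by (auto intro!: c.pure_closed coset_indicator_closed form_mat_bact form[OF that rep_closed])
  show ?thesis
  proof
    show "ind_to_tensor N p A B k \<in> hom (ind k) ?T"
    proof (rule homI)
      fix f assume f: "f \<in> carrier (ind k)"
      show "ind_to_tensor N p A B k f \<in> carrier ?T"
        unfolding ind_to_tensor_eq by (rule c.T'.finprod_closed[OF closed[OF f]])
    next
      fix f f' assume f: "f \<in> carrier (ind k)" and f': "f' \<in> carrier (ind k)"
      have "finprod ?T (?t (f \<otimes>\<^bsub>ind k\<^esub> f')) I = finprod ?T (\<lambda>i. ?t f i \<otimes>\<^bsub>?T\<^esub> ?t f' i) I"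
      proof (rule c.T'.finprod_cong'[OF refl])
        show "(\<lambda>i. ?t f i \<otimes>\<^bsub>?T\<^esub> ?t f' i) \<in> I \<rightarrow> carrier ?T"
          using closed[OF f] closed[OF f'] by (auto intro!: c.T'.m_closed)
        fix i
        show "?t (f \<otimes>\<^bsub>ind k\<^esub> f') i = ?t f i \<otimes>\<^bsub>?T\<^esub> ?t f' i"
          using b.bal_right[OF coset_indicator_closed, of "mat_bact (rep i) (f (rep i))" "mat_bact (rep i) (f' (rep i))" "rep i"]
            form[OF f rep_closed] form[OF f' rep_closed]
          by (simp add: i.Ind_mult rep_closed form_mat_bact mat_bact_add)
      qed
      then show "ind_to_tensor N p A B k (f \<otimes>\<^bsub>ind k\<^esub> f') =
          ind_to_tensor N p A B k f \<otimes>\<^bsub>?T\<^esub> ind_to_tensor N p A B k f'"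
        unfolding ind_to_tensor_eq by (simp only: c.T'.finprod_multf[OF closed[OF f] closed[OF f']])
    qed
  next
    fix y f assume y: "y \<in> carrier \<Gamma>" and f: "f \<in> carrier (ind k)"
    define \<pi> where "\<pi> i = idx (y ** rep i)" for i
    have yr: "y ** rep i \<in> carrier \<Gamma>" for i using y rep_closed by (rule Gamma1_closed)
    have pi_in: "\<pi> i \<in> I" for i by (simp add: \<pi>_def idx_in yr)
    have inj: "inj_on \<pi> I"
    proof (rule inj_onI)
      fix i j assume ij: "i \<in> I" "j \<in> I" "\<pi> i = \<pi> j"
      then have "pt (y ** rep i) = pt (y ** rep j)" using pt_idx[OF yr] by (simp add: \<pi>_def) (metis)
      then have "pt (adj2 y ** (y ** rep i)) = pt (adj2 y ** (y ** rep j))"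
        unfolding pt_mult[of "adj2 y"] by simp
      then show "i = j"
        using ij y by (simp add: matrix_mul_assoc adj2_inverse Gamma1_det pt_rep_inj)
    qed
    have image: "\<pi> ` I = I" by (rule endo_inj_surj[OF finite_I _ inj]) (use pi_in in auto)
    have "gact ?T y (ind_to_tensor N p A B k f) = finprod ?T (\<lambda>i. gact ?T y (?t f i)) I"
      unfolding ind_to_tensor_eq
      by (rule finprod_hom[OF c.T'.comm_group_axioms c.T'.comm_group_axioms
            group_hom.homh[OF t.act_group_hom[OF y]] closed[OF f]])
    also have "\<dots> = finprod ?T (\<lambda>i. ?t (gact (ind k) y f) (\<pi> i)) I"
    proof (rule c.T'.finprod_cong'[OF refl])
      show "(\<lambda>i. ?t (gact (ind k) y f) (\<pi> i)) \<in> I \<rightarrow> carrier ?T"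
        using closed[OF i.I.act_closed[OF y f]] pi_in by auto
    next
      fix i assume i: "i \<in> I"
      define h where "h = eta (y ** rep i)"
      have h: "h \<in> \<Gamma>\<^sub>0" by (simp add: h_def eta_in yr)
      then have hG: "h \<in> carrier \<Gamma>" by simp
      have decomp: "rep (\<pi> i) ** h = y ** rep i" by (simp add: \<pi>_def h_def rep_eta)
      have "adj2 y ** rep (\<pi> i) = rep i ** adj2 h"
      proof -
        have "rep i ** adj2 h = adj2 y ** (y ** rep i) ** adj2 h"
          using y by (simp add: matrix_mul_assoc adj2_inverse Gamma1_det)
        also have "\<dots> = adj2 y ** rep (\<pi> i) ** (h ** adj2 h)"
          by (simp only: matrix_mul_assoc flip: decomp)
        finally show ?thesis using hG by (simp add: adj2_inverse Gamma1_det)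
      qed
      then have "gact (ind k) y f (rep (\<pi> i)) = mat_bact h (f (rep i))"
        using i.Ind_mult_right[OF f rep_closed, of "adj2 h" i] h hG y
          subgroup.m_inv_closed[OF subgroup_Gamma10 h]
        by (simp add: i.Ind_act rep_closed Gamma1_inv adj2_Gamma1)
      then have "mat_bact (rep (\<pi> i)) (gact (ind k) y f (rep (\<pi> i))) = mat_bact y (mat_bact (rep i) (f (rep i)))"
        by (simp flip: mat_bact_matmul add: decomp)
      moreover have "coset_indicator (rep (\<pi> i)) = coset_indicator (y ** rep i)"
        by (intro coset_indicator_cong rep_closed yr) (simp add: \<pi>_def pt_idx yr)
      moreover have "gact ?T y (?t f i) = c.pure (coset_indicator (y ** rep i)) (mat_bact y (mat_bact (rep i) (f (rep i))))"
        using c.tensor_act_pure[OF y coset_indicator_closed, of "mat_bact (rep i) (f (rep i))" "rep i"]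
          form[OF f rep_closed] y
        by (simp add: form_mat_bact coset_indicator_act rep_closed)
      ultimately show "gact ?T y (?t f i) = ?t (gact (ind k) y f) (\<pi> i)" by simp
    qed
    also have "\<dots> = finprod ?T (?t (gact (ind k) y f)) I"
      using c.T'.finprod_reindex[of "?t (gact (ind k) y f)" \<pi> I] inj closed[OF i.I.act_closed[OF y f]]
      by (simp only: image)
    finally show "ind_to_tensor N p A B k (gact (ind k) y f) = gact ?T y (ind_to_tensor N p A B k f)"
      by (simp add: ind_to_tensor_eq)
  qed
qed

lemma proj_poly_indicator:
  assumes x: "x \<in> carrier \<Gamma>"
  shows "proj_poly p (cosets_to_proj N p A B (coset_indicator x)) = line_power p (pt x)"
proof -
  have "cosets_to_proj N p A B (coset_indicator x) P = (if P = pt x then 1 else 0)"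
    if P: "P \<in> proj_line" for P
  proof -
    obtain t where "t \<in> carrier \<Gamma>" "P = pt t" using line_cases[OF P] by blast
    then show ?thesis using x by (simp add: cosets_to_proj_pt coset_indicator_def coset_eq_iff)
  qed
  then have "proj_poly p (cosets_to_proj N p A B (coset_indicator x)) =
      (\<Sum>P\<in>proj_line. if P = pt x then line_power p P else 0)"
    unfolding proj_poly_def by (intro sum.cong refl) simp
  then show ?thesis
    using x by (simp add: finite_proj_line)
qed

definition ind_to_forms :: "nat \<Rightarrow> (imat \<Rightarrow> 'F bpoly) \<Rightarrow> 'F bpoly" where
  "ind_to_forms k = multiply k \<circ> (snd \<circ> (proj_split N p k \<circ>
    (cosets_to_proj_tensor N p A B k \<circ> ind_to_tensor N p A B k)))"

lemma gmodule_hom_chain: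
  "gmodule_hom \<Gamma> (ind k) (tensor prime_subfield line_funs (V k))
    (cosets_to_proj_tensor N p A B k \<circ> ind_to_tensor N p A B k)"
  "gmodule_hom \<Gamma> (ind k) (split k)
    (proj_split N p k \<circ> (cosets_to_proj_tensor N p A B k \<circ> ind_to_tensor N p A B k))"
  "gmodule_hom \<Gamma> (ind k) (tensor UNIV (V (p - 1)) (V k))
    (snd \<circ> (proj_split N p k \<circ> (cosets_to_proj_tensor N p A B k \<circ> ind_to_tensor N p A B k)))"
proof -
  show 1: "gmodule_hom \<Gamma> (ind k) (tensor prime_subfield line_funs (V k))
    (cosets_to_proj_tensor N p A B k \<circ> ind_to_tensor N p A B k)"
    by (rule gmodule_hom_comp[OF gmodule_hom_ind_to_tensor module_hom_cosets_to_proj_tensor])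
  show 2: "gmodule_hom \<Gamma> (ind k) (split k)
    (proj_split N p k \<circ> (cosets_to_proj_tensor N p A B k \<circ> ind_to_tensor N p A B k))"
    by (rule gmodule_hom_comp[OF 1 module_hom_proj_split])
  show "gmodule_hom \<Gamma> (ind k) (tensor UNIV (V (p - 1)) (V k))
    (snd \<circ> (proj_split N p k \<circ> (cosets_to_proj_tensor N p A B k \<circ> ind_to_tensor N p A B k)))"
    by (rule gmodule_hom_comp[OF 2 module_hom_snd])
qed

lemma gmodule_hom_ind_to_forms: "gmodule_hom \<Gamma> (ind k) (V (k + (p - 1))) (ind_to_forms k)"
  unfolding ind_to_forms_def by (rule gmodule_hom_comp[OF gmodule_hom_chain(3) module_hom_multiply])

text \<open>
  The indicator function of the coset of \<open>x\<^sub>i\<close> ends up as the form \<open>x\<^sub>i X\<^sup>p\<^sup>-\<^sup>1\<close>.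
\<close>

lemma ind_to_forms_eq:
  assumes f: "f \<in> carrier (ind k)"
  shows "ind_to_forms k f = (\<Sum>i\<in>I. mat_bact (rep i) (bX ^ (p - 1) * f (rep i)))"
proof -
  interpret i: induced_module \<Gamma> "V k" \<Gamma>\<^sub>0 by (rule induced_module)
  interpret c: tensor_module \<Gamma> prime_subfield coset_funs
    "V k" by (rule tensor_module_cosets)
  define \<theta> where "\<theta> = multiply k \<circ> (snd \<circ> (proj_split N p k \<circ> cosets_to_proj_tensor N p A B k))"
  interpret t: gmodule_hom \<Gamma> "tensor prime_subfield coset_funs (V k)" "V (k + (p - 1))" \<theta>
    unfolding \<theta>_def
    by (rule gmodule_hom_comp[OF gmodule_hom_comp[OF gmodule_hom_comp[OF
          module_hom_cosets_to_proj_tensor module_hom_proj_split] module_hom_snd] module_hom_multiply])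
  have form: "form k (mat_bact (rep i) (f (rep i)))" for i
    using i.Ind_closed[OF f rep_closed] by (simp add: form_mat_bact)
  have pure: "\<theta> (c.pure (coset_indicator (rep i)) (mat_bact (rep i) (f (rep i)))) =
      mat_bact (rep i) (bX ^ (p - 1) * f (rep i))" for i
  proof -
    have "\<theta> (c.pure (coset_indicator (rep i)) (mat_bact (rep i) (f (rep i)))) =
        proj_poly p (cosets_to_proj N p A B (coset_indicator (rep i))) * mat_bact (rep i) (f (rep i))"
      unfolding \<theta>_def comp_apply
        cosets_to_proj_tensor_pure[OF coset_indicator_closed form]
        proj_split_pure[OF cosets_to_proj_closed[OF coset_indicator_closed] form] snd_conv
      by (rule multiply_pure[OF proj_poly_form form])
    then show ?thesis
      by (simp only: proj_poly_indicator[OF rep_closed] line_power_rep mat_bact_mult)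
  qed
  have "ind_to_forms k f = \<theta> (ind_to_tensor N p A B k f)"
    by (simp add: ind_to_forms_def \<theta>_def)
  also have "\<dots> = finprod (V (k + (p - 1))) (\<lambda>i. \<theta> (c.pure (coset_indicator (rep i)) (mat_bact (rep i) (f (rep i))))) I"
    unfolding ind_to_tensor_eq
    by (rule finprod_hom[OF c.T'.comm_group_axioms comm_group_Vk t.hom])
      (use form in \<open>auto intro!: c.pure_closed coset_indicator_closed\<close>)
  also have "\<dots> = (\<Sum>i\<in>I. mat_bact (rep i) (bX ^ (p - 1) * f (rep i)))"
    unfolding pure
  proof (rule Vk_finprod)
    fix i
    have "form (p - 1 + k) (bX ^ (p - 1) * f (rep i))"
      using i.Ind_closed[OF f rep_closed] by (intro form_mult form_bX_power) simp
    then show "form (k + (p - 1)) (mat_bact (rep i) (bX ^ (p - 1) * f (rep i)))"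
      by (simp add: form_mat_bact add.commute)
  qed
  finally show ?thesis .
qed

section \<open>Conjugation by \<open>g\<close>\<close>

lemma det_gmat: "det (gmat p) \<noteq> 0"
  using p_gt_1 by (simp add: gmat_def det_2)

lemma gconj_eqI: "y ** gmat p = gmat p ** x \<Longrightarrow> gconj p x = y"
  unfolding gconj_def using imat_right_cancel[OF _ det_gmat] by (intro the_equality) auto

lemma gconj_eq:
  assumes "int p dvd x$2$1"
  shows "gconj p x = mat2 (x$1$1) (int p * x$1$2) (x$2$1 div int p) (x$2$2)"
  using assms by (intro gconj_eqI) (simp add: imat_eq_iff matmul_nth gmat_def)

lemma gconj_gmat: "int p dvd x$2$1 \<Longrightarrow> gconj p x ** gmat p = gmat p ** x"
  by (simp add: gconj_eq imat_eq_iff matmul_nth gmat_def)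

lemma gconj_mult:
  assumes "int p dvd x$2$1" "int p dvd y$2$1"
  shows "gconj p (x ** y) = gconj p x ** gconj p y"
  using gconj_gmat[OF assms(1)] gconj_gmat[OF assms(2)]
  by (intro gconj_eqI) (metis matrix_mul_assoc)

text \<open>
  This is \<open>g\<^sup>* (g x g\<^sup>-\<^sup>1) = x g\<^sup>*\<close>, both \<open>g g\<^sup>*\<close> and \<open>g\<^sup>* g\<close> being the scalar \<open>p\<close>.
\<close>

lemma gstar_gconj:
  assumes "int p dvd x$2$1"
  shows "mat_bact (gstar p) (mat_bact (gconj p x) P) = mat_bact x (mat_bact (gstar p) P)"
proof -
  have "gstar p ** gconj p x = x ** gstar p"
    using assms by (simp add: gconj_eq imat_eq_iff matmul_nth gstar_def)
  then show ?thesis by (metis mat_bact_matmul)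
qed

lemma dvd_cancel_p:
  assumes "N dvd int p * q"
  shows "N dvd q"
proof -
  have "q = q * (A * N + B * int p)" using bezout by simp
  also have "\<dots> = N * (A * q) + B * (int p * q)" by (simp add: algebra_simps)
  finally show ?thesis using assms by (metis dvd_add dvd_mult dvd_triv_left)
qed

lemma gconj_Hecke_set:
  assumes x: "x \<in> Hecke_set N r" and p: "int p dvd x$2$1"
  shows "gconj p x \<in> Hecke_set N r"
proof -
  have "N dvd x$2$1 div int p"
    using x p by - (rule dvd_cancel_p, simp add: Hecke_set_def cong_0_iff)
  moreover have "det (gconj p x) = det x"
  proof -
    have "x$1$2 * x$2$1 = x$1$2 * (int p * (x$2$1 div int p))" using p by simp
    then show ?thesis unfolding gconj_eq[OF p] by (simp only: det_2 mat2_nth mult_ac)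
  qed
  ultimately show ?thesis
    using x by (simp add: Hecke_set_def gconj_eq[OF p] cong_0_iff)
qed

lemma gconj_Gamma1: "x \<in> \<Gamma>\<^sub>0 \<Longrightarrow> gconj p x \<in> carrier \<Gamma>"
  using gconj_Hecke_set[of x 1] by (simp add: Gamma10_iff carrier_Gamma1)

text \<open>
  Modulo \<open>p\<close> the matrix sends \<open>X\<close> to a nonzero multiple of \<open>X\<close>, with a factor in the prime field.
\<close>

lemma bX_power_act:
  assumes "int p dvd e$2$1" "\<not> int p dvd e$1$1"
  shows "mat_bact e (bX ^ (p - 1) * P) = bX ^ (p - 1) * mat_bact e (P :: 'F bpoly)"
proof -
  have "of_int (e$2$1) = (0::'F)" "of_int (e$1$1) \<noteq> (0::'F)"
    using assms by (simp_all add: of_int_eq_0)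
  moreover from this have "of_int (e$1$1) ^ (p - 1) = (1::'F)"
    by (intro fermat_prime_subfield prime_subfield_of_int)
  ultimately show ?thesis
    by (simp add: mat_bact_mult mat_bact_power mat_bact_bX power_mult_distrib flip: bconst_power)
qed

lemma not_dvd_diag:
  fixes e :: imat
  assumes "int p dvd e$2$1" "det e = d" "\<not> int p dvd d"
  shows "\<not> int p dvd e$1$1" "\<not> int p dvd e$2$2"
  using assms by (auto simp: det_2)

lemma Gamma10_bX_power_act:
  assumes "x \<in> \<Gamma>\<^sub>0"
  shows "mat_bact x (bX ^ (p - 1) * P) = bX ^ (p - 1) * mat_bact x (P :: 'F bpoly)"
proof (rule bX_power_act)
  show *: "int p dvd x$2$1" using assms by (simp add: Gamma10_iff)
  show "\<not> int p dvd x$1$1"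
    by (rule not_dvd_diag(1)[OF * Gamma1_det[OF \<Gamma>\<^sub>0.mem_carrier[OF assms]] not_p_dvd_1])
qed

section \<open>The map on cocycles\<close>

definition restrict_conj :: "(imat \<Rightarrow> 'F bpoly) \<Rightarrow> imat \<Rightarrow> 'F bpoly" where
  "restrict_conj z = (\<lambda>x\<in>\<Gamma>\<^sub>0. mat_bact (gstar p) (z (gconj p x)))"

text \<open>
  The twist by \<open>g\<^sup>*\<close> turns the action of \<open>g x g\<^sup>-\<^sup>1\<close> into that of \<open>x\<close> (\<open>gstar_gconj\<close>).
\<close>

lemma restrict_conj_cochain_map:
  "cochain_map \<Gamma> (V k) (subgrp \<Gamma> \<Gamma>\<^sub>0) (V k) restrict_conj"
proof -
  interpret v: group_module \<Gamma> "V k" by (rule group_module_V)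
  interpret h: group_module "subgrp \<Gamma> \<Gamma>\<^sub>0" "V k"
    by (rule v.group_module_subgroup[OF subgroup_Gamma10])
  have p_dvd: "int p dvd x$2$1" if "x \<in> \<Gamma>\<^sub>0" for x using that by (simp add: Gamma10_iff)
  have mult: "x ** y \<in> \<Gamma>\<^sub>0" if "x \<in> \<Gamma>\<^sub>0" "y \<in> \<Gamma>\<^sub>0" for x y
    using \<Gamma>\<^sub>0.m_closed[OF that] by simp
  show ?thesis
  proof
    show "restrict_conj \<in> hom (Z1 \<Gamma> (V k)) (Z1 (subgrp \<Gamma> \<Gamma>\<^sub>0) (V k))"
    proof (rule homI)
      fix z :: "imat \<Rightarrow> 'F bpoly" assume "z \<in> carrier (Z1 \<Gamma> (V k))"
      then have z: "z \<in> cocycles \<Gamma> (V k)" by simp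
      have "restrict_conj z (x ** y) = restrict_conj z x + mat_bact x (restrict_conj z y)"
        if x: "x \<in> \<Gamma>\<^sub>0" and y: "y \<in> \<Gamma>\<^sub>0" for x y
        using v.cocycle_mult[OF z gconj_Gamma1[OF x] gconj_Gamma1[OF y]] x y p_dvd
        by (simp add: restrict_conj_def mult gconj_mult mat_bact_add gstar_gconj)
      then show "restrict_conj z \<in> carrier (Z1 (subgrp \<Gamma> \<Gamma>\<^sub>0) (V k))"
        using v.cocycle_closed[OF z gconj_Gamma1]
        by (simp add: cocycles_def) (simp add: restrict_conj_def form_mat_bact)
    next
      fix z w :: "imat \<Rightarrow> 'F bpoly"
      show "restrict_conj (z \<otimes>\<^bsub>Z1 \<Gamma> (V k)\<^esub> w) =
          restrict_conj z \<otimes>\<^bsub>Z1 (subgrp \<Gamma> \<Gamma>\<^sub>0) (V k)\<^esub> restrict_conj w"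
        by (auto simp: Z1_def restrict_conj_def gconj_Gamma1 mat_bact_add intro!: restrict_ext)
    qed
  next
    fix b :: "imat \<Rightarrow> 'F bpoly" assume "b \<in> coboundaries \<Gamma> (V k)"
    then obtain m where m: "m \<in> carrier (V k)"
        "b = (\<lambda>x\<in>carrier \<Gamma>. gact (V k) x m \<otimes>\<^bsub>V k\<^esub> inv\<^bsub>V k\<^esub> m)"
      unfolding coboundaries_def by (elim imageE)
    have "restrict_conj b = (\<lambda>x\<in>\<Gamma>\<^sub>0. mat_bact x (mat_bact (gstar p) m) - mat_bact (gstar p) m)"
      unfolding restrict_conj_def
    proof (rule restrict_ext)
      fix x assume x: "x \<in> \<Gamma>\<^sub>0"
      then show "mat_bact (gstar p) (b (gconj p x)) = mat_bact x (mat_bact (gstar p) m) - mat_bact (gstar p) m"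
        using m(1) p_dvd[OF x]
        by (simp add: m(2) gconj_Gamma1 Vk_inv mat_bact_diff gstar_gconj)
    qed
    then show "restrict_conj b \<in> coboundaries (subgrp \<Gamma> \<Gamma>\<^sub>0) (V k)"
      unfolding coboundaries_def using m(1)
      by (intro image_eqI[of _ _ "mat_bact (gstar p) m"])
        (auto simp: Vk_inv form_mat_bact intro!: restrict_ext)
  qed
qed

lemma beta1_class:
  assumes "z \<in> cocycles \<Gamma> (V k)"
  shows "beta1 N p k (H1_class \<Gamma> (V k) z) =
    H1_class (subgrp \<Gamma> \<Gamma>\<^sub>0) (V k) (restrict_conj z)"
  using cochain_map.H1_map_class[OF restrict_conj_cochain_map assms]
  by (simp add: beta1_def restrict_conj_def [abs_def])

text \<open>
  On constant forms the twist by \<open>g\<^sup>*\<close> is the identity.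
\<close>

lemma EK_restrict_class:
  assumes z: "z \<in> cocycles \<Gamma> (V 0)"
  shows "EK_restrict N p (H1_class \<Gamma> (V 0) z) =
    H1_class (subgrp \<Gamma> \<Gamma>\<^sub>0) (V 0) (restrict_conj z)"
proof -
  interpret v: group_module \<Gamma> "V 0" by (rule group_module_V)
  have "(\<lambda>x\<in>\<Gamma>\<^sub>0. w (gconj p x)) = (\<lambda>x\<in>\<Gamma>\<^sub>0. mat_bact (gstar p) (w (gconj p x)))"
    if "w \<in> H1_class \<Gamma> (V 0) z" for w
    using v.cocycle_closed[OF v.H1_class_memD(1)[OF z that] gconj_Gamma1]
    by (intro restrict_ext) (simp add: mat_bact_form_0)
  then have "EK_restrict N p (H1_class \<Gamma> (V 0) z) =
      beta1 N p 0 (H1_class \<Gamma> (V 0) z)"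
    unfolding EK_restrict_def beta1_def H1_map_def by (intro SUP_cong refl) simp
  then show ?thesis by (simp add: beta1_class[OF z])
qed

text \<open>
  For \<open>x\<close> in the group and \<open>j = alpha_perm i x\<close>, the coset of \<open>x x\<^sub>j\<close> is that of \<open>x\<^sub>i\<close>, and
  \<open>alpha_diff i x\<close> is the element \<open>x\<^sub>i\<^sup>-\<^sup>1 x x\<^sub>j\<close> of \<open>\<Gamma>\<^sub>0\<close>.
\<close>

definition alpha_perm :: "nat \<Rightarrow> imat \<Rightarrow> nat" where
  "alpha_perm i x = idx (adj2 x ** rep i)"

definition alpha_diff :: "nat \<Rightarrow> imat \<Rightarrow> imat" where
  "alpha_diff i x = adj2 (rep i) ** x ** rep (alpha_perm i x)"

definition alpha_fact :: "nat \<Rightarrow> imat \<Rightarrow> imat" where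
  "alpha_fact i x = gconj p (alpha_diff i x)"

definition alpha_weight :: "nat \<Rightarrow> 'F bpoly \<Rightarrow> 'F bpoly" where
  "alpha_weight i v = mat_bact (rep i) (bX ^ (p - 1) * mat_bact (gstar p) v)"

lemma pt_alpha_perm: "x \<in> carrier \<Gamma> \<Longrightarrow> pt (rep (alpha_perm i x)) = mat_proj (adj2 x) (pt (rep i))"
  by (simp add: alpha_perm_def pt_idx Gamma1_closed adj2_Gamma1 rep_closed pt_mult)

lemma alpha_perm_in: "x \<in> carrier \<Gamma> \<Longrightarrow> alpha_perm i x \<in> I"
  by (simp add: alpha_perm_def idx_in Gamma1_closed adj2_Gamma1 rep_closed)

lemma rep_alpha_diff: "rep i ** alpha_diff i x = x ** rep (alpha_perm i x)"
  by (simp add: alpha_diff_def matrix_mul_assoc adj2_inverse)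

lemma alpha_diff_in:
  assumes x: "x \<in> carrier \<Gamma>"
  shows "alpha_diff i x \<in> \<Gamma>\<^sub>0"
proof -
  have "pt (x ** rep (alpha_perm i x)) = mat_proj (x ** adj2 x) (pt (rep i))"
    by (simp add: pt_mult pt_alpha_perm x mat_proj_mult)
  then have "pt (rep i) = pt (x ** rep (alpha_perm i x))"
    using x by (simp add: adj2_inverse Gamma1_det)
  then show ?thesis
    using x pt_eq_iff[OF rep_closed, of "x ** rep (alpha_perm i x)" i]
    by (simp add: alpha_diff_def Gamma1_closed rep_closed matrix_mul_assoc)
qed

lemma alpha_perm_mult:
  assumes "x \<in> carrier \<Gamma>" "y \<in> carrier \<Gamma>"
  shows "alpha_perm i (x ** y) = alpha_perm (alpha_perm i x) y"
proof -
  have "pt (adj2 (x ** y) ** rep i) = pt (adj2 y ** rep (alpha_perm i x))"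
    by (simp add: adj2_matmul pt_mult mat_proj_mult pt_alpha_perm assms)
  then show ?thesis unfolding alpha_perm_def[of i "x ** y"] alpha_perm_def[of "alpha_perm i x"]
    by (rule idx_cong)
qed

lemma alpha_diff_mult:
  assumes "x \<in> carrier \<Gamma>" "y \<in> carrier \<Gamma>"
  shows "alpha_diff i (x ** y) = alpha_diff i x ** alpha_diff (alpha_perm i x) y"
proof -
  let ?j = "alpha_perm i x"
  have "alpha_diff i x ** alpha_diff ?j y =
      adj2 (rep i) ** x ** (rep ?j ** adj2 (rep ?j)) ** y ** rep (alpha_perm ?j y)"
    by (simp only: alpha_diff_def matrix_mul_assoc)
  then show ?thesis
    by (simp add: adj2_inverse alpha_diff_def alpha_perm_mult assms matrix_mul_assoc)
qed

lemma form_alpha_weight: "form k v \<Longrightarrow> form (k + (p - 1)) (alpha_weight i v)"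
  using form_mult[OF form_bX_power form_mat_bact, of k v "p - 1" "gstar p"]
  by (simp add: alpha_weight_def form_mat_bact add.commute)

text \<open>
  The weights are compatible with the action because the elements of \<open>\<Gamma>\<^sub>0\<close> commute with the
  multiplication by \<open>X\<^sup>p\<^sup>-\<^sup>1\<close>.
\<close>

lemma alpha_datum:
  "hecke_datum \<Gamma> (V k) (V (k + (p - 1)))
    I alpha_perm alpha_fact alpha_weight"
proof -
  interpret v: group_module \<Gamma> "V k" by (rule group_module_V)
  interpret w: group_module \<Gamma> "V (k + (p - 1))" by (rule group_module_V)
  show ?thesis
  proof
    fix i x y assume x: "x \<in> carrier \<Gamma>" and y: "y \<in> carrier \<Gamma>"
    show "alpha_perm i (x \<otimes>\<^bsub>\<Gamma>\<^esub> y) = alpha_perm (alpha_perm i x) y"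
      using alpha_perm_mult[OF x y] by simp
    show "alpha_fact i (x \<otimes>\<^bsub>\<Gamma>\<^esub> y) = alpha_fact i x \<otimes>\<^bsub>\<Gamma>\<^esub> alpha_fact (alpha_perm i x) y"
      using alpha_diff_in[OF x, of i] alpha_diff_in[OF y, of "alpha_perm i x"]
      by (simp add: alpha_fact_def alpha_diff_mult[OF x y] gconj_mult Gamma10_iff)
  next
    fix i x and m :: "'F bpoly" assume x: "x \<in> carrier \<Gamma>"
    have "alpha_weight i (mat_bact (alpha_fact i x) m) =
        mat_bact (rep i) (mat_bact (alpha_diff i x) (bX ^ (p - 1) * mat_bact (gstar p) m))"
      using alpha_diff_in[OF x, of i]
      by (simp add: alpha_weight_def alpha_fact_def gstar_gconj Gamma10_iff flip: Gamma10_bX_power_act)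
    also have "\<dots> = mat_bact x (alpha_weight (alpha_perm i x) m)"
      by (simp only: alpha_weight_def rep_alpha_diff flip: mat_bact_matmul)
    finally show "alpha_weight i (gact (V k) (alpha_fact i x) m) =
        gact (V (k + (p - 1))) x (alpha_weight (alpha_perm i x) m)" by simp
  next
    fix i assume "i \<in> I"
    then show "alpha_perm i \<one>\<^bsub>\<Gamma>\<^esub> = i" by (simp add: alpha_perm_def idx_rep)
  next
    fix i
    show "alpha_weight i \<in> hom (V k) (V (k + (p - 1)))"
      by (rule homI) (simp_all add: form_alpha_weight, simp add: alpha_weight_def mat_bact_add algebra_simps)
  qed (simp_all add: alpha_perm_in alpha_fact_def gconj_Gamma1 alpha_diff_in)
qed

definition alpha_op :: "nat \<Rightarrow> (imat \<Rightarrow> 'F bpoly) \<Rightarrow> imat \<Rightarrow> 'F bpoly" where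
  "alpha_op k = hecke_datum.operator \<Gamma> (V (k + (p - 1)))
    I alpha_fact alpha_weight"

lemma alpha_op_eq:
  assumes z: "z \<in> cocycles \<Gamma> (V k)"
  shows "alpha_op k z = (\<lambda>x\<in>carrier \<Gamma>. \<Sum>i\<in>I. alpha_weight i (z (alpha_fact i x)))"
proof -
  interpret d: hecke_datum \<Gamma> "V k"
    "V (k + (p - 1))" I alpha_perm alpha_fact alpha_weight
    by (rule alpha_datum)
  show ?thesis
    unfolding alpha_op_def d.operator_def
  proof (rule restrict_ext, rule Vk_finprod)
    fix x i assume "x \<in> carrier \<Gamma>" "i \<in> I"
    then show "form (k + (p - 1)) (alpha_weight i (z (alpha_fact i x)))"
      using d.A.cocycle_closed[OF z] d.fact_closed by (intro form_alpha_weight) simp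
  qed
qed

text \<open>
  The cocycle of \<open>shapiro_class\<close> for the given transversal.  Its value at \<open>x\<^sub>i\<close> is particularly simple,
  because \<open>eta\<close> is trivial there.
\<close>

definition shapiro_cocycle :: "(imat \<Rightarrow> 'F bpoly) \<Rightarrow> imat \<Rightarrow> imat \<Rightarrow> 'F bpoly" where
  "shapiro_cocycle w = (\<lambda>x\<in>carrier \<Gamma>. \<lambda>t\<in>carrier \<Gamma>.
    w (adj2 (eta (adj2 x ** t))) - w (adj2 (eta t)))"

lemma shapiro_class_eta:
  assumes w: "w \<in> cocycles (subgrp \<Gamma> \<Gamma>\<^sub>0) (V k)"
  shows "shapiro_cocycle w \<in> cocycles \<Gamma> (ind k)"
    and "shapiro \<Gamma> \<Gamma>\<^sub>0 (V k) (H1_class (subgrp \<Gamma> \<Gamma>\<^sub>0) (V k) w) =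
      H1_class \<Gamma> (ind k) (shapiro_cocycle w)"
proof -
  interpret i: induced_module \<Gamma> "V k" \<Gamma>\<^sub>0 by (rule induced_module)
  have eta_G: "eta x \<in> carrier \<Gamma>" if "x \<in> carrier \<Gamma>" for x using eta_in[OF that] by simp
  have adj_eta: "adj2 (eta x) \<in> \<Gamma>\<^sub>0" if "x \<in> carrier \<Gamma>" for x
    using \<Gamma>\<^sub>0.m_inv_closed[OF eta_in[OF that]] eta_G[OF that] by (simp add: Gamma1_inv)
  have "shapiro_cocycle w = (\<lambda>x\<in>carrier \<Gamma>. \<lambda>t\<in>carrier \<Gamma>.
    w (inv\<^bsub>\<Gamma>\<^esub> (eta (inv\<^bsub>\<Gamma>\<^esub> x \<otimes>\<^bsub>\<Gamma>\<^esub> t))) \<otimes>\<^bsub>V k\<^esub> inv\<^bsub>V k\<^esub> (w (inv\<^bsub>\<Gamma>\<^esub> (eta t))))"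
    unfolding shapiro_cocycle_def
    using i.S.cocycle_closed[OF w] adj_eta
    by (intro restrict_ext) (simp add: Gamma1_inv eta_G adj2_Gamma1 Gamma1_closed Vk_inv)
  then show "shapiro_cocycle w \<in> cocycles \<Gamma> (ind k)"
    "shapiro \<Gamma> \<Gamma>\<^sub>0 (V k) (H1_class (subgrp \<Gamma> \<Gamma>\<^sub>0) (V k) w) =
      H1_class \<Gamma> (ind k) (shapiro_cocycle w)"
    using i.shapiro_class[OF w, of eta] by (simp_all add: eta_in eta_1 eta_mult)
qed

lemma shapiro_cocycle_rep:
  assumes w: "w \<in> cocycles (subgrp \<Gamma> \<Gamma>\<^sub>0) (V k)"
    and x: "x \<in> carrier \<Gamma>" and i: "i \<in> I"
  shows "shapiro_cocycle w x (rep i) = w (alpha_diff i x)"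
proof -
  interpret v: group_module "subgrp \<Gamma> \<Gamma>\<^sub>0" "V k"
    by (rule group_module.group_module_subgroup[OF group_module_V subgroup_Gamma10])
  have "adj2 (eta (adj2 x ** rep i)) = alpha_diff i x"
    by (simp add: eta_def alpha_diff_def alpha_perm_def adj2_matmul matrix_mul_assoc)
  then show ?thesis
    using v.cocycle_one[OF w] x i by (simp add: shapiro_cocycle_def rep_closed eta_rep)
qed

text \<open>
  All coefficient maps are combined into \<open>ind_to_forms\<close> before they are applied to the explicit
  preimage under Shapiro's isomorphism.
\<close>

lemma alpha_class:
  assumes z: "z \<in> cocycles \<Gamma> (V k)"
  shows "alpha N p A B k (H1_class \<Gamma> (V k) z) =
    H1_class \<Gamma> (V (k + (p - 1))) (alpha_op k z)"
proof -
  let ?w = "restrict_conj z"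
  interpret f: gmodule_hom \<Gamma> "ind k" "V (k + (p - 1))" "ind_to_forms k"
    by (rule gmodule_hom_ind_to_forms)
  have w: "?w \<in> cocycles (subgrp \<Gamma> \<Gamma>\<^sub>0) (V k)"
    by (rule cochain_map.map_cocycle[OF restrict_conj_cochain_map z])
  note W = shapiro_class_eta[OF w]
  let ?y = "H1_class \<Gamma> (ind k) (shapiro_cocycle ?w)"
  have y: "?y \<in> carrier (H1 \<Gamma> (ind k))" by (rule f.A.H1_classI[OF W(1)])
  have "alpha N p A B k (H1_class \<Gamma> (V k) z) =
      H1_coeff \<Gamma> (V (k + (p - 1))) (ind_to_forms k) ?y"
    unfolding alpha_def beta_def Let_def snd_conv beta2_def beta1_class[OF z] W(2)
      H1_coeff_comp[OF gmodule_hom_ind_to_tensor module_hom_cosets_to_proj_tensor y]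
      H1_coeff_comp[OF gmodule_hom_chain(1) module_hom_proj_split y]
      H1_coeff_comp[OF gmodule_hom_chain(2) module_hom_snd y]
      H1_coeff_comp[OF gmodule_hom_chain(3) module_hom_multiply y]
      ind_to_forms_def ..
  also have "\<dots> = H1_class \<Gamma> (V (k + (p - 1))) (\<lambda>x\<in>carrier \<Gamma>. ind_to_forms k (shapiro_cocycle ?w x))"
    by (rule f.H1_coeff_class[OF W(1)])
  also have "(\<lambda>x\<in>carrier \<Gamma>. ind_to_forms k (shapiro_cocycle ?w x)) = alpha_op k z"
    unfolding alpha_op_eq[OF z]
  proof (rule restrict_ext)
    fix x assume x: "x \<in> carrier \<Gamma>"
    have "ind_to_forms k (shapiro_cocycle ?w x) =
        (\<Sum>i\<in>I. mat_bact (rep i) (bX ^ (p - 1) * shapiro_cocycle ?w x (rep i)))"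
      by (rule ind_to_forms_eq[OF f.A.cocycle_closed[OF W(1) x]])
    also have "\<dots> = (\<Sum>i\<in>I. alpha_weight i (z (alpha_fact i x)))"
      by (intro sum.cong refl)
        (simp add: shapiro_cocycle_rep[OF w x] alpha_weight_def alpha_fact_def,
          simp add: restrict_conj_def alpha_diff_in[OF x])
    finally show "ind_to_forms k (shapiro_cocycle ?w x) = (\<Sum>i\<in>I. alpha_weight i (z (alpha_fact i x)))" .
  qed
  finally show ?thesis .
qed

section \<open>The map of Edixhoven and Khare\<close>

lemma group_module_EK: "group_module \<Gamma> (EK_proj_module N :: ('F, imat, ('F \<times> 'F) set \<Rightarrow> 'F bpoly) gmodule)"
  unfolding EK_proj_module_def
  by (rule group_module_fun_module[OF group_module_V])
    (simp_all add: mat_proj_closed mat_proj_mult Gamma1_det)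

lemma EK_carrier: "f \<in> carrier (EK_proj_module N) \<longleftrightarrow>
    f \<in> proj_line \<rightarrow>\<^sub>E {P :: 'F bpoly. form 0 P}"
proof -
  have "carrier (V 0) = {P. form 0 P}" by auto
  then show ?thesis by (simp add: EK_proj_module_def fun_module_def)
qed

lemma EK_mult: "f \<otimes>\<^bsub>EK_proj_module N\<^esub> f' = (\<lambda>P\<in>proj_line. f P + f' P :: 'F bpoly)"
  by (simp add: EK_proj_module_def fun_module_def)

lemma EK_act: "y \<in> carrier \<Gamma> \<Longrightarrow> gact (EK_proj_module N) y f =
    (\<lambda>P\<in>proj_line. mat_bact y (f (mat_proj (adj2 y) P)) :: 'F bpoly)"
  by (simp add: EK_proj_module_def fun_module_def Gamma1_inv)

text \<open>
  The choice of a group element in each fibre is immaterial: elements of the induced module are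
  constant on left cosets, as the action on \<open>V\<^sub>0\<close> is trivial.
\<close>

lemma EK_ind_to_proj_pt:
  assumes f: "f \<in> carrier (ind 0)" and x: "x \<in> carrier \<Gamma>"
  shows "EK_ind_to_proj N f (pt x) = f x"
proof -
  interpret i: induced_module \<Gamma> "V 0" \<Gamma>\<^sub>0 by (rule induced_module)
  define y where "y = (SOME y. y \<in> carrier \<Gamma> \<and> mat_proj y (proj_pt 1 0) = pt x)"
  have "y \<in> carrier \<Gamma> \<and> mat_proj y (proj_pt 1 0) = pt x"
    unfolding y_def by (rule someI[of _ x]) (simp add: x pt_def)
  then have y: "y \<in> carrier \<Gamma>" "pt x = pt y" by (simp_all add: pt_def)
  then have h: "adj2 x ** y \<in> \<Gamma>\<^sub>0" using pt_eq_iff[OF x y(1)] by simp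
  have "f y = f (x \<otimes>\<^bsub>\<Gamma>\<^esub> (adj2 x ** y))"
    using x by (simp add: matrix_mul_assoc adj2_inverse Gamma1_det)
  also have "\<dots> = f x"
    using i.Ind_mult_right[OF f x h] i.Ind_closed[OF f x] by (simp add: mat_bact_form_0)
  finally show ?thesis
    using x by (simp add: EK_ind_to_proj_def flip: y_def)
qed

lemma EK_ext: "EK_ind_to_proj N (f :: imat \<Rightarrow> 'F bpoly) \<in> extensional proj_line"
  by (simp add: EK_ind_to_proj_def)

lemma gmodule_hom_EK_ind_to_proj: "gmodule_hom \<Gamma> (ind 0) (EK_proj_module N) (EK_ind_to_proj N)"
proof -
  interpret i: induced_module \<Gamma> "V 0" \<Gamma>\<^sub>0 by (rule induced_module)
  interpret e: group_module \<Gamma> "EK_proj_module N :: ('F, imat, ('F \<times> 'F) set \<Rightarrow> 'F bpoly) gmodule"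
    by (rule group_module_EK)
  show ?thesis
  proof
    show "EK_ind_to_proj N \<in> hom (ind 0) (EK_proj_module N)"
    proof (rule homI)
      fix f assume f: "f \<in> carrier (ind 0)"
      have "form 0 (EK_ind_to_proj N f P)" if P: "P \<in> proj_line" for P
      proof -
        obtain x where "x \<in> carrier \<Gamma>" "P = pt x" using line_cases[OF P] by blast
        then show ?thesis using i.Ind_closed[OF f] by (simp add: EK_ind_to_proj_pt[OF f])
      qed
      then show "EK_ind_to_proj N f \<in> carrier (EK_proj_module N)"
        using EK_ext by (simp add: EK_carrier PiE_def)
    next
      fix f f' assume f: "f \<in> carrier (ind 0)" and f': "f' \<in> carrier (ind 0)"
      show "EK_ind_to_proj N (f \<otimes>\<^bsub>ind 0\<^esub> f') =
          EK_ind_to_proj N f \<otimes>\<^bsub>EK_proj_module N\<^esub> EK_ind_to_proj N f'"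
        by (rule line_ext)
          (simp_all add: EK_ext EK_mult EK_ind_to_proj_pt f f' i.I.M.m_closed, simp add: i.Ind_mult)
    qed
  next
    fix y f assume y: "y \<in> carrier \<Gamma>" and f: "f \<in> carrier (ind 0)"
    show "EK_ind_to_proj N (gact (ind 0) y f) = gact (EK_proj_module N) y (EK_ind_to_proj N f)"
    proof (rule line_ext)
      fix x assume x: "x \<in> carrier \<Gamma>"
      have "form 0 (f (adj2 y ** x))"
        using i.Ind_closed[OF f, of "adj2 y ** x"] x y by (simp add: Gamma1_closed adj2_Gamma1)
      then show "EK_ind_to_proj N (gact (ind 0) y f) (pt x) =
          gact (EK_proj_module N) y (EK_ind_to_proj N f) (pt x)"
        using x y EK_ind_to_proj_pt[OF i.I.act_closed[OF y f] x]
          EK_ind_to_proj_pt[OF f, of "adj2 y ** x"]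
        by (simp add: EK_act i.Ind_act Gamma1_inv mat_bact_form_0 Gamma1_closed adj2_Gamma1 flip: pt_mult)
    qed (simp_all add: EK_ext EK_act y)
  qed
qed

lemma EK_split_eq:
  "EK_split p (f :: ('F \<times> 'F) set \<Rightarrow> 'F bpoly) =
    (sum f proj_line, \<Sum>P\<in>proj_line. f P * line_power p P)"
proof -
  have "(\<Sum>P\<in>proj_line. (f P - sum f proj_line) * line_power p P) =
      (\<Sum>P\<in>proj_line. f P * line_power p P) - sum f proj_line * (\<Sum>P\<in>proj_line. line_power p P)"
    by (simp add: algebra_simps sum_subtractf sum_distrib_left)
  then show ?thesis
    by (simp add: EK_split_def const_zero_split_eq[OF sum_proj_line_const(2)] sum_line_power)
qed

lemma gmodule_hom_EK_split:
  "gmodule_hom \<Gamma> (EK_proj_module N) (dsum (V 0) (V (p - 1))) (EK_split p)"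
proof -
  interpret e: group_module \<Gamma> "EK_proj_module N :: ('F, imat, ('F \<times> 'F) set \<Rightarrow> 'F bpoly) gmodule"
    by (rule group_module_EK)
  interpret d: group_module \<Gamma> "dsum (V 0)
      (V (p - 1))"
    by (rule group_module_dsum[OF group_module_V group_module_V])
  show ?thesis
  proof
    show "EK_split p \<in> hom (EK_proj_module N)
        (dsum (V 0) (V (p - 1)))"
    proof (rule homI)
      fix f :: "('F \<times> 'F) set \<Rightarrow> 'F bpoly" assume "f \<in> carrier (EK_proj_module N)"
      then have f: "form 0 (f P)" if "P \<in> proj_line" for P using that by (auto simp: EK_carrier)
      have "form (0 + (p - 1)) (f P * line_power p P)" if "P \<in> proj_line" for P
        using that by (intro form_mult f line_power_form)
      then show "EK_split p f \<in> carrier (dsum (V 0) (V (p - 1)))"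
        unfolding EK_split_eq using f by (auto simp: dsum_def intro!: form_sum)
    next
      fix f f' :: "('F \<times> 'F) set \<Rightarrow> 'F bpoly"
      show "EK_split p (f \<otimes>\<^bsub>EK_proj_module N\<^esub> f') =
          EK_split p f \<otimes>\<^bsub>dsum (V 0) (V (p - 1))\<^esub> EK_split p f'"
        by (simp add: EK_split_eq EK_mult dsum_def sum.distrib algebra_simps)
    qed
  next
    fix y and f :: "('F \<times> 'F) set \<Rightarrow> 'F bpoly" assume y: "y \<in> carrier \<Gamma>"
    let ?f = "gact (EK_proj_module N) y f"
    have "sum ?f proj_line = mat_bact y (sum f proj_line)"
      using sum_line_act_inv[OF y, of "\<lambda>P. mat_bact y (f P)"] by (simp add: EK_act y mat_bact_sum)
    moreover have "(\<Sum>P\<in>proj_line. ?f P * line_power p P) = mat_bact y (\<Sum>P\<in>proj_line. f P * line_power p P)"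
    proof -
      have "(\<Sum>P\<in>proj_line. ?f P * line_power p P) =
          (\<Sum>P\<in>proj_line. mat_bact y (f (mat_proj (adj2 y) P)) * line_power p P)"
        by (simp add: EK_act y)
      also have "\<dots> = (\<Sum>P\<in>proj_line. mat_bact y (f (mat_proj (adj2 y) (mat_proj y P))) * line_power p (mat_proj y P))"
        by (rule sum_line_act[OF y, symmetric])
      also have "\<dots> = (\<Sum>P\<in>proj_line. mat_bact y (f P) * mat_bact y (line_power p P))"
        using y by (intro sum.cong refl)
          (simp add: line_power_act adj2_inverse Gamma1_det flip: mat_proj_mult)
      finally show ?thesis by (simp add: mat_bact_sum mat_bact_mult)
    qed
    ultimately show "EK_split p ?f =
        gact (dsum (V 0) (V (p - 1))) y (EK_split p f)"
      by (simp add: EK_split_eq dsum_def)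
  qed
qed

lemma gmodule_hom_EK_snd:
  "gmodule_hom \<Gamma> (dsum (V 0) (V (p - 1)))
    (V (p - 1)) snd"
proof -
  interpret d: group_module \<Gamma> "dsum (V 0)
      (V (p - 1))"
    by (rule group_module_dsum[OF group_module_V group_module_V])
  interpret v: group_module \<Gamma> "V (p - 1)" by (rule group_module_V)
  show ?thesis by unfold_locales (auto simp: dsum_def hom_def)
qed

text \<open>
  This is \<open>ind_to_forms_eq\<close> in degree zero, for the maps of Edixhoven and Khare.
\<close>

lemma EK_total:
  assumes f: "f \<in> carrier (ind 0)"
  shows "(snd \<circ> (EK_split p \<circ> EK_ind_to_proj N)) f =
    (\<Sum>i\<in>I. mat_bact (rep i) (bX ^ (p - 1) * f (rep i)))"
proof -
  interpret i: induced_module \<Gamma> "V 0" \<Gamma>\<^sub>0 by (rule induced_module)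
  have "(snd \<circ> (EK_split p \<circ> EK_ind_to_proj N)) f =
      (\<Sum>i\<in>I. EK_ind_to_proj N f (pt (rep i)) * line_power p (pt (rep i)))"
    by (simp add: EK_split_eq sum_proj_line)
  also have "\<dots> = (\<Sum>i\<in>I. mat_bact (rep i) (bX ^ (p - 1) * f (rep i)))"
    using i.Ind_closed[OF f rep_closed]
    by (intro sum.cong refl)
      (simp add: EK_ind_to_proj_pt[OF f rep_closed] line_power_rep mat_bact_mult mat_bact_form_0 mult.commute)
  finally show ?thesis .
qed

lemma alpha_EK_class:
  assumes z: "z \<in> cocycles \<Gamma> (V 0)"
  shows "alpha_EK N p (H1_class \<Gamma> (V 0) z) =
    H1_class \<Gamma> (V (p - 1)) (alpha_op 0 z)"
proof -
  let ?w = "restrict_conj z" and ?e = "snd \<circ> (EK_split p \<circ> EK_ind_to_proj N)"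
  note hom2 = gmodule_hom_comp[OF gmodule_hom_EK_ind_to_proj gmodule_hom_EK_split]
  interpret f: gmodule_hom \<Gamma> "ind 0" "V (p - 1)" ?e
    by (rule gmodule_hom_comp[OF hom2 gmodule_hom_EK_snd])
  have w: "?w \<in> cocycles (subgrp \<Gamma> \<Gamma>\<^sub>0) (V 0)"
    by (rule cochain_map.map_cocycle[OF restrict_conj_cochain_map z])
  note W = shapiro_class_eta[OF w]
  let ?y = "H1_class \<Gamma> (ind 0) (shapiro_cocycle ?w)"
  have y: "?y \<in> carrier (H1 \<Gamma> (ind 0))" by (rule f.A.H1_classI[OF W(1)])
  have "alpha_EK N p (H1_class \<Gamma> (V 0) z) =
      H1_coeff \<Gamma> (V (p - 1)) ?e ?y"
    unfolding alpha_EK_def Let_def EK_restrict_class[OF z] W(2)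
      H1_coeff_comp[OF gmodule_hom_EK_ind_to_proj gmodule_hom_EK_split y]
      H1_coeff_comp[OF hom2 gmodule_hom_EK_snd y] ..
  also have "\<dots> = H1_class \<Gamma> (V (p - 1)) (\<lambda>x\<in>carrier \<Gamma>. ?e (shapiro_cocycle ?w x))"
    by (rule f.H1_coeff_class[OF W(1)])
  also have "(\<lambda>x\<in>carrier \<Gamma>. ?e (shapiro_cocycle ?w x)) = alpha_op 0 z"
    unfolding alpha_op_eq[OF z]
  proof (rule restrict_ext)
    fix x assume x: "x \<in> carrier \<Gamma>"
    show "?e (shapiro_cocycle ?w x) = (\<Sum>i\<in>I. alpha_weight i (z (alpha_fact i x)))"
      unfolding EK_total[OF f.A.cocycle_closed[OF W(1) x]]
      by (intro sum.cong refl)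
        (simp add: shapiro_cocycle_rep[OF w x] alpha_weight_def alpha_fact_def,
          simp add: restrict_conj_def alpha_diff_in[OF x])
  qed
  finally show ?thesis .
qed

end

section \<open>Hecke operators of index prime to \<open>p\<close>\<close>

locale hecke_level = level_p p F N A B
  for p :: nat and F :: "'F::field itself" and N A B :: int +
  fixes r :: nat and R :: "imat set"
  assumes reps: "is_Hecke_reps N r R" and not_dvd_r: "\<not> p dvd r"
begin

lemma r_pos: "r > 0"
  using not_dvd_r by (cases r) auto

lemma not_int_dvd_r: "\<not> int p dvd int r"
  using not_dvd_r by simp

lemma finite_R: "finite R"
  using reps r_pos by (rule Hecke_reps_finite)

lemma R_Hecke_set: "d \<in> R \<Longrightarrow> d \<in> Hecke_set N r"
  using reps by (auto simp: is_Hecke_reps_def)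

lemma det_R: "d \<in> R \<Longrightarrow> det d = int r"
  using R_Hecke_set by (simp add: Hecke_set_def)

lemma R_unique:
  assumes "d \<in> R" "d' \<in> R" "y \<in> carrier \<Gamma>" "d = y ** d'"
  shows "d = d'"
proof -
  have "\<exists>!t. t \<in> R \<and> (\<exists>y\<in>carrier \<Gamma>. d = y ** t)"
    using reps R_Hecke_set[OF assms(1)] unfolding is_Hecke_reps_def by blast
  moreover have "d = mat 1 ** d" "mat 1 \<in> carrier \<Gamma>" by simp_all
  ultimately show ?thesis using assms by blast
qed

lemma R_exists: "M \<in> Hecke_set N r \<Longrightarrow> \<exists>y\<in>carrier \<Gamma>. \<exists>d\<in>R. M = y ** d"
  using reps unfolding is_Hecke_reps_def by blast

definition hecke_perm :: "imat \<Rightarrow> imat \<Rightarrow> imat" where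
  "hecke_perm d x = (THE d'. d' \<in> R \<and> (\<exists>y\<in>carrier \<Gamma>. d ** x = y ** d'))"

definition hecke_fact :: "imat \<Rightarrow> imat \<Rightarrow> imat" where
  "hecke_fact d x = (THE y. y \<in> carrier \<Gamma> \<and> (\<exists>d'\<in>R. d ** x = y ** d'))"

lemma hecke_factorization_unique:
  assumes "y \<in> carrier \<Gamma>" "d \<in> R" "y' \<in> carrier \<Gamma>" "d' \<in> R" "y ** d = y' ** d'"
  shows "y = y'" "d = d'"
proof -
  have "d = adj2 y ** (y ** d)"
    using assms(1) by (simp add: matrix_mul_assoc adj2_inverse Gamma1_det)
  then have "d = (adj2 y ** y') ** d'" by (simp add: assms(5) matrix_mul_assoc)
  then show d: "d = d'"
    using assms by (intro R_unique[of d d' "adj2 y ** y'"]) (simp_all add: Gamma1_closed adj2_Gamma1)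
  show "y = y'"
    using assms(5) r_pos by (intro imat_right_cancel[of y d]) (simp_all add: d det_R assms(4))
qed

lemma hecke_perm_fact_eqI:
  assumes "d ** x = y ** d'" "y \<in> carrier \<Gamma>" "d' \<in> R"
  shows "hecke_perm d x = d'" "hecke_fact d x = y"
proof -
  show "hecke_perm d x = d'"
    unfolding hecke_perm_def
  proof (rule the_equality)
    fix t assume "t \<in> R \<and> (\<exists>u\<in>carrier \<Gamma>. d ** x = u ** t)"
    then obtain u where "t \<in> R" "u \<in> carrier \<Gamma>" "u ** t = y ** d'" using assms(1) by auto
    then show "t = d'" using hecke_factorization_unique(2)[of u t y d'] assms by simp
  qed (use assms in blast)
  show "hecke_fact d x = y"
    unfolding hecke_fact_def
  proof (rule the_equality)
    fix u assume "u \<in> carrier \<Gamma> \<and> (\<exists>t\<in>R. d ** x = u ** t)"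
    then obtain t where "t \<in> R" "u \<in> carrier \<Gamma>" "u ** t = y ** d'" using assms(1) by auto
    then show "u = y" using hecke_factorization_unique(1)[of u t y d'] assms by simp
  qed (use assms in blast)
qed

lemma hecke_factorization:
  assumes d: "d \<in> R" and x: "x \<in> carrier \<Gamma>"
  shows "hecke_perm d x \<in> R" "hecke_fact d x \<in> carrier \<Gamma>"
    "d ** x = hecke_fact d x ** hecke_perm d x"
proof -
  have "d ** x \<in> Hecke_set N r"
    using Hecke_set_mult[OF R_Hecke_set[OF d], of x 1] x by (simp add: carrier_Gamma1)
  then obtain y d' where y: "y \<in> carrier \<Gamma>" "d' \<in> R" "d ** x = y ** d'" using R_exists by blast
  then show "hecke_perm d x \<in> R" "hecke_fact d x \<in> carrier \<Gamma>"
    "d ** x = hecke_fact d x ** hecke_perm d x"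
    by (simp_all add: hecke_perm_fact_eqI[OF y(3,1,2)])
qed

text \<open>
  Taking adjugates in \<open>d x = y d'\<close> gives \<open>adj(d) y = x adj(d')\<close>.
\<close>

lemma hecke_datum_R:
  "hecke_datum \<Gamma> (V k) (V k)
    R hecke_perm hecke_fact (\<lambda>d. mat_bact (adj2 d))"
proof -
  interpret v: group_module \<Gamma> "V k" by (rule group_module_V)
  show ?thesis
  proof
    fix d x y assume d: "d \<in> R" and x: "x \<in> carrier \<Gamma>" and y: "y \<in> carrier \<Gamma>"
    note dx = hecke_factorization[OF d x]
    note dxy = hecke_factorization[OF dx(1) y]
    have "d ** (x ** y) = (hecke_fact d x ** hecke_fact (hecke_perm d x) y) ** hecke_perm (hecke_perm d x) y"
      by (metis dx(3) dxy(3) matrix_mul_assoc)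
    from hecke_perm_fact_eqI[OF this Gamma1_closed[OF dx(2) dxy(2)] dxy(1)]
    show "hecke_perm d (x \<otimes>\<^bsub>\<Gamma>\<^esub> y) = hecke_perm (hecke_perm d x) y"
      "hecke_fact d (x \<otimes>\<^bsub>\<Gamma>\<^esub> y) = hecke_fact d x \<otimes>\<^bsub>\<Gamma>\<^esub> hecke_fact (hecke_perm d x) y"
      by simp_all
  next
    fix d assume "d \<in> R"
    then show "hecke_perm d \<one>\<^bsub>\<Gamma>\<^esub> = d"
      by (intro hecke_perm_fact_eqI(1)[of d _ "mat 1"]) simp_all
  next
    fix d x and m :: "'F bpoly" assume d: "d \<in> R" and x: "x \<in> carrier \<Gamma>"
    note dx = hecke_factorization[OF d x]
    have "adj2 d ** hecke_fact d x = (x ** adj2 x) ** adj2 d ** hecke_fact d x"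
      using x by (simp add: adj2_inverse Gamma1_det)
    also have "\<dots> = x ** adj2 (d ** x) ** hecke_fact d x"
      by (simp only: adj2_matmul matrix_mul_assoc)
    also have "\<dots> = x ** adj2 (hecke_perm d x) ** (adj2 (hecke_fact d x) ** hecke_fact d x)"
      by (simp only: dx(3) adj2_matmul matrix_mul_assoc)
    also have "\<dots> = x ** adj2 (hecke_perm d x)"
      using dx(2) by (simp add: adj2_inverse Gamma1_det)
    finally show "mat_bact (adj2 d) (gact (V k) (hecke_fact d x) m) =
        gact (V k) x (mat_bact (adj2 (hecke_perm d x)) m)"
      by (simp flip: mat_bact_matmul)
  next
    fix d show "mat_bact (adj2 d) \<in> hom (V k) (V k)"
      by (rule homI) (simp_all add: form_mat_bact mat_bact_add)
  qed (simp_all add: finite_R hecke_factorization)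
qed

definition hecke_op :: "nat \<Rightarrow> (imat \<Rightarrow> 'F bpoly) \<Rightarrow> imat \<Rightarrow> 'F bpoly" where
  "hecke_op k = hecke_datum.operator \<Gamma> (V k)
    R hecke_fact (\<lambda>d. mat_bact (adj2 d))"

lemma Hecke_cochain_eq: "Hecke_cochain N (V k) R = hecke_op k"
  by (intro ext) (simp add: hecke_op_def hecke_datum.operator_def[OF hecke_datum_R] Hecke_cochain_def
      hecke_fact_def)

section \<open>Commutation with the Hecke operators\<close>

text \<open>
  Up to the factor \<open>X\<^sup>p\<^sup>-\<^sup>1\<close> in the weights, \<open>alpha_op\<close> is the Hecke operator of these matrices:
  the adjugate of \<open>delta i\<close> is \<open>x\<^sub>i g\<^sup>*\<close>.
\<close>

definition delta :: "nat \<Rightarrow> imat" where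
  "delta i = gmat p ** adj2 (rep i)"

lemma det_gmat_p: "det (gmat p) = int p"
  by (simp add: gmat_def det_2)

lemma det_delta [simp]: "det (delta i) = int p"
  by (simp add: delta_def det_mul det_gmat_p)

lemma delta_mult:
  assumes x: "x \<in> carrier \<Gamma>"
  shows "delta i ** x = alpha_fact i x ** delta (alpha_perm i x)"
proof -
  have "alpha_fact i x ** delta (alpha_perm i x) =
      gmat p ** alpha_diff i x ** adj2 (rep (alpha_perm i x))"
    using gconj_gmat[of "alpha_diff i x"] alpha_diff_in[OF x, of i]
    by (simp add: alpha_fact_def delta_def Gamma10_iff matrix_mul_assoc)
  also have "\<dots> = gmat p ** adj2 (rep i) ** x ** (rep (alpha_perm i x) ** adj2 (rep (alpha_perm i x)))"
    by (simp only: alpha_diff_def matrix_mul_assoc)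
  finally show ?thesis by (simp add: adj2_inverse delta_def)
qed

lemma rep_eq_of_dvd:
  assumes "i \<in> I" "j \<in> I" "int p dvd (adj2 (rep i) ** rep j)$2$1"
  shows "i = j"
  using assms pt_eq_iff_dvd[OF det_rep det_rep, of i j] by (simp add: pt_rep_inj)

text \<open>
  Put \<open>E = \<delta>\<^sub>i adj(\<delta>\<^sub>i\<^sub>')\<close>.  The equation gives \<open>d E = p y d'\<close>; multiplying by the adjugate of \<open>d\<close> one gets
  that \<open>p\<close> divides \<open>r E\<close>, hence \<open>E\<close>.  But the lower left entry of \<open>E\<close> is that of \<open>x\<^sub>i\<^sup>-\<^sup>1 x\<^sub>i\<^sub>'\<close>, so that
  \<open>i = i'\<close>.
\<close>

lemma orbit_delta_R:
  assumes i: "i \<in> I" "i' \<in> I" and d: "d \<in> R" "d' \<in> R" and y: "y \<in> carrier \<Gamma>"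
    and eq: "d ** delta i = y ** (d' ** delta i')"
  shows "i = i'" "d = d'"
proof -
  define E where "E = delta i ** adj2 (delta i')"
  have "d ** E = (y ** d') ** (delta i' ** adj2 (delta i'))"
    unfolding E_def by (metis eq matrix_mul_assoc)
  then have dE: "(d ** E) $ a $ b = int p * (y ** d') $ a $ b" for a b
    by (simp add: adj2_scalar)
  have "int p dvd (adj2 d ** (d ** E)) $ 2 $ 1"
    by (rule dvd_matmul_right) (simp add: dE)
  then have "int p dvd int r * E $ 2 $ 1"
    by (simp add: adj2_scalar_left det_R d)
  then have "int p dvd E $ 2 $ 1"
    using not_int_dvd_r prime_p by (simp add: prime_dvd_mult_iff)
  moreover have "E = gmat p ** (adj2 (rep i) ** rep i') ** adj2 (gmat p)"
    by (simp add: E_def delta_def adj2_matmul matrix_mul_assoc)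
  then have "E $ 2 $ 1 = (adj2 (rep i) ** rep i') $ 2 $ 1"
    by (simp add: matmul_nth[of "gmat p"] matmul_nth[of "gmat p ** (adj2 (rep i) ** rep i')"]) (simp add: gmat_def)
  ultimately show "i = i'" using rep_eq_of_dvd[OF i] by simp
  then have "d ** delta i = (y ** d') ** delta i"
    using eq by (simp add: matrix_mul_assoc)
  then have "d = y ** d'"
    using p_gt_1 by (intro imat_right_cancel[of d "delta i" "y ** d'"]) simp_all
  then show "d = d'" by (rule R_unique[OF d y])
qed

text \<open>
  Put \<open>E = d adj(d')\<close>.  The equation gives \<open>\<delta>\<^sub>i E = r y \<delta>\<^sub>i\<^sub>'\<close>; multiplying by the adjugate of \<open>\<delta>\<^sub>i\<close> one gets
  that \<open>r\<close> divides \<open>p E\<close>, hence \<open>E\<close>.  So \<open>d\<close> and \<open>d'\<close> are in the same orbit and agree, and the rest is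
  the assertion that the points of \<open>x\<^sub>i\<close> and \<open>x\<^sub>i\<^sub>'\<close> agree.
\<close>

lemma orbit_R_delta:
  assumes i: "i \<in> I" "i' \<in> I" and d: "d \<in> R" "d' \<in> R" and y: "y \<in> carrier \<Gamma>"
    and eq: "delta i ** d = y ** (delta i' ** d')"
  shows "i = i'" "d = d'"
proof -
  define E where "E = d ** adj2 d'"
  have "delta i ** E = (y ** delta i') ** (d' ** adj2 d')"
    unfolding E_def by (metis eq matrix_mul_assoc)
  then have dE: "(delta i ** E) $ a $ b = int r * (y ** delta i') $ a $ b" for a b
    by (simp add: adj2_scalar det_R d)
  have "int r dvd (adj2 (delta i) ** (delta i ** E)) $ a $ b" for a b
    by (rule dvd_matmul_right) (simp add: dE)
  then have "int r dvd int p * E $ a $ b" for a b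
    by (simp add: adj2_scalar_left)
  moreover have "coprime (int r) (int p)"
    using prime_imp_coprime[OF prime_p not_dvd_r] by (simp add: coprime_commute)
  ultimately have "int r dvd E $ a $ b" for a b
    by (simp add: coprime_dvd_mult_right_iff)
  then obtain e where e: "\<And>a b. E $ a $ b = int r * e a b"
    unfolding dvd_def by metis
  define E' :: imat where "E' = (\<chi> a b. e a b)"
  have "\<And>a b. (d ** adj2 d') $ a $ b = int r * E' $ a $ b"
    using e by (simp add: E_def E'_def)
  from Hecke_set_left_quotient[OF R_Hecke_set[OF d(1)] R_Hecke_set[OF d(2)] r_pos this]
  show dd: "d = d'" using R_unique[OF d] by blast
  have "delta i ** d = (y ** delta i') ** d"
    using eq by (simp add: dd matrix_mul_assoc)
  then have "delta i = y ** delta i'"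
    using r_pos det_R[OF d(1)] by (intro imat_right_cancel[of "delta i" d "y ** delta i'"]) simp_all
  then have "gmat p ** (adj2 (rep i) ** rep i') = y ** gmat p ** (adj2 (rep i') ** rep i')"
    by (simp add: delta_def matrix_mul_assoc)
  then have "gmat p ** (adj2 (rep i) ** rep i') = y ** gmat p"
    by (simp add: adj2_inverse)
  then have "(gmat p ** (adj2 (rep i) ** rep i')) $ 2 $ 1 = (y ** gmat p) $ 2 $ 1" by simp
  then have "(adj2 (rep i) ** rep i') $ 2 $ 1 = y $ 2 $ 1 * int p"
    by (simp add: matmul_nth[of "gmat p"] matmul_nth[of y]) (simp add: gmat_def)
  then show "i = i'" using rep_eq_of_dvd[OF i] by simp
qed

lemma gconj_adj2: "int p dvd e$2$1 \<Longrightarrow> gconj p (adj2 e) = adj2 (gconj p e)"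
  by (simp add: gconj_eq imat_eq_iff dvd_neg_div)

text \<open>
  The index \<open>j\<close> is chosen so that \<open>d\<close> sends the \<open>j\<close>-th point to the \<open>i\<close>-th one; \<open>adj(d)\<close> is used for the
  inverse of \<open>d\<close>.  Then \<open>e = x\<^sub>i\<^sup>-\<^sup>1 d x\<^sub>j\<close> is upper triangular modulo \<open>p\<close>, and its conjugate by \<open>g\<close> lies in
  the Hecke set again, where it has the form \<open>y d'\<close>.  The weights match because \<open>adj(e)\<close> fixes
  \<open>X\<^sup>p\<^sup>-\<^sup>1\<close> and \<open>adj(e) g\<^sup>* = g\<^sup>* adj(y d')\<close>.
\<close>

lemma swap_exists:
  assumes d: "d \<in> R" and i: "i \<in> I"
  shows "\<exists>j\<in>I. \<exists>d'\<in>R. \<exists>y\<in>carrier \<Gamma>. delta i ** d = y ** (d' ** delta j) \<and>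
    (\<forall>v. mat_bact (adj2 d) (alpha_weight i (mat_bact y v)) = alpha_weight j (mat_bact (adj2 d') v))"
proof -
  \<comment> \<open>the first column of \<open>u\<close> gives the coordinates of the \<open>j\<close>-th point\<close>
  define u where "u = adj2 d ** rep i"
  have det_u: "det u = int r" by (simp add: u_def det_mul det_R d)
  have nz: "(of_int (u$1$1) :: 'F, of_int (u$2$1) :: 'F) \<noteq> (0, 0)"
    using of_int_col_nonzero[of u "u$2$2" "u$1$2"] det_u not_int_dvd_r
    by (simp add: det_2 algebra_simps)
  then have "(proj_pt (of_int (u$1$1)) (of_int (u$2$1)) :: ('F \<times> 'F) set) \<in> proj_line"
    unfolding proj_line_def using prime_subfield_of_int by blast
  then obtain j where j: "j \<in> I"
    and ptj: "pt (rep j) = (proj_pt (of_int (u$1$1)) (of_int (u$2$1)) :: ('F \<times> 'F) set)"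
    unfolding pt_rep by (metis imageE transv_pt_image)
  define e where "e = adj2 (rep i) ** d ** rep j"
  have "of_int (rep j$1$1) * of_int (u$2$1) = (of_int (rep j$2$1) * of_int (u$1$1) :: 'F)"
    using ptj unfolding pt_eq
    by (subst (asm) proj_pt_eq_iff) (use nz col_nonzero[OF det_rep] in auto)
  then have "of_int (rep j$1$1 * u$2$1 - rep j$2$1 * u$1$1) = (0::'F)" by simp
  then have "int p dvd rep j$1$1 * u$2$1 - rep j$2$1 * u$1$1" by (simp only: of_int_eq_0)
  moreover have "rep j$1$1 * u$2$1 - rep j$2$1 * u$1$1 = - (e$2$1)"
    by (simp add: e_def u_def matmul_nth algebra_simps)
  ultimately have p_e: "int p dvd e$2$1" by simp
  have "e \<in> Hecke_set N (1 * r * 1)"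
    unfolding e_def using d rep_closed[of j] adj2_Gamma1[OF rep_closed[of i]]
    by (intro Hecke_set_mult R_Hecke_set) (simp_all add: carrier_Gamma1)
  then have e: "e \<in> Hecke_set N r" by simp
  obtain y d' where y: "y \<in> carrier \<Gamma>" and d': "d' \<in> R" and D: "gconj p e = y ** d'"
    using R_exists[OF gconj_Hecke_set[OF e p_e]] by blast
  have "delta i ** d = gmat p ** adj2 (rep i) ** d ** (rep j ** adj2 (rep j))"
    by (simp add: delta_def adj2_inverse)
  also have "\<dots> = gmat p ** e ** adj2 (rep j)"
    by (simp only: e_def matrix_mul_assoc)
  also have "\<dots> = y ** (d' ** delta j)"
    unfolding gconj_gmat[OF p_e, symmetric] by (simp add: D delta_def matrix_mul_assoc)
  finally have delta: "delta i ** d = y ** (d' ** delta j)" .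
  have weight: "mat_bact (adj2 d) (alpha_weight i (mat_bact y v)) =
      alpha_weight j (mat_bact (adj2 d') v)" for v :: "'F bpoly"
  proof -
    have e21: "int p dvd adj2 e$2$1" using p_e by simp
    have e11: "\<not> int p dvd adj2 e$1$1"
      using not_dvd_diag(2)[OF p_e _ not_int_dvd_r] e by (simp add: Hecke_set_def)
    have "adj2 d ** rep i = rep j ** adj2 e"
      by (simp add: e_def adj2_matmul matrix_mul_assoc adj2_inverse)
    then have "mat_bact (adj2 d) (alpha_weight i (mat_bact y v)) =
        mat_bact (rep j) (mat_bact (adj2 e) (bX ^ (p - 1) * mat_bact (gstar p) (mat_bact y v)))"
      by (simp add: alpha_weight_def flip: mat_bact_matmul)
    also have "\<dots> = mat_bact (rep j) (bX ^ (p - 1) * mat_bact (gstar p) (mat_bact (adj2 (gconj p e)) (mat_bact y v)))"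
      by (simp only: bX_power_act[OF e21 e11] gstar_gconj[OF e21, symmetric] gconj_adj2[OF p_e])
    also have "mat_bact (adj2 (gconj p e)) (mat_bact y v) = mat_bact (adj2 d' ** (adj2 y ** y)) v"
      by (simp add: D adj2_matmul matrix_mul_assoc flip: mat_bact_matmul)
    also have "adj2 d' ** (adj2 y ** y) = adj2 d'"
      using y by (simp add: adj2_inverse Gamma1_det)
    finally show ?thesis by (simp add: alpha_weight_def)
  qed
  show ?thesis using j d' y delta weight by blast
qed

text \<open>
  Both sides are operators of Hecke data, with matrices \<open>\<delta>\<^sub>i d\<close> on the left and \<open>d \<delta>\<^sub>i\<close> on the right.
  The lemma \<open>swap_exists\<close> provides the map between the index sets.  It is injective because the
  elements \<open>\<delta>\<^sub>i d\<close> lie in different orbits, and therefore bijective.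
\<close>

lemma alpha_hecke_commute:
  assumes z: "z \<in> cocycles \<Gamma> (V k)"
  shows "H1_class \<Gamma> (V (k + (p - 1))) (hecke_op (k + (p - 1)) (alpha_op k z)) =
    H1_class \<Gamma> (V (k + (p - 1))) (alpha_op k (hecke_op k z))"
proof -
  \<comment> \<open>\<open>M1\<close> and \<open>M2\<close> are the matrices underlying the two composites\<close>
  define M1 :: "imat \<times> nat \<Rightarrow> imat" where "M1 = (\<lambda>(d, i). delta i ** d)"
  define M2 :: "nat \<times> imat \<Rightarrow> imat" where "M2 = (\<lambda>(i, d). d ** delta i)"
  define s1 where "s1 = (\<lambda>(d, i) x. (hecke_perm d x, alpha_perm i (hecke_fact d x)))"
  define s2 where "s2 = (\<lambda>(i, d) x. (alpha_perm i x, hecke_perm d (alpha_fact i x)))"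
  define r1 where "r1 = (\<lambda>(d, i) x. alpha_fact i (hecke_fact d x))"
  define r2 where "r2 = (\<lambda>(i, d) x. hecke_fact d (alpha_fact i x))"
  define w1 :: "imat \<times> nat \<Rightarrow> 'F bpoly \<Rightarrow> 'F bpoly"
    where "w1 = (\<lambda>(d, i). mat_bact (adj2 d) \<circ> alpha_weight i)"
  define w2 :: "nat \<times> imat \<Rightarrow> 'F bpoly \<Rightarrow> 'F bpoly"
    where "w2 = (\<lambda>(i, d). alpha_weight i \<circ> mat_bact (adj2 d))"
  interpret a: hecke_datum \<Gamma> "V k"
    "V (k + (p - 1))" "R \<times> I" s1 r1 w1
    unfolding s1_def r1_def w1_def by (rule hecke_datum_comp[OF alpha_datum hecke_datum_R])
  interpret b: hecke_datum \<Gamma> "V k"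
    "V (k + (p - 1))" "I \<times> R" s2 r2 w2
    unfolding s2_def r2_def w2_def by (rule hecke_datum_comp[OF hecke_datum_R alpha_datum])
  have op1: "hecke_op (k + (p - 1)) (alpha_op k z) = a.operator z"
    unfolding hecke_op_def alpha_op_def operator_comp[OF alpha_datum hecke_datum_R z] r1_def w1_def ..
  have op2: "alpha_op k (hecke_op k z) = b.operator z"
    unfolding hecke_op_def alpha_op_def operator_comp[OF hecke_datum_R alpha_datum z] r2_def w2_def ..
  have fact1: "M1 s ** x = r1 s x ** M1 (s1 s x)" if "s \<in> R \<times> I" "x \<in> carrier \<Gamma>" for s x
  proof -
    obtain d i where s: "s = (d, i)" "d \<in> R" using \<open>s \<in> R \<times> I\<close> by auto
    note dx = hecke_factorization[OF s(2) that(2)]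
    have "delta i ** d ** x = delta i ** hecke_fact d x ** hecke_perm d x"
      by (metis dx(3) matrix_mul_assoc)
    then show ?thesis
      by (simp add: s M1_def r1_def s1_def delta_mult[OF dx(2)] matrix_mul_assoc)
  qed
  have fact2: "M2 t ** x = r2 t x ** M2 (s2 t x)" if "t \<in> I \<times> R" "x \<in> carrier \<Gamma>" for t x
  proof -
    obtain i d where t: "t = (i, d)" "d \<in> R" "i \<in> I" using \<open>t \<in> I \<times> R\<close> by auto
    have y: "alpha_fact i x \<in> carrier \<Gamma>"
      by (simp add: alpha_fact_def gconj_Gamma1 alpha_diff_in that)
    note dy = hecke_factorization[OF t(2) y]
    have "d ** delta i ** x = (d ** alpha_fact i x) ** delta (alpha_perm i x)"
      using delta_mult[OF that(2), of i] by (metis matrix_mul_assoc)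
    then show ?thesis
      by (simp add: t M2_def r2_def s2_def dy(3) matrix_mul_assoc)
  qed
  have inj1: "s = s'" if "s \<in> R \<times> I" "s' \<in> R \<times> I" "y \<in> carrier \<Gamma>" "M1 s = y ** M1 s'" for s s' y
    using that orbit_R_delta[of "snd s" "snd s'" "fst s" "fst s'" y]
    by (cases s; cases s') (simp add: M1_def)
  have inj2: "t = t'" if "t \<in> I \<times> R" "t' \<in> I \<times> R" "y \<in> carrier \<Gamma>" "M2 t = y ** M2 t'" for t t' y
    using that orbit_delta_R[of "fst t" "fst t'" "snd t" "snd t'" y]
    by (cases t; cases t') (simp add: M2_def)
  have det2: "det (M2 t) \<noteq> 0" if "t \<in> I \<times> R" for t
    using that r_pos p_gt_1 by (auto simp: M2_def det_mul det_R)
  have "\<forall>s\<in>R \<times> I. \<exists>ty. fst ty \<in> I \<times> R \<and> snd ty \<in> carrier \<Gamma> \<and> M1 s = snd ty ** M2 (fst ty) \<and>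
      (\<forall>v. w1 s (mat_bact (snd ty) v) = w2 (fst ty) v)"
  proof
    fix s assume "s \<in> R \<times> I"
    then obtain d i where s: "s = (d, i)" "d \<in> R" "i \<in> I" by auto
    obtain j d' y where "j \<in> I" "d' \<in> R" "y \<in> carrier \<Gamma>" "delta i ** d = y ** (d' ** delta j)"
      "\<forall>v. mat_bact (adj2 d) (alpha_weight i (mat_bact y v)) = alpha_weight j (mat_bact (adj2 d') v)"
      using swap_exists[OF s(2,3)] by blast
    then show "\<exists>ty. fst ty \<in> I \<times> R \<and> snd ty \<in> carrier \<Gamma> \<and> M1 s = snd ty ** M2 (fst ty) \<and>
        (\<forall>v. w1 s (mat_bact (snd ty) v) = w2 (fst ty) v)"
      by (intro exI[of _ "((j, d'), y)"]) (simp add: s M1_def M2_def w1_def w2_def)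
  qed
  from bchoice[OF this] obtain F' where F': "\<forall>s\<in>R \<times> I. fst (F' s) \<in> I \<times> R \<and>
      snd (F' s) \<in> carrier \<Gamma> \<and> M1 s = snd (F' s) ** M2 (fst (F' s)) \<and>
      (\<forall>v. w1 s (mat_bact (snd (F' s)) v) = w2 (fst (F' s)) v)" ..
  define f where "f = (\<lambda>s. fst (F' s))"
  define y where "y = (\<lambda>s. snd (F' s))"
  have f_in: "f s \<in> I \<times> R" and y_in: "y s \<in> carrier \<Gamma>" and M1_M2: "M1 s = y s ** M2 (f s)"
    and weight: "w1 s (mat_bact (y s) v) = w2 (f s) v" if "s \<in> R \<times> I" for s v
    using bspec[OF F' that] by (simp_all only: f_def y_def)
  have "inj_on f (R \<times> I)"
  proof (rule inj_onI)
    fix s s' assume s: "s \<in> R \<times> I" and s': "s' \<in> R \<times> I" and ff: "f s = f s'"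
    have "M2 (f s') = adj2 (y s') ** M1 s'"
      using y_in[OF s'] by (simp add: M1_M2[OF s'] matrix_mul_assoc adj2_inverse Gamma1_det)
    then have "M1 s = (y s ** adj2 (y s')) ** M1 s'"
      unfolding M1_M2[OF s] ff by (simp add: matrix_mul_assoc)
    then show "s = s'"
      by (rule inj1[OF s s' Gamma1_closed[OF y_in[OF s] adj2_Gamma1[OF y_in[OF s']]]])
  qed
  moreover have "f ` (R \<times> I) = I \<times> R"
  proof (rule card_subset_eq)
    show "card (f ` (R \<times> I)) = card (I \<times> R)"
      using \<open>inj_on f (R \<times> I)\<close> by (simp add: card_image card_cartesian_product)
    show "f ` (R \<times> I) \<subseteq> I \<times> R" using f_in by (rule image_subsetI)
    show "finite (I \<times> R)" by (simp add: finite_R)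
  qed
  ultimately have bij: "bij_betw f (R \<times> I) (I \<times> R)" by (simp add: bij_betw_def)
  have fact: "r1 s x ** y (s1 s x) = y s ** r2 (f s) x" if s: "s \<in> R \<times> I" and x: "x \<in> carrier \<Gamma>" for s x
  proof -
    have s1: "s1 s x \<in> R \<times> I" and s2: "s2 (f s) x \<in> I \<times> R"
      and r1: "r1 s x \<in> carrier \<Gamma>" and r2: "r2 (f s) x \<in> carrier \<Gamma>"
      using s x f_in[OF s] by (auto intro: a.perm_closed b.perm_closed a.fact_closed b.fact_closed)
    have eq: "(r1 s x ** y (s1 s x)) ** M2 (f (s1 s x)) = (y s ** r2 (f s) x) ** M2 (s2 (f s) x)"
    proof -
      have "(r1 s x ** y (s1 s x)) ** M2 (f (s1 s x)) = M1 s ** x"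
        unfolding fact1[OF s x] M1_M2[OF s1] by (simp only: matrix_mul_assoc)
      also have "\<dots> = y s ** (M2 (f s) ** x)"
        unfolding M1_M2[OF s] by (simp only: matrix_mul_assoc)
      finally show ?thesis
        unfolding fact2[OF f_in[OF s] x] by (simp only: matrix_mul_assoc)
    qed
    let ?g = "r1 s x ** y (s1 s x)"
    have g: "?g \<in> carrier \<Gamma>" by (rule Gamma1_closed[OF r1 y_in[OF s1]])
    have "M2 (f (s1 s x)) = (adj2 ?g ** ?g) ** M2 (f (s1 s x))"
      using g by (simp add: adj2_inverse Gamma1_det)
    also have "\<dots> = adj2 ?g ** (?g ** M2 (f (s1 s x)))" by (simp only: matrix_mul_assoc)
    also have "\<dots> = (adj2 ?g ** (y s ** r2 (f s) x)) ** M2 (s2 (f s) x)"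
      unfolding eq by (simp only: matrix_mul_assoc)
    finally have "f (s1 s x) = s2 (f s) x"
      by (rule inj2[OF f_in[OF s1] s2 Gamma1_closed[OF adj2_Gamma1[OF g] Gamma1_closed[OF y_in[OF s] r2]]])
    then show ?thesis using eq det2[OF s2] by (auto intro: imat_right_cancel)
  qed
  show ?thesis
    unfolding op1 op2
  proof (rule equivalent_hecke_data[OF a.hecke_datum_axioms b.hecke_datum_axioms bij y_in _ _ z])
    fix s x assume "s \<in> R \<times> I" "x \<in> carrier \<Gamma>"
    from fact[OF this] show "r1 s x \<otimes>\<^bsub>\<Gamma>\<^esub> y (s1 s x) = y s \<otimes>\<^bsub>\<Gamma>\<^esub> r2 (f s) x" by simp
  next
    fix s and m :: "'F bpoly" assume "s \<in> R \<times> I"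
    from weight[OF this, of m] show "w1 s (gact (V k) (y s) m) = w2 (f s) m" by simp
  qed
qed

end

context level_p begin

lemma alpha_hom:
  "(alpha N p A B k :: (imat \<Rightarrow> 'F bpoly) set \<Rightarrow> _) \<in> hom (H1 \<Gamma> (V k)) (H1 \<Gamma> (V (k + (p - 1))))"
proof -
  interpret d: hecke_datum \<Gamma> "V k"
    "V (k + (p - 1))" I alpha_perm alpha_fact alpha_weight
    by (rule alpha_datum)
  interpret c: cochain_map \<Gamma> "V k"
    \<Gamma> "V (k + (p - 1))" "alpha_op k"
    unfolding alpha_op_def by (rule d.operator_cochain_map)
  let ?H = "H1_map \<Gamma> (V (k + (p - 1))) (alpha_op k)"
  have eq: "alpha N p A B k c = ?H c" if "c \<in> carrier (H1 \<Gamma> (V k))" for c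
    using that unfolding d.A.carrier_H1 by (elim imageE) (simp add: alpha_class c.H1_map_class)
  interpret h: comm_group "H1 \<Gamma> (V k)" by (rule d.A.comm_group_H1)
  show ?thesis
    by (rule homI) (simp_all add: eq hom_in_carrier[OF c.H1_map_hom] hom_mult[OF c.H1_map_hom])
qed

lemma gmodule_hom_scal:
  "gmodule_hom \<Gamma> (V k) (V k) (scal (V k) c)"
proof -
  interpret v: group_module \<Gamma> "V k" by (rule group_module_V)
  show ?thesis
    by unfold_locales (auto simp: hom_def form_bconst_mult mat_bact_mult distrib_left)
qed

lemma alpha_scal:
  assumes x: "x \<in> carrier (H1 \<Gamma> (V k))"
  shows "alpha N p A B k (H1_scal \<Gamma> (V k) c x) = H1_scal \<Gamma> (V (k + (p - 1))) c (alpha N p A B k x)"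
proof -
  interpret d: hecke_datum \<Gamma> "V k"
    "V (k + (p - 1))" I alpha_perm alpha_fact alpha_weight
    by (rule alpha_datum)
  interpret s: gmodule_hom \<Gamma> "V k" "V k"
    "scal (V k) c" by (rule gmodule_hom_scal)
  interpret s': gmodule_hom \<Gamma> "V (k + (p - 1))"
    "V (k + (p - 1))" "scal (V (k + (p - 1))) c" by (rule gmodule_hom_scal)
  from x obtain z where z: "z \<in> cocycles \<Gamma> (V k)"
    and xz: "x = H1_class \<Gamma> (V k) z" unfolding d.A.carrier_H1 by (elim imageE)
  have az: "alpha_op k z \<in> cocycles \<Gamma> (V (k + (p - 1)))"
    unfolding alpha_op_def by (rule cochain_map.map_cocycle[OF d.operator_cochain_map z])
  have cz: "(\<lambda>y\<in>carrier \<Gamma>. scal (V k) c (z y)) \<in> cocycles \<Gamma> (V k)"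
    by (rule s.coeff_cocycle[OF z])
  have "alpha_op k (\<lambda>y\<in>carrier \<Gamma>. scal (V k) c (z y)) =
      (\<lambda>y\<in>carrier \<Gamma>. scal (V (k + (p - 1))) c (alpha_op k z y))"
    unfolding alpha_op_eq[OF cz] alpha_op_eq[OF z]
  proof (rule restrict_ext)
    fix y assume "y \<in> carrier \<Gamma>"
    moreover have "alpha_weight i (bconst c * v) = bconst c * alpha_weight i v" for i and v :: "'F bpoly"
      by (simp add: alpha_weight_def mat_bact_mult algebra_simps)
    ultimately show "(\<Sum>i\<in>I. alpha_weight i ((\<lambda>y\<in>carrier \<Gamma>. scal (V k) c (z y)) (alpha_fact i y))) =
        scal (V (k + (p - 1))) c ((\<lambda>x\<in>carrier \<Gamma>. \<Sum>i\<in>I. alpha_weight i (z (alpha_fact i x))) y)"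
      by (simp add: alpha_fact_def gconj_Gamma1 alpha_diff_in sum_distrib_left)
  qed
  then show ?thesis
    by (simp only: xz H1_scal_def s.H1_coeff_class[OF z] alpha_class[OF cz] alpha_class[OF z]
        s'.H1_coeff_class[OF az])
qed

lemma alpha_Hecke_T:
  assumes r: "\<not> p dvd r" and x: "x \<in> carrier (H1 \<Gamma> (V k))"
  shows "alpha N p A B k (Hecke_T N (V k) r x) =
    Hecke_T N (V (k + (p - 1))) r (alpha N p A B k x)"
proof -
  define R where "R = (SOME R. is_Hecke_reps N r R)"
  have "is_Hecke_reps N r R" unfolding R_def by (rule someI_ex[OF Hecke_reps_exist])
  then interpret hecke_level p F N A B r R by unfold_locales (use r in auto)
  interpret d: hecke_datum \<Gamma> "V k"
    "V (k + (p - 1))" I alpha_perm alpha_fact alpha_weight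
    by (rule alpha_datum)
  have op: "cochain_map \<Gamma> (V l) \<Gamma> (V l) (hecke_op l)" for l
    unfolding hecke_op_def by (rule hecke_datum.operator_cochain_map[OF hecke_datum_R])
  have T: "Hecke_T N (V l) r (H1_class \<Gamma> (V l) w) =
      H1_class \<Gamma> (V l) (hecke_op l w)" if "w \<in> cocycles \<Gamma> (V l)" for l w
    unfolding Hecke_T_def R_def[symmetric] Hecke_cochain_eq
    by (rule cochain_map.H1_map_class[OF op that])
  from x obtain z where z: "z \<in> cocycles \<Gamma> (V k)"
    and xz: "x = H1_class \<Gamma> (V k) z" unfolding d.A.carrier_H1 by (elim imageE)
  have az: "alpha_op k z \<in> cocycles \<Gamma> (V (k + (p - 1)))"
    unfolding alpha_op_def by (rule cochain_map.map_cocycle[OF d.operator_cochain_map z])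
  show ?thesis
    unfolding xz T[OF z] alpha_class[OF z] T[OF az] alpha_class[OF cochain_map.map_cocycle[OF op z]]
    by (rule alpha_hecke_commute[OF z, symmetric])
qed

lemma alpha_0_eq_alpha_EK:
  assumes x: "x \<in> carrier (H1 \<Gamma> (V 0))"
  shows "alpha N p A B 0 x = alpha_EK N p x"
proof -
  from x obtain z where z: "z \<in> cocycles \<Gamma> (V 0)"
    and xz: "x = H1_class \<Gamma> (V 0) z"
    unfolding group_module.carrier_H1[OF group_module_V] by (elim imageE)
  show ?thesis
    using alpha_class[OF z] alpha_EK_class[OF z] by (simp add: xz)
qed

end

theorem proposition5p3:
  fixes N A B :: int and p :: nat
  assumes "prime p" and "p > 3" and "N \<ge> 5" and "\<not> int p dvd N"
    and "A * N + B * int p = 1"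
    and "is_Fp_closure TYPE('F::alg_closed_field) p"
  shows "(\<forall>k.
      (alpha N p A B k :: (imat \<Rightarrow> 'F bpoly) set \<Rightarrow> _)
        \<in> hom (H1 (Gamma1 N) (Vk k)) (H1 (Gamma1 N) (Vk (k + (p - 1)))) \<and>
      (\<forall>(c :: 'F). \<forall>x\<in>carrier (H1 (Gamma1 N) (Vk k)).
        alpha N p A B k (H1_scal (Gamma1 N) (Vk k) c x)
          = H1_scal (Gamma1 N) (Vk (k + (p - 1))) c (alpha N p A B k x)) \<and>
      (\<forall>r. \<not> p dvd r \<longrightarrow>
        (\<forall>x\<in>carrier (H1 (Gamma1 N) (Vk k :: ('F, imat, 'F bpoly) gmodule)).
          alpha N p A B k (Hecke_T N (Vk k :: ('F, imat, 'F bpoly) gmodule) r x)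
            = Hecke_T N (Vk (k + (p - 1)) :: ('F, imat, 'F bpoly) gmodule) r
                (alpha N p A B k x)))) \<and>
    (\<forall>x\<in>carrier (H1 (Gamma1 N) (Vk 0 :: ('F, imat, 'F bpoly) gmodule)).
      alpha N p A B 0 x = alpha_EK N p x)"
proof -
  interpret level_p p "TYPE('F)" N A B
    using assms by unfold_locales (simp_all add: is_Fp_closure_def)
  show ?thesis
    by (intro conjI allI ballI impI alpha_hom alpha_scal alpha_Hecke_T alpha_0_eq_alpha_EK)
qed

end
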